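(* Let $\Bbbk$ be any field, let $n$ be a positive integer, and let $R = \Bbbk[\mathbb{R}^n_+]$. Set $\mathfrak{m}_1 = \langle x_n^\varepsilon \mid \varepsilon > 0\rangle \subseteq R$ and $J = \langle x_1,\dots,x_{n-1}\rangle \subseteq R$. Using $x = x_n$ as the variable of $R_1 = \Bbbk[\mathbb{R}_+]$, let $F = \bigoplus_{k\in\mathbb{N}} \langle x^{\varepsilon_k}\rangle$ be the direct sum of the principal ideals of $R_1$ generated by $x^{\varepsilon_k}$, where $\{\varepsilon_k\}_{k\in\mathbb{N}}$ is a strictly decreasing sequence of positive real numbers with limit $0$. Consider $F$ as an $R$-module via the surjection $R \twoheadrightarrow R_1$ under which $x_i^\varepsilon \mapsto 0$ for all $\varepsilon > 0$ and $i \leq n-1$. Then $\operatorname{Ext}^{n+1}_R(R/I, F) \neq 0$ when $I = J + \mathfrak{m}_1$.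
   Context: $\mathbb{R}_+$ is the additive monoid of nonnegative real numbers and $\mathbb{R}^n_+ = \prod_{i=1}^n\mathbb{R}_+$. $R = \Bbbk[\mathbb{R}^n_+]$ is the monoid algebra (real-exponent polynomials in $n$ variables), with elements the finite $\Bbbk$-linear combinations of monomials $\mathbf{x}^{\mathbf{a}} = x_1^{a_1}\cdots x_n^{a_n}$, $\mathbf{a} \in \mathbb{R}^n_+$; $R_1 = \Bbbk[\mathbb{R}_+]$ is the case $n=1$. The surjection $R \twoheadrightarrow R_1$ is the $\Bbbk$-algebra map that also sends $x_n^\varepsilon \mapsto x^\varepsilon$. *)

theory Defs
  imports Complex_Main "HOL-Algebra.QuotRing" "HOL-Algebra.Module" "HOL-Library.Poly_Mapping"
begin

section \<open>Modules over a commutative ring\<close>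

text \<open>
  Modules are records of HOL-Algebra; their fields \<open>mult\<close> and \<open>one\<close> play no role
  (the locale \<^locale>\<open>module\<close> ignores them) and are left unspecified.
\<close>

definition regular_module :: "('r, 'x) ring_scheme \<Rightarrow> ('r, 'r) module" where
  "regular_module R =
    \<lparr>carrier = carrier R, mult = undefined, one = undefined,
     zero = \<zero>\<^bsub>R\<^esub>, add = add R, smult = mult R\<rparr>"

definition submodule_on :: "'a set \<Rightarrow> ('r, 'a) module \<Rightarrow> ('r, 'a) module" where
  "submodule_on K M = M\<lparr>carrier := K\<rparr>"

definition quotient_module :: "('r, 'a) module \<Rightarrow> 'a set \<Rightarrow> ('r, 'a set) module" where
  "quotient_module M K =
    \<lparr>carrier = a_rcosets\<^bsub>M\<^esub> K, mult = undefined, one = undefined,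
     zero = K, add = set_add M, smult = (\<lambda>r X. \<Union>x\<in>X. K +>\<^bsub>M\<^esub> (r \<odot>\<^bsub>M\<^esub> x))\<rparr>"

definition restrict_scalars :: "('r \<Rightarrow> 's) \<Rightarrow> ('s, 'a) module \<Rightarrow> ('r, 'a) module" where
  "restrict_scalars h M =
    \<lparr>carrier = carrier M, mult = undefined, one = undefined,
     zero = \<zero>\<^bsub>M\<^esub>, add = add M, smult = (\<lambda>r. smult M (h r))\<rparr>"

definition direct_sum :: "'i set \<Rightarrow> ('i \<Rightarrow> ('r, 'a) module) \<Rightarrow> ('r, 'i \<Rightarrow> 'a) module" where
  "direct_sum S M =
    \<lparr>carrier = {f \<in> (\<Pi>\<^sub>E i\<in>S. carrier (M i)). finite {i\<in>S. f i \<noteq> \<zero>\<^bsub>M i\<^esub>}},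
     mult = undefined, one = undefined,
     zero = (\<lambda>i\<in>S. \<zero>\<^bsub>M i\<^esub>),
     add = (\<lambda>f g. \<lambda>i\<in>S. f i \<oplus>\<^bsub>M i\<^esub> g i),
     smult = (\<lambda>r f. \<lambda>i\<in>S. r \<odot>\<^bsub>M i\<^esub> f i)\<rparr>"

definition module_homs ::
    "('r, 'x) ring_scheme \<Rightarrow> ('r, 'a) module \<Rightarrow> ('r, 'b) module \<Rightarrow> ('a \<Rightarrow> 'b) set" where
  "module_homs R M N =
    {f \<in> carrier M \<rightarrow>\<^sub>E carrier N.
       (\<forall>x\<in>carrier M. \<forall>y\<in>carrier M. f (x \<oplus>\<^bsub>M\<^esub> y) = f x \<oplus>\<^bsub>N\<^esub> f y) \<and>
       (\<forall>r\<in>carrier R. \<forall>x\<in>carrier M. f (r \<odot>\<^bsub>M\<^esub> x) = r \<odot>\<^bsub>N\<^esub> f x)}"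

definition Hom_module ::
    "('r, 'x) ring_scheme \<Rightarrow> ('r, 'a) module \<Rightarrow> ('r, 'b) module \<Rightarrow> ('r, 'a \<Rightarrow> 'b) module" where
  "Hom_module R M N =
    \<lparr>carrier = module_homs R M N, mult = undefined, one = undefined,
     zero = (\<lambda>x\<in>carrier M. \<zero>\<^bsub>N\<^esub>),
     add = (\<lambda>f g. \<lambda>x\<in>carrier M. f x \<oplus>\<^bsub>N\<^esub> g x),
     smult = (\<lambda>r f. \<lambda>x\<in>carrier M. r \<odot>\<^bsub>N\<^esub> f x)\<rparr>"


section \<open>Free modules\<close>

definition free_module :: "('r, 'x) ring_scheme \<Rightarrow> 's set \<Rightarrow> ('r, 's \<Rightarrow> 'r) module" where
  "free_module R S = direct_sum S (\<lambda>_. regular_module R)"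

definition free_basis :: "('r, 'x) ring_scheme \<Rightarrow> 's set \<Rightarrow> 's \<Rightarrow> 's \<Rightarrow> 'r" where
  "free_basis R S s = (\<lambda>t\<in>S. if t = s then \<one>\<^bsub>R\<^esub> else \<zero>\<^bsub>R\<^esub>)"

text \<open>The linear extension to \<open>free_module R S\<close> of a map \<open>g\<close> from \<open>S\<close> to a module.\<close>

definition free_lift ::
    "('r, 'x) ring_scheme \<Rightarrow> 's set \<Rightarrow> ('r, 'a) module \<Rightarrow> ('s \<Rightarrow> 'a) \<Rightarrow> ('s \<Rightarrow> 'r) \<Rightarrow> 'a" where
  "free_lift R S M g =
    (\<lambda>f\<in>carrier (free_module R S). \<Oplus>\<^bsub>M\<^esub>s\<in>{s\<in>S. f s \<noteq> \<zero>\<^bsub>R\<^esub>}. f s \<odot>\<^bsub>M\<^esub> g s)"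

text \<open>The element \<open>r\<^sub>1 e\<^bsub>s\<^sub>1\<^esub> + \<dots> + r\<^sub>k e\<^bsub>s\<^sub>k\<^esub>\<close> of \<open>free_module R S\<close> written as a list of pairs.\<close>

definition free_vec :: "('r, 'x) ring_scheme \<Rightarrow> 's set \<Rightarrow> ('r \<times> 's) list \<Rightarrow> 's \<Rightarrow> 'r" where
  "free_vec R S l =
    foldr (\<lambda>(r, s) v. (r \<odot>\<^bsub>free_module R S\<^esub> free_basis R S s) \<oplus>\<^bsub>free_module R S\<^esub> v)
      l \<zero>\<^bsub>free_module R S\<^esub>"


section \<open>The Ext modules\<close>

text \<open>
  \<open>Ext\<close> is the cohomology of \<open>Hom(P, N)\<close> for a free resolution \<open>P\<close> of \<open>M\<close>. Since it does not
  depend on \<open>P\<close>, we fix the following one, which exists for every \<open>R\<close> and \<open>M\<close>: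
  \<open>P\<^sub>0\<close> is free on all elements of \<open>M\<close>, and \<open>P\<^bsub>i+1\<^esub>\<close> is free on all expressions
  \<open>r\<^sub>1 e\<^bsub>s\<^sub>1\<^esub> + \<dots> + r\<^sub>k e\<^bsub>s\<^sub>k\<^esub>\<close> whose value in \<open>P\<^sub>i\<close> is a cycle. The basis elements of all the \<open>P\<^sub>i\<close>
  live in one datatype of formal symbols: \<open>Gen m\<close> is the basis element of \<open>P\<^sub>0\<close> mapping to \<open>m\<close>,
  and \<open>Rel l\<close> is the basis element of \<open>P\<^bsub>i+1\<^esub>\<close> mapping to \<open>free_vec\<close> of \<open>l\<close> in \<open>P\<^sub>i\<close>.
\<close>

datatype ('r, 'm) symb = Gen (gen_of: 'm) | Rel (rel_of: "('r \<times> ('r, 'm) symb) list")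

fun res_basis ::
    "('r, 'x) ring_scheme \<Rightarrow> ('r, 'm) module \<Rightarrow> nat \<Rightarrow> ('r, 'm) symb set" where
  "res_basis R M 0 = Gen ` carrier M"
| "res_basis R M (Suc 0) =
    {Rel l |l. set l \<subseteq> carrier R \<times> res_basis R M 0 \<and>
       free_lift R (res_basis R M 0) M gen_of (free_vec R (res_basis R M 0) l) = \<zero>\<^bsub>M\<^esub>}"
| "res_basis R M (Suc (Suc i)) =
    {Rel l |l. set l \<subseteq> carrier R \<times> res_basis R M (Suc i) \<and>
       free_lift R (res_basis R M (Suc i)) (free_module R (res_basis R M i))
         (\<lambda>s. free_vec R (res_basis R M i) (rel_of s)) (free_vec R (res_basis R M (Suc i)) l)
       = \<zero>\<^bsub>free_module R (res_basis R M i)\<^esub>}"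

definition res_module ::
    "('r, 'x) ring_scheme \<Rightarrow> ('r, 'm) module \<Rightarrow> nat \<Rightarrow> ('r, ('r, 'm) symb \<Rightarrow> 'r) module" where
  "res_module R M i = free_module R (res_basis R M i)"

definition res_aug ::
    "('r, 'x) ring_scheme \<Rightarrow> ('r, 'm) module \<Rightarrow> (('r, 'm) symb \<Rightarrow> 'r) \<Rightarrow> 'm" where
  "res_aug R M = free_lift R (res_basis R M 0) M gen_of"

text \<open>\<open>res_diff R M i\<close> is the differential from degree \<open>i + 1\<close> to degree \<open>i\<close>.\<close>

definition res_diff ::
    "('r, 'x) ring_scheme \<Rightarrow> ('r, 'm) module \<Rightarrow> nat \<Rightarrow>
      (('r, 'm) symb \<Rightarrow> 'r) \<Rightarrow> ('r, 'm) symb \<Rightarrow> 'r" where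
  "res_diff R M i =
    free_lift R (res_basis R M (Suc i)) (res_module R M i)
      (\<lambda>s. free_vec R (res_basis R M i) (rel_of s))"

definition Ext_cochains ::
    "('r, 'x) ring_scheme \<Rightarrow> nat \<Rightarrow> ('r, 'm) module \<Rightarrow> ('r, 'a) module \<Rightarrow>
      ('r, (('r, 'm) symb \<Rightarrow> 'r) \<Rightarrow> 'a) module" where
  "Ext_cochains R i M N = Hom_module R (res_module R M i) N"

definition Ext_coboundary ::
    "('r, 'x) ring_scheme \<Rightarrow> nat \<Rightarrow> ('r, 'm) module \<Rightarrow>
      ((('r, 'm) symb \<Rightarrow> 'r) \<Rightarrow> 'a) \<Rightarrow> (('r, 'm) symb \<Rightarrow> 'r) \<Rightarrow> 'a" where
  "Ext_coboundary R i M \<phi> = (\<lambda>v\<in>carrier (res_module R M (Suc i)). \<phi> (res_diff R M i v))"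

definition Ext_cocycles ::
    "('r, 'x) ring_scheme \<Rightarrow> nat \<Rightarrow> ('r, 'm) module \<Rightarrow> ('r, 'a) module \<Rightarrow>
      ((('r, 'm) symb \<Rightarrow> 'r) \<Rightarrow> 'a) set" where
  "Ext_cocycles R i M N =
    {\<phi> \<in> carrier (Ext_cochains R i M N).
       Ext_coboundary R i M \<phi> = \<zero>\<^bsub>Ext_cochains R (Suc i) M N\<^esub>}"

definition Ext_coboundaries ::
    "('r, 'x) ring_scheme \<Rightarrow> nat \<Rightarrow> ('r, 'm) module \<Rightarrow> ('r, 'a) module \<Rightarrow>
      ((('r, 'm) symb \<Rightarrow> 'r) \<Rightarrow> 'a) set" where
  "Ext_coboundaries R i M N =
    (case i of 0 \<Rightarrow> {\<zero>\<^bsub>Ext_cochains R 0 M N\<^esub>}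
     | Suc j \<Rightarrow> Ext_coboundary R j M ` carrier (Ext_cochains R j M N))"

definition Ext ::
    "('r, 'x) ring_scheme \<Rightarrow> nat \<Rightarrow> ('r, 'm) module \<Rightarrow> ('r, 'a) module \<Rightarrow>
      ('r, ((('r, 'm) symb \<Rightarrow> 'r) \<Rightarrow> 'a) set) module" where
  "Ext R i M N =
    quotient_module (submodule_on (Ext_cocycles R i M N) (Ext_cochains R i M N))
      (Ext_coboundaries R i M N)"


section \<open>Real-exponent polynomials\<close>

text \<open>
  A monomial \<open>x\<^sub>1\<^bsup>a\<^sub>1\<^esup> \<cdots> x\<^sub>n\<^bsup>a\<^sub>n\<^esup>\<close> is represented by its exponent vector
  \<open>a :: nat \<Rightarrow>\<^sub>0 real\<close>, indexed by \<open>{1..n}\<close>.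
\<close>

definition nonneg_exps :: "nat \<Rightarrow> (nat \<Rightarrow>\<^sub>0 real) set" where
  "nonneg_exps n = {a. Poly_Mapping.keys a \<subseteq> {1..n} \<and> (\<forall>i. 0 \<le> Poly_Mapping.lookup a i)}"

definition real_poly_ring :: "nat \<Rightarrow> ((nat \<Rightarrow>\<^sub>0 real) \<Rightarrow>\<^sub>0 'k::field) ring" where
  "real_poly_ring n =
    \<lparr>carrier = {p. Poly_Mapping.keys p \<subseteq> nonneg_exps n}, mult = (*), one = 1, zero = 0, add = (+)\<rparr>"

definition var_pow :: "nat \<Rightarrow> real \<Rightarrow> ((nat \<Rightarrow>\<^sub>0 real) \<Rightarrow>\<^sub>0 'k::field)" where
  "var_pow i \<epsilon> = Poly_Mapping.single (Poly_Mapping.single i \<epsilon>) 1"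

text \<open>
  The \<open>k\<close>-algebra map from \<open>k[\<real>\<^sub>+\<^sup>n]\<close> to \<open>k[\<real>\<^sub>+]\<close>: monomials involving some \<open>x\<^sub>i\<close> with \<open>i < n\<close> go to
  \<open>0\<close>, and \<open>x\<^sub>n\<close> is renamed to \<open>x\<close>, the only variable (of index \<open>1\<close>) of \<^term>\<open>real_poly_ring 1\<close>.
\<close>

definition to_last_var ::
    "nat \<Rightarrow> ((nat \<Rightarrow>\<^sub>0 real) \<Rightarrow>\<^sub>0 'k::field) \<Rightarrow> ((nat \<Rightarrow>\<^sub>0 real) \<Rightarrow>\<^sub>0 'k)" where
  "to_last_var n p =
    (\<Sum>a\<in>{a\<in>Poly_Mapping.keys p. Poly_Mapping.keys a \<subseteq> {n}}.
       Poly_Mapping.single (Poly_Mapping.single 1 (Poly_Mapping.lookup a n)) (Poly_Mapping.lookup p a))"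

section \<open>Well-formedness of these constructions\<close>


lemma regular_module_module: "cring R \<Longrightarrow> Module.module R (regular_module R)"
proof -
  assume "cring R"
  then interpret R: cring R .
  show ?thesis
    by (rule moduleI)
       (auto simp: regular_module_def R.l_distr R.r_distr R.m_assoc \<open>cring R\<close> R.a_ac
             intro!: abelian_groupI intro: R.l_neg)
qed

lemma direct_sum_module:
  assumes R: "cring R" and M: "\<And>i. i \<in> S \<Longrightarrow> Module.module R (M i)"
  shows "Module.module R (direct_sum S M)"
proof -
  interpret R: cring R by fact
  have ag: "abelian_group (M i)" if "i \<in> S" for i
    using M[OF that] by (simp add: Module.module_def)
  note am = ag[THEN abelian_group.axioms(1)]
  note [simp] = abelian_monoid.zero_closed[OF am] abelian_monoid.a_closed[OF am]
    abelian_monoid.l_zero[OF am] abelian_monoid.r_zero[OF am] abelian_group.a_inv_closed[OF ag]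
    module.smult_closed[OF M] abelian_group.l_neg[OF ag] abelian_group.r_neg[OF ag]
    module.smult_r_null[OF M] module.smult_one[OF M] abelian_group.a_inv_closed[OF ag]
  have fin: "finite {i \<in> S. f i \<oplus>\<^bsub>M i\<^esub> g i \<noteq> \<zero>\<^bsub>M i\<^esub>}"
    if "finite {i \<in> S. f i \<noteq> \<zero>\<^bsub>M i\<^esub>}" "finite {i \<in> S. g i \<noteq> \<zero>\<^bsub>M i\<^esub>}" for f g
    by (rule finite_subset[OF _ finite_UnI[OF that]]) auto
  have fin': "finite {i \<in> S. r \<odot>\<^bsub>M i\<^esub> f i \<noteq> \<zero>\<^bsub>M i\<^esub>}"
    if "finite {i \<in> S. f i \<noteq> \<zero>\<^bsub>M i\<^esub>}" "r \<in> carrier R" for f r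
    by (rule finite_subset[OF _ that(1)]) (use that in auto)
  show ?thesis
  proof (rule moduleI)
    show "abelian_group (direct_sum S M)"
    proof (rule abelian_groupI)
      fix x assume x: "x \<in> carrier (direct_sum S M)"
      let ?y = "\<lambda>i\<in>S. \<ominus>\<^bsub>M i\<^esub> x i"
      have f: "finite {i \<in> S. \<ominus>\<^bsub>M i\<^esub> x i \<noteq> \<zero>\<^bsub>M i\<^esub>}"
      proof (rule finite_subset)
        show "{i \<in> S. \<ominus>\<^bsub>M i\<^esub> x i \<noteq> \<zero>\<^bsub>M i\<^esub>} \<subseteq> {i \<in> S. x i \<noteq> \<zero>\<^bsub>M i\<^esub>}"
          using abelian_group.minus_equality[OF ag, OF _ _ am[THEN abelian_monoid.zero_closed]
              am[THEN abelian_monoid.zero_closed]] am[THEN abelian_monoid.l_zero] by auto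
      qed (use x in \<open>auto simp: direct_sum_def\<close>)
      show "\<exists>y\<in>carrier (direct_sum S M). y \<oplus>\<^bsub>direct_sum S M\<^esub> x = \<zero>\<^bsub>direct_sum S M\<^esub>"
        by (rule bexI[of _ ?y]) (use x f in \<open>auto simp: direct_sum_def PiE_iff intro!: restrict_ext
             cong: conj_cong\<close>)
    qed (auto simp: direct_sum_def PiE_iff fun_eq_iff restrict_def extensional_def
          abelian_monoid.a_assoc[OF am] abelian_monoid.a_comm[OF am]
          abelian_monoid.a_lcomm[OF am] intro!: fin cong: conj_cong)
  qed (auto simp: direct_sum_def PiE_iff fun_eq_iff restrict_def extensional_def R
        module.smult_l_distr[OF M] module.smult_r_distr[OF M] module.smult_assoc1[OF M]
        intro!: fin' cong: conj_cong)
qed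

lemma free_module_module: "cring R \<Longrightarrow> Module.module R (free_module R S)"
  unfolding free_module_def by (intro direct_sum_module regular_module_module)

lemma cring_real_poly_ring: "cring (real_poly_ring n :: ((nat \<Rightarrow>\<^sub>0 real) \<Rightarrow>\<^sub>0 'k::field) ring)"
proof -
  let ?C = "{p :: (nat \<Rightarrow>\<^sub>0 real) \<Rightarrow>\<^sub>0 'k. Poly_Mapping.keys p \<subseteq> nonneg_exps n}"
  have add: "a + b \<in> nonneg_exps n" if "a \<in> nonneg_exps n" "b \<in> nonneg_exps n" for a b
    using that Poly_Mapping.keys_add[of a b] unfolding nonneg_exps_def by (auto simp: lookup_add)
  have 1: "p + q \<in> ?C" if "p \<in> ?C" "q \<in> ?C" for p q
    using that Poly_Mapping.keys_add[of p q] by blast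
  have 2: "p * q \<in> ?C" if "p \<in> ?C" "q \<in> ?C" for p q
    using that keys_mult[of p q] add by blast
  have 3: "1 \<in> ?C" by (auto simp: nonneg_exps_def)
  have 4: "\<exists>y\<in>?C. y + p = 0" if "p \<in> ?C" for p
    by (rule bexI[of _ "-p"]) (use that in \<open>auto simp: in_keys_iff\<close>)
  show ?thesis
    unfolding real_poly_ring_def
    by (intro cringI abelian_groupI comm_monoidI)
       (use 1 2 3 4 in \<open>simp_all add: algebra_simps\<close>)
qed

lemma var_pow_closed: "1 \<le> i \<Longrightarrow> i \<le> n \<Longrightarrow> 0 \<le> \<epsilon> \<Longrightarrow> var_pow i \<epsilon> \<in> carrier (real_poly_ring n)"
  by (auto simp: var_pow_def real_poly_ring_def nonneg_exps_def lookup_single when_def split: if_splits)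


lemma submodule_on_module:
  assumes "Module.module R M" "K \<subseteq> carrier M" "\<zero>\<^bsub>M\<^esub> \<in> K"
    and "\<And>x y. x \<in> K \<Longrightarrow> y \<in> K \<Longrightarrow> x \<oplus>\<^bsub>M\<^esub> y \<in> K"
    and smult: "\<And>r x. r \<in> carrier R \<Longrightarrow> x \<in> K \<Longrightarrow> r \<odot>\<^bsub>M\<^esub> x \<in> K"
  shows "Module.module R (submodule_on K M)"
proof -
  interpret Module.module R M by fact
  have inv: "\<exists>y\<in>K. y \<oplus>\<^bsub>M\<^esub> x = \<zero>\<^bsub>M\<^esub>" if "x \<in> K" for x
  proof (rule bexI)
    show "(\<ominus>\<^bsub>R\<^esub> \<one>\<^bsub>R\<^esub>) \<odot>\<^bsub>M\<^esub> x \<in> K" using that by (intro smult) auto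
    show "(\<ominus>\<^bsub>R\<^esub> \<one>\<^bsub>R\<^esub>) \<odot>\<^bsub>M\<^esub> x \<oplus>\<^bsub>M\<^esub> x = \<zero>\<^bsub>M\<^esub>"
      using that assms(2) by (auto simp: smult_l_minus M.l_neg)
  qed
  have K: "x \<in> carrier M" if "x \<in> K" for x using that assms(2) by blast
  show ?thesis
    unfolding submodule_on_def
    by (intro moduleI abelian_groupI)
       (use assms inv K in \<open>auto simp: M.a_assoc M.a_comm M.a_lcomm smult_l_distr smult_r_distr
         smult_assoc1 R.is_cring\<close>)
qed

lemma ideal_module:
  assumes "cring R" "ideal I R"
  shows "Module.module R (submodule_on I (regular_module R))"
proof -
  interpret I: ideal I R by fact
  show ?thesis
    by (rule submodule_on_module[OF regular_module_module[OF assms(1)]])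
       (auto simp: regular_module_def I.I_l_closed)
qed

lemma restrict_scalars_module:
  assumes "cring R" "Module.module S M" "h \<in> ring_hom R S"
  shows "Module.module R (restrict_scalars h M)"
proof -
  interpret Module.module S M by fact
  interpret R: cring R by fact
  show ?thesis
    unfolding restrict_scalars_def
    by (intro moduleI abelian_groupI)
       (use assms in \<open>auto simp: M.a_assoc M.a_comm M.a_lcomm smult_l_distr smult_r_distr
         smult_assoc1 ring_hom_add ring_hom_mult ring_hom_one ring_hom_closed intro: M.l_neg\<close>)
qed

lemma quotient_module_module:
  assumes "Module.module R M" "K \<subseteq> carrier M" "\<zero>\<^bsub>M\<^esub> \<in> K"
    and add: "\<And>x y. x \<in> K \<Longrightarrow> y \<in> K \<Longrightarrow> x \<oplus>\<^bsub>M\<^esub> y \<in> K"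
    and smult: "\<And>r x. r \<in> carrier R \<Longrightarrow> x \<in> K \<Longrightarrow> r \<odot>\<^bsub>M\<^esub> x \<in> K"
  shows "Module.module R (quotient_module M K)"
    and "x \<in> carrier M \<Longrightarrow> r \<in> carrier R \<Longrightarrow>
      r \<odot>\<^bsub>quotient_module M K\<^esub> (K +>\<^bsub>M\<^esub> x) = K +>\<^bsub>M\<^esub> (r \<odot>\<^bsub>M\<^esub> x)"
proof -
  interpret Module.module R M by fact
  have K: "x \<in> carrier M" if "x \<in> K" for x using that assms(2) by blast
  have inv: "\<ominus>\<^bsub>M\<^esub> x \<in> K" if "x \<in> K" for x
    using smult[of "\<ominus>\<^bsub>R\<^esub> \<one>\<^bsub>R\<^esub>" x] that K by (simp add: smult_l_minus)
  interpret K: abelian_subgroup K M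
    by (rule abelian_subgroupI3)
       (use assms K inv in \<open>auto intro!: additive_subgroup.intro subgroup.intro
          simp: M.abelian_group_axioms simp flip: a_inv_def\<close>)
  have eq: "K +>\<^bsub>M\<^esub> x = K +>\<^bsub>M\<^esub> y" if "x \<in> K +>\<^bsub>M\<^esub> y" "y \<in> carrier M" for x y
    using that K.a_repr_independence' by metis
  have sm: "(\<Union>x\<in>K +>\<^bsub>M\<^esub> y. K +>\<^bsub>M\<^esub> (r \<odot>\<^bsub>M\<^esub> x)) = K +>\<^bsub>M\<^esub> (r \<odot>\<^bsub>M\<^esub> y)"
    if y: "y \<in> carrier M" and r: "r \<in> carrier R" for y r
  proof -
    have "K +>\<^bsub>M\<^esub> (r \<odot>\<^bsub>M\<^esub> x) = K +>\<^bsub>M\<^esub> (r \<odot>\<^bsub>M\<^esub> y)" if "x \<in> K +>\<^bsub>M\<^esub> y" for x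
    proof -
      obtain k where k: "k \<in> K" "x = k \<oplus>\<^bsub>M\<^esub> y" using \<open>x \<in> _\<close> by (auto simp: a_r_coset_def')
      have "r \<odot>\<^bsub>M\<^esub> x = r \<odot>\<^bsub>M\<^esub> k \<oplus>\<^bsub>M\<^esub> r \<odot>\<^bsub>M\<^esub> y" using k y r K by (simp add: smult_r_distr)
      thus ?thesis using y r k smult by (intro eq) (auto simp: a_r_coset_def')
    qed
    moreover have "y \<in> K +>\<^bsub>M\<^esub> y" using y by (rule K.a_rcos_self)
    ultimately show ?thesis by blast
  qed
  show "r \<odot>\<^bsub>quotient_module M K\<^esub> (K +>\<^bsub>M\<^esub> x) = K +>\<^bsub>M\<^esub> (r \<odot>\<^bsub>M\<^esub> x)"
    if "x \<in> carrier M" "r \<in> carrier R"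
    using that by (simp add: quotient_module_def sm)
  have car: "a_rcosets\<^bsub>M\<^esub> K = (\<lambda>x. K +>\<^bsub>M\<^esub> x) ` carrier M"
    by (auto simp: A_RCOSETS_def' a_r_coset_def')
  have K0: "K = K +>\<^bsub>M\<^esub> \<zero>\<^bsub>M\<^esub>" using assms(2) by (simp add: M.a_coset_add_zero)
  define Q where "Q = quotient_module M K"
  have [simp]: "carrier Q = (\<lambda>x. K +>\<^bsub>M\<^esub> x) ` carrier M"
    by (simp add: Q_def quotient_module_def car)
  have [simp]: "(K +>\<^bsub>M\<^esub> x) \<oplus>\<^bsub>Q\<^esub> (K +>\<^bsub>M\<^esub> y) = K +>\<^bsub>M\<^esub> (x \<oplus>\<^bsub>M\<^esub> y)"
    if "x \<in> carrier M" "y \<in> carrier M" for x y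
    using that by (simp add: Q_def quotient_module_def K.a_rcos_sum)
  have [simp]: "r \<odot>\<^bsub>Q\<^esub> (K +>\<^bsub>M\<^esub> x) = K +>\<^bsub>M\<^esub> (r \<odot>\<^bsub>M\<^esub> x)"
    if "x \<in> carrier M" "r \<in> carrier R" for x r
    using that by (simp add: Q_def quotient_module_def sm)
  have [simp]: "\<zero>\<^bsub>Q\<^esub> = K +>\<^bsub>M\<^esub> \<zero>\<^bsub>M\<^esub>"
    using K0 by (simp add: Q_def quotient_module_def)
  have neg: "\<exists>y\<in>carrier M. K +>\<^bsub>M\<^esub> (x \<oplus>\<^bsub>M\<^esub> y) = K +>\<^bsub>M\<^esub> \<zero>\<^bsub>M\<^esub>" if "x \<in> carrier M" for x
    using that by (intro bexI[of _ "\<ominus>\<^bsub>M\<^esub> x"]) (auto simp: M.r_neg)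
  have "Module.module R Q"
    by (intro moduleI abelian_groupI R.is_cring)
       (auto simp: smult_l_distr smult_r_distr smult_assoc1 M.a_assoc M.a_comm M.a_lcomm neg
          simp del: M.a_coset_add_zero)
  thus "Module.module R (quotient_module M K)" by (simp add: Q_def)
qed

lemma to_last_var_superset:
  assumes "finite A" "Poly_Mapping.keys p \<subseteq> A"
  shows "to_last_var n p = (\<Sum>a\<in>{a\<in>A. Poly_Mapping.keys a \<subseteq> {n}}.
       Poly_Mapping.single (Poly_Mapping.single 1 (Poly_Mapping.lookup a n)) (Poly_Mapping.lookup p a))"
  unfolding to_last_var_def
  by (rule sum.mono_neutral_left) (use assms in \<open>auto simp: in_keys_iff\<close>)

lemma to_last_var_add: "to_last_var n (p + q) = to_last_var n p + to_last_var n q"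
proof -
  let ?A = "Poly_Mapping.keys p \<union> Poly_Mapping.keys q"
  show ?thesis
    by (subst (1 2 3) to_last_var_superset[of ?A])
       (use Poly_Mapping.keys_add[of p q] in
         \<open>auto simp: lookup_add single_add sum.distrib\<close>)
qed

lemma to_last_var_single:
  "to_last_var n (Poly_Mapping.single a c) =
     (if Poly_Mapping.keys a \<subseteq> {n}
      then Poly_Mapping.single (Poly_Mapping.single 1 (Poly_Mapping.lookup a n)) c else 0)"
proof -
  have "{b \<in> {a}. Poly_Mapping.keys b \<subseteq> {n}} = (if Poly_Mapping.keys a \<subseteq> {n} then {a} else {})"
    by auto
  thus ?thesis by (subst to_last_var_superset[of "{a}"]) auto
qed

lemma to_last_var_var_pow:
  "to_last_var n (var_pow n \<epsilon>) = var_pow 1 \<epsilon>"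
  "i \<noteq> n \<Longrightarrow> \<epsilon> \<noteq> 0 \<Longrightarrow> to_last_var n (var_pow i \<epsilon>) = 0"
  "to_last_var n (Poly_Mapping.single 0 c) = Poly_Mapping.single 0 c"
  by (auto simp: var_pow_def to_last_var_single)

lemma real_poly_induct [consumes 1, case_names zero add]:
  assumes "Poly_Mapping.keys p \<subseteq> E" "P 0"
    and "\<And>a c q. a \<in> E \<Longrightarrow> Poly_Mapping.keys q \<subseteq> E \<Longrightarrow> P q \<Longrightarrow> P (Poly_Mapping.single a c + q)"
  shows "P p"
  using assms(1)
proof (induction p rule: update_induct)
  case (update f a b)
  have eq: "Poly_Mapping.update a b f = Poly_Mapping.single a b + f"
    using update(1) by (intro poly_mapping_eqI) (auto simp: lookup_update lookup_add lookup_single in_keys_iff)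
  have "Poly_Mapping.keys (Poly_Mapping.update a b f) = insert a (Poly_Mapping.keys f)"
    using update(2) by (auto simp: in_keys_iff lookup_update split: if_splits)
  with update eq assms(3) show ?case by auto
qed (rule assms(2))

lemma to_last_var_mult:
  assumes "Poly_Mapping.keys p \<subseteq> nonneg_exps n" "Poly_Mapping.keys q \<subseteq> nonneg_exps n"
  shows "to_last_var n (p * q) = to_last_var n p * to_last_var n q"
  using assms(1)
proof (induction p rule: real_poly_induct)
  case zero thus ?case by (simp add: to_last_var_def)
next
  case (add a c p)
  have "to_last_var n (Poly_Mapping.single a c * q)
        = to_last_var n (Poly_Mapping.single a c) * to_last_var n q"
    using assms(2)
  proof (induction q rule: real_poly_induct)
    case zero thus ?case by (simp add: to_last_var_def)
  next
    case (add b d q)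
    have keys: "Poly_Mapping.keys (a + b) = Poly_Mapping.keys a \<union> Poly_Mapping.keys b"
      using \<open>a \<in> _\<close> \<open>b \<in> _\<close>
      by (auto simp: in_keys_iff lookup_add nonneg_exps_def add_nonneg_eq_0_iff)
    have "to_last_var n (Poly_Mapping.single a c * Poly_Mapping.single b d)
        = to_last_var n (Poly_Mapping.single a c) * to_last_var n (Poly_Mapping.single b d)"
      by (auto simp: mult_single to_last_var_single keys lookup_add single_add)
    with add show ?case by (simp add: distrib_left to_last_var_add)
  qed
  with add show ?case by (simp add: distrib_right to_last_var_add)
qed

lemma to_last_var_hom:
  assumes "0 < n"
  shows "to_last_var n \<in> ring_hom (real_poly_ring n) (real_poly_ring 1 :: (_ \<Rightarrow>\<^sub>0 'k::field) ring)"
    and "to_last_var n ` carrier (real_poly_ring n) =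
      carrier (real_poly_ring 1 :: (_ \<Rightarrow>\<^sub>0 'k) ring)"
proof -
  let ?R = "real_poly_ring n :: (_ \<Rightarrow>\<^sub>0 'k) ring" and ?R1 = "real_poly_ring 1 :: (_ \<Rightarrow>\<^sub>0 'k) ring"
  interpret R1: cring ?R1 by (rule cring_real_poly_ring)
  interpret R: cring ?R by (rule cring_real_poly_ring)
  have nn: "Poly_Mapping.single i x \<in> nonneg_exps m" if "0 \<le> x" "i \<in> {1..m}" for i m x
    using that by (auto simp: nonneg_exps_def lookup_single when_def split: if_splits)
  have s: "Poly_Mapping.single a c \<in> carrier (real_poly_ring m)" if "a \<in> nonneg_exps m" for a m and c :: 'k
    using that by (auto simp: real_poly_ring_def)
  have clo: "to_last_var n p \<in> carrier ?R1" if "Poly_Mapping.keys p \<subseteq> nonneg_exps n" for p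
    using that
  proof (induction p rule: real_poly_induct)
    case zero thus ?case by (simp add: to_last_var_def real_poly_ring_def)
  next
    case (add a c q)
    have "to_last_var n (Poly_Mapping.single a c) \<in> carrier ?R1"
    proof (cases "Poly_Mapping.keys a \<subseteq> {n}")
      case True
      have "0 \<le> Poly_Mapping.lookup a n" using add(1) by (simp add: nonneg_exps_def)
      thus ?thesis using True s[OF nn] by (simp add: to_last_var_single)
    next
      case False
      thus ?thesis using R1.zero_closed by (simp add: to_last_var_single real_poly_ring_def)
    qed
    with add R1.add.m_closed show ?case by (auto simp: to_last_var_add real_poly_ring_def)
  qed
  show "to_last_var n \<in> ring_hom ?R ?R1"
  proof (rule ring_hom_memI)
    show "to_last_var n x \<in> carrier ?R1" if "x \<in> carrier ?R" for x
      using that clo by (simp add: real_poly_ring_def)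
    show "to_last_var n \<one>\<^bsub>?R\<^esub> = \<one>\<^bsub>?R1\<^esub>"
      using to_last_var_single[of n 0 1] by (simp add: real_poly_ring_def)
  qed (auto simp: real_poly_ring_def to_last_var_add to_last_var_mult)
  have "\<exists>p\<in>carrier ?R. to_last_var n p = q" if "Poly_Mapping.keys q \<subseteq> nonneg_exps 1" for q :: "_ \<Rightarrow>\<^sub>0 'k"
    using that
  proof (induction q rule: real_poly_induct)
    case zero show ?case by (rule bexI[of _ 0]) (auto simp: to_last_var_def real_poly_ring_def)
  next
    case (add a c q)
    then obtain p where p: "p \<in> carrier ?R" "to_last_var n p = q" by blast
    let ?a = "Poly_Mapping.single n (Poly_Mapping.lookup a 1)"
    have a: "a = Poly_Mapping.single 1 (Poly_Mapping.lookup a 1)"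
      using add(1) by (intro poly_mapping_eqI) (auto simp: nonneg_exps_def lookup_single when_def in_keys_iff)
    have "?a \<in> nonneg_exps n" using add(1) assms by (intro nn) (auto simp: nonneg_exps_def)
    hence "Poly_Mapping.single ?a c + p \<in> carrier ?R"
      using R.add.m_closed[OF s p(1)] by (simp add: real_poly_ring_def)
    moreover have "to_last_var n (Poly_Mapping.single ?a c + p) = Poly_Mapping.single a c + q"
      using p a by (auto simp: to_last_var_add to_last_var_single)
    ultimately show ?case by blast
  qed
  thus "to_last_var n ` carrier ?R = carrier ?R1"
    using clo by (auto simp: real_poly_ring_def image_iff Bex_def)
qed

lemma module_homsD:
  assumes "f \<in> module_homs R M N"
  shows "x \<in> carrier M \<Longrightarrow> f x \<in> carrier N"
    "x \<in> carrier M \<Longrightarrow> y \<in> carrier M \<Longrightarrow> f (x \<oplus>\<^bsub>M\<^esub> y) = f x \<oplus>\<^bsub>N\<^esub> f y"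
    "r \<in> carrier R \<Longrightarrow> x \<in> carrier M \<Longrightarrow> f (r \<odot>\<^bsub>M\<^esub> x) = r \<odot>\<^bsub>N\<^esub> f x"
    "x \<notin> carrier M \<Longrightarrow> f x = undefined"
  using assms by (auto simp: module_homs_def PiE_iff extensional_def)

lemma module_homs_zero:
  assumes "Module.module R M" "Module.module R N" "f \<in> module_homs R M N"
  shows "f \<zero>\<^bsub>M\<^esub> = \<zero>\<^bsub>N\<^esub>"
proof -
  interpret M: Module.module R M by fact
  interpret N: Module.module R N by fact
  have "f (\<zero>\<^bsub>R\<^esub> \<odot>\<^bsub>M\<^esub> \<zero>\<^bsub>M\<^esub>) = \<zero>\<^bsub>R\<^esub> \<odot>\<^bsub>N\<^esub> f \<zero>\<^bsub>M\<^esub>"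
    using module_homsD[OF assms(3)] by blast
  thus ?thesis using module_homsD(1)[OF assms(3)] by simp
qed

lemma free_module_simps:
  "f \<in> carrier (free_module R S) \<longleftrightarrow>
     f \<in> S \<rightarrow>\<^sub>E carrier R \<and> finite {s\<in>S. f s \<noteq> \<zero>\<^bsub>R\<^esub>}"
  "f \<oplus>\<^bsub>free_module R S\<^esub> g = (\<lambda>s\<in>S. f s \<oplus>\<^bsub>R\<^esub> g s)"
  "r \<odot>\<^bsub>free_module R S\<^esub> f = (\<lambda>s\<in>S. r \<otimes>\<^bsub>R\<^esub> f s)"
  "\<zero>\<^bsub>free_module R S\<^esub> = (\<lambda>s\<in>S. \<zero>\<^bsub>R\<^esub>)"
  by (simp_all add: free_module_def direct_sum_def regular_module_def)

lemma free_basis_closed: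
  assumes "cring R" "s \<in> S"
  shows "free_basis R S s \<in> carrier (free_module R S)"
proof -
  interpret cring R by fact
  show ?thesis using assms(2)
    by (auto simp: free_module_simps free_basis_def PiE_iff intro: finite_subset[of _ "{s}"])
qed

lemma free_vec_simps:
  "free_vec R S [] = \<zero>\<^bsub>free_module R S\<^esub>"
  "free_vec R S ((r, s) # l) =
     (r \<odot>\<^bsub>free_module R S\<^esub> free_basis R S s) \<oplus>\<^bsub>free_module R S\<^esub> free_vec R S l"
  by (simp_all add: free_vec_def)

lemma free_vec_closed:
  assumes "cring R" "set l \<subseteq> carrier R \<times> S"
  shows "free_vec R S l \<in> carrier (free_module R S)"
proof -
  interpret Module.module R "free_module R S" by (rule free_module_module) fact
  show ?thesis using assms(2)
    by (induction l) (auto simp: free_vec_simps free_basis_closed[OF assms(1)])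
qed

lemma free_vec_surj:
  assumes "cring R" "f \<in> carrier (free_module R S)"
  shows "\<exists>l. set l \<subseteq> carrier R \<times> S \<and> f = free_vec R S l"
proof -
  interpret cring R by fact
  have "finite {s\<in>S. f s \<noteq> \<zero>\<^bsub>R\<^esub>}" using assms(2) by (simp add: free_module_simps)
  from this assms(2) show ?thesis
  proof (induction "{s\<in>S. f s \<noteq> \<zero>\<^bsub>R\<^esub>}" arbitrary: f rule: finite_induct)
    case empty
    hence "f = (\<lambda>s\<in>S. \<zero>\<^bsub>R\<^esub>)" by (intro ext) (auto simp: free_module_simps PiE_iff extensional_def)
    thus ?case by (intro exI[of _ "[]"]) (simp add: free_vec_simps free_module_simps)
  next
    case (insert s A)
    let ?g = "f(s := \<zero>\<^bsub>R\<^esub>)"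
    have s: "s \<in> S" using insert by blast
    have A: "A = {t\<in>S. ?g t \<noteq> \<zero>\<^bsub>R\<^esub>}" using insert(2,4) by auto
    have g: "?g \<in> carrier (free_module R S)"
      using insert(1,5) A s by (auto simp: free_module_simps PiE_iff extensional_def)
    from insert(3)[OF A g] obtain l where l: "set l \<subseteq> carrier R \<times> S" "?g = free_vec R S l" by blast
    have "f = (f s \<odot>\<^bsub>free_module R S\<^esub> free_basis R S s) \<oplus>\<^bsub>free_module R S\<^esub> ?g"
      using insert(5) s by (intro ext) (auto simp: free_module_simps free_basis_def PiE_iff extensional_def)
    moreover have "f s \<in> carrier R" using insert(5) s by (auto simp: free_module_simps)
    ultimately show ?case
      using l s by (intro exI[of _ "(f s, s) # l"]) (simp add: free_vec_simps)
  qed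
qed

lemma free_lift_superset:
  assumes M: "Module.module R M" and g: "\<And>s. s \<in> S \<Longrightarrow> g s \<in> carrier M"
    and f: "f \<in> carrier (free_module R S)"
    and A: "finite A" "A \<subseteq> S" "{s\<in>S. f s \<noteq> \<zero>\<^bsub>R\<^esub>} \<subseteq> A"
  shows "free_lift R S M g f = (\<Oplus>\<^bsub>M\<^esub>s\<in>A. f s \<odot>\<^bsub>M\<^esub> g s)"
proof -
  interpret Module.module R M by fact
  have "(\<Oplus>\<^bsub>M\<^esub>s\<in>{s\<in>S. f s \<noteq> \<zero>\<^bsub>R\<^esub>}. f s \<odot>\<^bsub>M\<^esub> g s) = (\<Oplus>\<^bsub>M\<^esub>s\<in>A. f s \<odot>\<^bsub>M\<^esub> g s)"
  proof (rule M.add.finprod_mono_neutral_cong_left[OF A(1,3)])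
    show "\<And>i. i \<in> A - {s \<in> S. f s \<noteq> \<zero>\<^bsub>R\<^esub>} \<Longrightarrow> f i \<odot>\<^bsub>M\<^esub> g i = \<zero>\<^bsub>M\<^esub>"
      using A g by auto
    have "f x \<in> carrier R" if "x \<in> A" for x using that f A(2) by (auto simp: free_module_simps)
    thus "(\<lambda>s. f s \<odot>\<^bsub>M\<^esub> g s) \<in> A \<rightarrow> carrier M" using A(2) g by auto
  qed auto
  thus ?thesis using f by (simp add: free_lift_def)
qed

lemma free_lift_hom:
  assumes M: "Module.module R M" and g: "\<And>s. s \<in> S \<Longrightarrow> g s \<in> carrier M"
  shows "free_lift R S M g \<in> module_homs R (free_module R S) M"
proof -
  interpret Module.module R M by fact
  interpret F: Module.module R "free_module R S" by (rule free_module_module) (rule R.is_cring)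
  let ?s = "\<lambda>f. {s\<in>S. f s \<noteq> \<zero>\<^bsub>R\<^esub>}"
  have fin: "finite (?s f)" if "f \<in> carrier (free_module R S)" for f
    using that by (simp add: free_module_simps)
  have car: "f s \<in> carrier R" if "f \<in> carrier (free_module R S)" "s \<in> S" for f s
    using that by (auto simp: free_module_simps)
  note sup = free_lift_superset[OF M g]
  have cl: "free_lift R S M g f \<in> carrier M" if "f \<in> carrier (free_module R S)" for f
    using that car g by (subst sup[OF _ _ fin[OF that]]) (auto intro!: M.finsum_closed)
  have add: "free_lift R S M g (f \<oplus>\<^bsub>free_module R S\<^esub> h) =
      free_lift R S M g f \<oplus>\<^bsub>M\<^esub> free_lift R S M g h"
    if fh: "f \<in> carrier (free_module R S)" "h \<in> carrier (free_module R S)" for f h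
  proof -
    let ?A = "?s f \<union> ?s h"
    have A: "finite ?A" "?A \<subseteq> S" using fin fh by auto
    have "free_lift R S M g (f \<oplus>\<^bsub>free_module R S\<^esub> h) =
       (\<Oplus>\<^bsub>M\<^esub>s\<in>?A. (f \<oplus>\<^bsub>free_module R S\<^esub> h) s \<odot>\<^bsub>M\<^esub> g s)"
      by (rule sup[OF _ F.M.a_closed[OF fh] A]) (auto simp: free_module_simps(2))
    also have "\<dots> = (\<Oplus>\<^bsub>M\<^esub>s\<in>?A. f s \<odot>\<^bsub>M\<^esub> g s \<oplus>\<^bsub>M\<^esub> h s \<odot>\<^bsub>M\<^esub> g s)"
      using car[OF fh(1)] car[OF fh(2)] g
      by (intro M.finsum_cong') (auto simp: free_module_simps(2) smult_l_distr)
    also have "\<dots> = (\<Oplus>\<^bsub>M\<^esub>s\<in>?A. f s \<odot>\<^bsub>M\<^esub> g s) \<oplus>\<^bsub>M\<^esub> (\<Oplus>\<^bsub>M\<^esub>s\<in>?A. h s \<odot>\<^bsub>M\<^esub> g s)"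
      using car[OF fh(1)] car[OF fh(2)] g by (intro M.finsum_addf) auto
    also have "\<dots> = free_lift R S M g f \<oplus>\<^bsub>M\<^esub> free_lift R S M g h"
      using sup[OF _ fh(1) A] sup[OF _ fh(2) A] by auto
    finally show ?thesis .
  qed
  have smult: "free_lift R S M g (r \<odot>\<^bsub>free_module R S\<^esub> f) = r \<odot>\<^bsub>M\<^esub> free_lift R S M g f"
    if f: "f \<in> carrier (free_module R S)" and r: "r \<in> carrier R" for f r
  proof -
    have fs: "finite (?s f)" by (rule fin[OF f])
    have "free_lift R S M g (r \<odot>\<^bsub>free_module R S\<^esub> f) =
       (\<Oplus>\<^bsub>M\<^esub>s\<in>?s f. (r \<odot>\<^bsub>free_module R S\<^esub> f) s \<odot>\<^bsub>M\<^esub> g s)"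
      by (rule sup[OF _ F.smult_closed[OF r f] fs]) (use r in \<open>auto simp: free_module_simps(3)\<close>)
    also have "\<dots> = (\<Oplus>\<^bsub>M\<^esub>s\<in>?s f. r \<odot>\<^bsub>M\<^esub> (f s \<odot>\<^bsub>M\<^esub> g s))"
      using car[OF f] g r
      by (intro M.finsum_cong') (auto simp: free_module_simps(3) smult_assoc1)
    also have "\<dots> = r \<odot>\<^bsub>M\<^esub> (\<Oplus>\<^bsub>M\<^esub>s\<in>?s f. f s \<odot>\<^bsub>M\<^esub> g s)"
      using car[OF f] g r fs by (intro finsum_smult_ldistr[symmetric]) auto
    also have "\<dots> = r \<odot>\<^bsub>M\<^esub> free_lift R S M g f"
      using f by (simp add: free_lift_def)
    finally show ?thesis .
  qed
  show ?thesis
    using cl add smult by (auto simp: module_homs_def free_lift_def)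
qed

lemma free_lift_basis:
  assumes M: "Module.module R M" and g: "\<And>s. s \<in> S \<Longrightarrow> g s \<in> carrier M" and s: "s \<in> S"
  shows "free_lift R S M g (free_basis R S s) = g s"
proof -
  interpret Module.module R M by fact
  have "free_lift R S M g (free_basis R S s) = (\<Oplus>\<^bsub>M\<^esub>t\<in>{s}. free_basis R S s t \<odot>\<^bsub>M\<^esub> g t)"
    by (rule free_lift_superset[OF M g free_basis_closed[OF R.is_cring s]])
       (use s in \<open>auto simp: free_basis_def\<close>)
  also have "\<dots> = g s" using s g by (simp add: free_basis_def)
  finally show ?thesis .
qed

text \<open>The complex \<open>\<dots> \<rightarrow> res_module R M 1 \<rightarrow> res_module R M 0 \<rightarrow> M \<rightarrow> 0\<close> is a free resolution.\<close>

lemma res_module_module: "cring R \<Longrightarrow> Module.module R (res_module R M i)"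
  unfolding res_module_def by (rule free_module_module)

lemma res_aug_hom:
  assumes "Module.module R M"
  shows "res_aug R M \<in> module_homs R (res_module R M 0) M"
  unfolding res_aug_def res_module_def by (rule free_lift_hom[OF assms]) auto

lemma res_basis_SucE:
  assumes "s \<in> res_basis R M (Suc i)"
  obtains l where "s = Rel l" "set l \<subseteq> carrier R \<times> res_basis R M i"
  using assms by (cases i) auto

lemma res_basis_vec_closed:
  assumes "cring R" "s \<in> res_basis R M (Suc i)"
  shows "free_vec R (res_basis R M i) (rel_of s) \<in> carrier (free_module R (res_basis R M i))"
  using assms(2) by (rule res_basis_SucE) (simp add: free_vec_closed[OF assms(1)])

lemma res_diff_hom:
  assumes "cring R"
  shows "res_diff R M i \<in> module_homs R (res_module R M (Suc i)) (res_module R M i)"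
  unfolding res_diff_def res_module_def
  by (rule free_lift_hom[OF free_module_module[OF assms] res_basis_vec_closed[OF assms]])

lemma res_diff_basis:
  assumes "cring R" "Rel l \<in> res_basis R M (Suc i)"
  shows "res_diff R M i (free_basis R (res_basis R M (Suc i)) (Rel l)) = free_vec R (res_basis R M i) l"
proof -
  let ?g = "\<lambda>s. free_vec R (res_basis R M i) (rel_of s)"
  have "free_lift R (res_basis R M (Suc i)) (free_module R (res_basis R M i)) ?g
      (free_basis R (res_basis R M (Suc i)) (Rel l)) = ?g (Rel l)"
    by (rule free_lift_basis[OF free_module_module[OF assms(1)] res_basis_vec_closed[OF assms(1)] assms(2)])
  thus ?thesis by (simp add: res_diff_def res_module_def)
qed

lemma res_aug_surj:
  assumes "Module.module R M"
  shows "res_aug R M ` carrier (res_module R M 0) = carrier M"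
proof -
  interpret Module.module R M by fact
  have "res_aug R M (free_basis R (res_basis R M 0) (Gen m)) = m" if "m \<in> carrier M" for m
    unfolding res_aug_def using that by (subst free_lift_basis[OF assms]) auto
  moreover have "free_basis R (res_basis R M 0) (Gen m) \<in> carrier (res_module R M 0)"
    if "m \<in> carrier M" for m
    unfolding res_module_def using that by (intro free_basis_closed R.is_cring) auto
  ultimately have "m \<in> res_aug R M ` carrier (res_module R M 0)" if "m \<in> carrier M" for m
    using that by (intro image_eqI[of _ _ "free_basis R (res_basis R M 0) (Gen m)"]) (simp_all del: res_basis.simps)
  thus ?thesis using module_homsD(1)[OF res_aug_hom[OF assms]] by blast
qed

lemma hom_vanishI:
  assumes "cring R" "Module.module R N" "f \<in> module_homs R (free_module R S) N"
    and "\<And>s. s \<in> S \<Longrightarrow> f (free_basis R S s) = \<zero>\<^bsub>N\<^esub>" "v \<in> carrier (free_module R S)"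
  shows "f v = \<zero>\<^bsub>N\<^esub>"
proof -
  interpret N: Module.module R N by fact
  interpret F: Module.module R "free_module R S" by (rule free_module_module) fact
  obtain l where l: "set l \<subseteq> carrier R \<times> S" "v = free_vec R S l"
    using free_vec_surj[OF assms(1,5)] by blast
  have "f (free_vec R S l) = \<zero>\<^bsub>N\<^esub>" using l(1)
  proof (induction l)
    case Nil
    show ?case using module_homs_zero[OF F.module_axioms N.module_axioms assms(3)]
      by (simp add: free_vec_simps)
  next
    case (Cons p l)
    obtain r s where p: "p = (r, s)" by (cases p)
    have c: "r \<in> carrier R" "s \<in> S" "free_basis R S s \<in> carrier (free_module R S)"
        "free_vec R S l \<in> carrier (free_module R S)"
      using Cons(2) p free_vec_closed[OF assms(1), of l S] free_basis_closed[OF assms(1), of s S] by auto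
    have "f (free_vec R S (p # l)) = r \<odot>\<^bsub>N\<^esub> f (free_basis R S s) \<oplus>\<^bsub>N\<^esub> f (free_vec R S l)"
      using c by (simp add: p free_vec_simps module_homsD[OF assms(3)])
    thus ?case using c Cons assms(4) by simp
  qed
  thus ?thesis using l by simp
qed

lemma module_homs_comp:
  assumes "Module.module R L" "f \<in> module_homs R L M" "g \<in> module_homs R M N"
  shows "(\<lambda>x\<in>carrier L. g (f x)) \<in> module_homs R L N"
proof -
  interpret Module.module R L by fact
  show ?thesis
    using module_homsD[OF assms(2)] module_homsD[OF assms(3)] unfolding module_homs_def by auto
qed

text \<open>
  One step of the construction: if the basis in degree \<open>i + 1\<close> consists of all the lists
  representing elements of the kernel of \<open>f\<close>, the differential maps onto this kernel.
\<close>

lemma res_exact_step: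
  assumes R: "cring R" and N: "Module.module R N"
    and f: "f \<in> module_homs R (res_module R M i) N"
    and basis: "res_basis R M (Suc i) =
      {Rel l |l. set l \<subseteq> carrier R \<times> res_basis R M i \<and> f (free_vec R (res_basis R M i) l) = \<zero>\<^bsub>N\<^esub>}"
  shows "res_diff R M i ` carrier (res_module R M (Suc i)) =
    {v \<in> carrier (res_module R M i). f v = \<zero>\<^bsub>N\<^esub>}"
proof (rule equalityI; rule subsetI)
  fix v assume "v \<in> res_diff R M i ` carrier (res_module R M (Suc i))"
  then obtain w where w: "w \<in> carrier (res_module R M (Suc i))" "v = res_diff R M i w" by blast
  let ?h = "\<lambda>x\<in>carrier (res_module R M (Suc i)). f (res_diff R M i x)"
  have "?h w = \<zero>\<^bsub>N\<^esub>"
  proof (rule hom_vanishI[OF R N, where f = ?h and v = w])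
    show "?h \<in> module_homs R (free_module R (res_basis R M (Suc i))) N"
      using module_homs_comp[OF res_module_module[OF R] res_diff_hom[OF R] f]
      by (simp add: res_module_def)
    show "w \<in> carrier (free_module R (res_basis R M (Suc i)))" using w by (simp add: res_module_def)
    fix s assume s: "s \<in> res_basis R M (Suc i)"
    then obtain l where l: "s = Rel l" "f (free_vec R (res_basis R M i) l) = \<zero>\<^bsub>N\<^esub>"
      unfolding basis by blast
    show "?h (free_basis R (res_basis R M (Suc i)) s) = \<zero>\<^bsub>N\<^esub>"
      using l s free_basis_closed[OF R s] by (simp add: res_module_def res_diff_basis[OF R, of l M i])
  qed
  thus "v \<in> {v \<in> carrier (res_module R M i). f v = \<zero>\<^bsub>N\<^esub>}"
    using w module_homsD(1)[OF res_diff_hom[OF R]] by auto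
next
  fix v assume "v \<in> {v \<in> carrier (res_module R M i). f v = \<zero>\<^bsub>N\<^esub>}"
  then obtain l where l: "set l \<subseteq> carrier R \<times> res_basis R M i" "v = free_vec R (res_basis R M i) l"
      "f v = \<zero>\<^bsub>N\<^esub>"
    using free_vec_surj[OF R] unfolding res_module_def by blast
  hence "Rel l \<in> res_basis R M (Suc i)" unfolding basis by auto
  thus "v \<in> res_diff R M i ` carrier (res_module R M (Suc i))"
    using res_diff_basis[OF R] free_basis_closed[OF R] l unfolding res_module_def
    by (metis image_eqI)
qed

lemma res_exact_0:
  assumes "Module.module R M"
  shows "res_diff R M 0 ` carrier (res_module R M (Suc 0)) =
    {v \<in> carrier (res_module R M 0). res_aug R M v = \<zero>\<^bsub>M\<^esub>}"
proof -
  interpret Module.module R M by fact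
  show ?thesis
    by (rule res_exact_step[OF R.is_cring assms res_aug_hom[OF assms]])
       (simp add: res_aug_def del: res_basis.simps(1))
qed

lemma res_exact_Suc:
  assumes "cring R"
  shows "res_diff R M (Suc i) ` carrier (res_module R M (Suc (Suc i))) =
    {v \<in> carrier (res_module R M (Suc i)). res_diff R M i v = \<zero>\<^bsub>res_module R M i\<^esub>}"
  by (rule res_exact_step[OF assms res_module_module[OF assms] res_diff_hom[OF assms]])
     (simp add: res_diff_def res_module_def)

lemma Hom_module_module:
  assumes "cring R" "Module.module R M" "Module.module R N"
  shows "Module.module R (Hom_module R M N)"
proof -
  interpret R: cring R by fact
  interpret M: Module.module R M by fact
  interpret N: Module.module R N by fact
  have neg: "\<exists>g\<in>module_homs R M N. (\<lambda>x\<in>carrier M. g x \<oplus>\<^bsub>N\<^esub> f x) = (\<lambda>x\<in>carrier M. \<zero>\<^bsub>N\<^esub>)"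
    if f: "f \<in> module_homs R M N" for f
  proof (rule bexI)
    note fD = module_homsD(1-3)[OF f]
    show "(\<lambda>x\<in>carrier M. \<ominus>\<^bsub>N\<^esub> f x) \<in> module_homs R M N"
      unfolding module_homs_def by (auto simp: fD N.M.minus_add N.smult_r_minus)
    show "(\<lambda>x\<in>carrier M. (\<lambda>x\<in>carrier M. \<ominus>\<^bsub>N\<^esub> f x) x \<oplus>\<^bsub>N\<^esub> f x) = (\<lambda>x\<in>carrier M. \<zero>\<^bsub>N\<^esub>)"
      by (rule restrict_ext) (simp add: fD N.M.l_neg)
  qed
  have res: "restrict f (carrier M) = f" if "f \<in> module_homs R M N" for f
    using that by (auto simp: module_homs_def PiE_restrict)
  have add: "(\<lambda>x\<in>carrier M. f x \<oplus>\<^bsub>N\<^esub> g x) \<in> module_homs R M N"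
    if "f \<in> module_homs R M N" "g \<in> module_homs R M N" for f g
    unfolding module_homs_def
    by (auto simp: module_homsD(1-3)[OF that(1)] module_homsD(1-3)[OF that(2)]
        N.M.add.m_ac N.smult_r_distr)
  have smult: "(\<lambda>x\<in>carrier M. r \<odot>\<^bsub>N\<^esub> f x) \<in> module_homs R M N"
    if "f \<in> module_homs R M N" "r \<in> carrier R" for f r
  proof -
    have comm: "r \<odot>\<^bsub>N\<^esub> (s \<odot>\<^bsub>N\<^esub> y) = s \<odot>\<^bsub>N\<^esub> (r \<odot>\<^bsub>N\<^esub> y)" if "s \<in> carrier R" "y \<in> carrier N" for s y
      using \<open>r \<in> carrier R\<close> that N.smult_assoc1 R.m_comm by metis
    show ?thesis
      unfolding module_homs_def
      using that(2) by (auto simp: module_homsD(1-3)[OF that(1)] N.smult_r_distr comm)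
  qed
  have zero: "(\<lambda>x\<in>carrier M. \<zero>\<^bsub>N\<^esub>) \<in> module_homs R M N"
    unfolding module_homs_def by auto
  have cl: "f x \<in> carrier N" if "f \<in> module_homs R M N" "x \<in> carrier M" for f x
    using that by (rule module_homsD(1))
  have eq: "(\<lambda>x\<in>carrier M. f x) = g"
    if "g \<in> module_homs R M N" "\<And>x. x \<in> carrier M \<Longrightarrow> f x = g x" for f g
    using res[OF that(1)] that(2) restrict_ext[of "carrier M" f g] by simp
  show ?thesis
  proof (rule moduleI[OF assms(1) abelian_groupI])
    fix f assume "f \<in> carrier (Hom_module R M N)"
    thus "\<exists>g\<in>carrier (Hom_module R M N). g \<oplus>\<^bsub>Hom_module R M N\<^esub> f = \<zero>\<^bsub>Hom_module R M N\<^esub>"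
      using neg by (simp add: Hom_module_def)
  next
    fix f assume "f \<in> carrier (Hom_module R M N)"
    hence f: "f \<in> module_homs R M N" by (simp add: Hom_module_def)
    show "\<zero>\<^bsub>Hom_module R M N\<^esub> \<oplus>\<^bsub>Hom_module R M N\<^esub> f = f"
      and "\<one>\<^bsub>R\<^esub> \<odot>\<^bsub>Hom_module R M N\<^esub> f = f"
      unfolding Hom_module_def by (auto intro!: eq f simp: cl[OF f])
  next
    fix f g assume "f \<in> carrier (Hom_module R M N)" "g \<in> carrier (Hom_module R M N)"
    hence f: "f \<in> module_homs R M N" and g: "g \<in> module_homs R M N" by (simp_all add: Hom_module_def)
    show "f \<oplus>\<^bsub>Hom_module R M N\<^esub> g \<in> carrier (Hom_module R M N)"
      using add[OF f g] by (simp add: Hom_module_def)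
    show "f \<oplus>\<^bsub>Hom_module R M N\<^esub> g = g \<oplus>\<^bsub>Hom_module R M N\<^esub> f"
      unfolding Hom_module_def by (auto intro!: restrict_ext simp: cl[OF f] cl[OF g] N.M.a_comm)
    fix h assume "h \<in> carrier (Hom_module R M N)"
    hence h: "h \<in> module_homs R M N" by (simp add: Hom_module_def)
    show "f \<oplus>\<^bsub>Hom_module R M N\<^esub> g \<oplus>\<^bsub>Hom_module R M N\<^esub> h =
        f \<oplus>\<^bsub>Hom_module R M N\<^esub> (g \<oplus>\<^bsub>Hom_module R M N\<^esub> h)"
      unfolding Hom_module_def
      by (auto intro!: restrict_ext simp: cl[OF f] cl[OF g] cl[OF h] N.M.a_assoc)
  next
    show "\<zero>\<^bsub>Hom_module R M N\<^esub> \<in> carrier (Hom_module R M N)"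
      using zero by (simp add: Hom_module_def)
  next
    fix r f assume r: "r \<in> carrier R" and "f \<in> carrier (Hom_module R M N)"
    hence f: "f \<in> module_homs R M N" by (simp add: Hom_module_def)
    show "r \<odot>\<^bsub>Hom_module R M N\<^esub> f \<in> carrier (Hom_module R M N)"
      using smult[OF f r] by (simp add: Hom_module_def)
  next
    fix r s f assume r: "r \<in> carrier R" "s \<in> carrier R" and "f \<in> carrier (Hom_module R M N)"
    hence f: "f \<in> module_homs R M N" by (simp add: Hom_module_def)
    show "(r \<oplus>\<^bsub>R\<^esub> s) \<odot>\<^bsub>Hom_module R M N\<^esub> f =
        r \<odot>\<^bsub>Hom_module R M N\<^esub> f \<oplus>\<^bsub>Hom_module R M N\<^esub> s \<odot>\<^bsub>Hom_module R M N\<^esub> f"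
      and "(r \<otimes>\<^bsub>R\<^esub> s) \<odot>\<^bsub>Hom_module R M N\<^esub> f =
        r \<odot>\<^bsub>Hom_module R M N\<^esub> (s \<odot>\<^bsub>Hom_module R M N\<^esub> f)"
      unfolding Hom_module_def
      by (auto intro!: restrict_ext simp: cl[OF f] r N.smult_l_distr N.smult_assoc1)
  next
    fix r f g assume r: "r \<in> carrier R"
      and "f \<in> carrier (Hom_module R M N)" "g \<in> carrier (Hom_module R M N)"
    hence f: "f \<in> module_homs R M N" and g: "g \<in> module_homs R M N" by (simp_all add: Hom_module_def)
    show "r \<odot>\<^bsub>Hom_module R M N\<^esub> (f \<oplus>\<^bsub>Hom_module R M N\<^esub> g) =
        r \<odot>\<^bsub>Hom_module R M N\<^esub> f \<oplus>\<^bsub>Hom_module R M N\<^esub> r \<odot>\<^bsub>Hom_module R M N\<^esub> g"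
      unfolding Hom_module_def
      by (auto intro!: restrict_ext simp: cl[OF f] cl[OF g] r N.smult_r_distr)
  qed
qed

lemma Ext_coboundary_hom:
  assumes "cring R" "\<phi> \<in> carrier (Ext_cochains R i M N)"
  shows "Ext_coboundary R i M \<phi> \<in> carrier (Ext_cochains R (Suc i) M N)"
  using module_homs_comp[OF res_module_module[OF assms(1)] res_diff_hom[OF assms(1)]] assms(2)
  by (simp add: Ext_cochains_def Ext_coboundary_def Hom_module_def)

lemma Ext_coboundary_linear:
  assumes "cring R"
  shows "Ext_coboundary R i M (\<phi> \<oplus>\<^bsub>Ext_cochains R i M N\<^esub> \<psi>) =
      Ext_coboundary R i M \<phi> \<oplus>\<^bsub>Ext_cochains R (Suc i) M N\<^esub> Ext_coboundary R i M \<psi>"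
    and "Ext_coboundary R i M (r \<odot>\<^bsub>Ext_cochains R i M N\<^esub> \<phi>) =
      r \<odot>\<^bsub>Ext_cochains R (Suc i) M N\<^esub> Ext_coboundary R i M \<phi>"
    and "Ext_coboundary R i M \<zero>\<^bsub>Ext_cochains R i M N\<^esub> = \<zero>\<^bsub>Ext_cochains R (Suc i) M N\<^esub>"
  using module_homsD(1)[OF res_diff_hom[OF assms, of M i]]
  by (auto simp: Ext_coboundary_def Ext_cochains_def Hom_module_def intro!: restrict_ext)

lemma Ext_coboundary_twice:
  assumes "cring R" "Module.module R N" "\<phi> \<in> carrier (Ext_cochains R i M N)"
  shows "Ext_coboundary R (Suc i) M (Ext_coboundary R i M \<phi>) = \<zero>\<^bsub>Ext_cochains R (Suc (Suc i)) M N\<^esub>"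
proof -
  have \<phi>: "\<phi> \<in> module_homs R (res_module R M i) N"
    using assms(3) by (simp add: Ext_cochains_def Hom_module_def)
  have 0: "\<phi> \<zero>\<^bsub>res_module R M i\<^esub> = \<zero>\<^bsub>N\<^esub>"
    by (rule module_homs_zero[OF res_module_module[OF assms(1)] assms(2) \<phi>])
  have "res_diff R M (Suc i) v \<in> carrier (res_module R M (Suc i)) \<and>
      \<phi> (res_diff R M i (res_diff R M (Suc i) v)) = \<zero>\<^bsub>N\<^esub>"
    if "v \<in> carrier (res_module R M (Suc (Suc i)))" for v
    proof -
    have "res_diff R M (Suc i) v \<in> {v \<in> carrier (res_module R M (Suc i)). res_diff R M i v = \<zero>\<^bsub>res_module R M i\<^esub>}"
      unfolding res_exact_Suc[OF assms(1), of M i, symmetric] using that by (rule imageI)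
    thus ?thesis using 0 by simp
  qed
  thus ?thesis
    by (auto simp: Ext_coboundary_def Ext_cochains_def Hom_module_def intro!: restrict_ext)
qed

lemma Ext_module:
  assumes "Module.module R M" "Module.module R N"
  shows "Module.module R (Ext R i M N)"
proof -
  interpret M: Module.module R M by fact
  have R: "cring R" by (rule M.R.is_cring)
  have C: "Module.module R (Ext_cochains R j M N)" for j
    unfolding Ext_cochains_def by (intro Hom_module_module res_module_module R assms)
  interpret C: Module.module R "Ext_cochains R j M N" for j by (rule C)
  note lin = Ext_coboundary_linear[OF R]
  have Z: "Module.module R (submodule_on (Ext_cocycles R i M N) (Ext_cochains R i M N))"
    by (rule submodule_on_module[OF C]) (auto simp: Ext_cocycles_def lin)
  show ?thesis
    unfolding Ext_def
  proof (rule quotient_module_module(1)[OF Z])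
    let ?B = "Ext_coboundaries R i M N"
    show "?B \<subseteq> carrier (submodule_on (Ext_cocycles R i M N) (Ext_cochains R i M N))"
      by (auto simp: Ext_coboundaries_def submodule_on_def Ext_cocycles_def lin
          Ext_coboundary_hom[OF R] Ext_coboundary_twice[OF R assms(2)] split: nat.split)
    show "\<zero>\<^bsub>submodule_on (Ext_cocycles R i M N) (Ext_cochains R i M N)\<^esub> \<in> ?B"
      by (cases i) (auto simp: Ext_coboundaries_def submodule_on_def simp flip: lin(3))
    show "x \<oplus>\<^bsub>submodule_on (Ext_cocycles R i M N) (Ext_cochains R i M N)\<^esub> y \<in> ?B"
      if "x \<in> ?B" "y \<in> ?B" for x y
      using that by (cases i) (auto simp: Ext_coboundaries_def submodule_on_def simp flip: lin(1))
    show "r \<odot>\<^bsub>submodule_on (Ext_cocycles R i M N) (Ext_cochains R i M N)\<^esub> x \<in> ?B"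
      if "r \<in> carrier R" "x \<in> ?B" for r x
      using that by (cases i) (auto simp: Ext_coboundaries_def submodule_on_def simp flip: lin(2))
  qed
qed

lemma ideal_quotient_module:
  assumes "cring R" "ideal I R"
  shows "Module.module R (quotient_module (regular_module R) I)"
proof -
  interpret I: ideal I R by fact
  show ?thesis
    by (rule quotient_module_module(1)[OF regular_module_module[OF assms(1)]])
       (auto simp: regular_module_def I.I_l_closed)
qed

end

theory Submission
  imports Defs
begin

text \<open>
  Killing an element \<open>x\<close> that is regular on \<open>M\<close> and acts as zero on \<open>N\<close> shifts Ext: the mapping
  cone of \<open>x\<close> on a free resolution of \<open>M\<close> resolves \<open>M/xM\<close>, and since \<open>xN = 0\<close> a cocycle of degree
  \<open>i\<close> for \<open>M\<close> that is no coboundary yields one of degree \<open>i + 1\<close> for \<open>M/xM\<close>. Applied to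
  \<open>x\<^sub>1, \<dots>, x\<^bsub>n-1\<^esub>\<close>, this reduces the claim to \<open>Ext\<^sup>2(R/\<mm>\<^sub>1, F) \<noteq> 0\<close>.

  As \<open>\<mm>\<^sub>1\<close> is the union of the ideals \<open>(x\<^sub>n\<^bsup>\<epsilon>\<^sub>k\<^esup>)\<close>, the module \<open>R/\<mm>\<^sub>1\<close> has a telescope resolution of
  length \<open>2\<close>, and \<open>Ext\<^sup>2(R/\<mm>\<^sub>1, F)\<close> is the cokernel of \<open>(b\<^sub>k) \<mapsto> (b\<^sub>k - x\<^bsup>\<epsilon>\<^sub>k-\<epsilon>\<^bsub>k+1\<^esub>\<^esup> b\<^bsub>k+1\<^esub>)\<close> on
  sequences in \<open>F\<close>. Let \<open>c\<^sub>k\<close> be \<open>x\<^bsup>\<epsilon>\<^sub>k\<^esup>\<close> in the \<open>k\<close>-th summand. A preimage \<open>b\<close> of \<open>c\<close> would have the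
  monomial \<open>x\<^bsup>\<epsilon>\<^sub>0\<^esup>\<close> in every coordinate of \<open>b\<^sub>0\<close>, contradicting finite support.
\<close>

section \<open>Linear maps and lifting\<close>

text \<open>Linearity on the carrier only: unlike in \<open>module_homs\<close>, values elsewhere
  are free, so sums, compositions and projections are linear as plain functions, without
  \<open>restrict\<close>.\<close>

definition mod_lin ::
    "('r, 'x) ring_scheme \<Rightarrow> ('r, 'a) module \<Rightarrow> ('r, 'b) module \<Rightarrow> ('a \<Rightarrow> 'b) \<Rightarrow> bool" where
  "mod_lin R M N f \<longleftrightarrow> f \<in> carrier M \<rightarrow> carrier N \<and>
     (\<forall>x\<in>carrier M. \<forall>y\<in>carrier M. f (x \<oplus>\<^bsub>M\<^esub> y) = f x \<oplus>\<^bsub>N\<^esub> f y) \<and>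
     (\<forall>r\<in>carrier R. \<forall>x\<in>carrier M. f (r \<odot>\<^bsub>M\<^esub> x) = r \<odot>\<^bsub>N\<^esub> f x)"

lemma mod_linI:
  assumes "\<And>x. x \<in> carrier M \<Longrightarrow> f x \<in> carrier N"
    and "\<And>x y. x \<in> carrier M \<Longrightarrow> y \<in> carrier M \<Longrightarrow> f (x \<oplus>\<^bsub>M\<^esub> y) = f x \<oplus>\<^bsub>N\<^esub> f y"
    and "\<And>r x. r \<in> carrier R \<Longrightarrow> x \<in> carrier M \<Longrightarrow> f (r \<odot>\<^bsub>M\<^esub> x) = r \<odot>\<^bsub>N\<^esub> f x"
  shows "mod_lin R M N f"
  using assms by (auto simp: mod_lin_def)

lemma mod_linD:
  assumes "mod_lin R M N f"
  shows "x \<in> carrier M \<Longrightarrow> f x \<in> carrier N"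
    and "x \<in> carrier M \<Longrightarrow> y \<in> carrier M \<Longrightarrow> f (x \<oplus>\<^bsub>M\<^esub> y) = f x \<oplus>\<^bsub>N\<^esub> f y"
    and "r \<in> carrier R \<Longrightarrow> x \<in> carrier M \<Longrightarrow> f (r \<odot>\<^bsub>M\<^esub> x) = r \<odot>\<^bsub>N\<^esub> f x"
  using assms by (auto simp: mod_lin_def)

lemma mod_lin_restrict:
  assumes "Module.module R M" "mod_lin R M N f"
  shows "restrict f (carrier M) \<in> module_homs R M N"
proof -
  interpret Module.module R M by fact
  show ?thesis using assms(2) by (auto simp: mod_lin_def module_homs_def)
qed

lemma module_homs_mod_lin: "f \<in> module_homs R M N \<Longrightarrow> mod_lin R M N f"
  by (auto simp: mod_lin_def module_homs_def)

lemma mod_lin_zero: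
  assumes "Module.module R M" "Module.module R N" "mod_lin R M N f"
  shows "f \<zero>\<^bsub>M\<^esub> = \<zero>\<^bsub>N\<^esub>"
proof -
  interpret M: Module.module R M by fact
  show ?thesis
    using module_homs_zero[OF assms(1,2) mod_lin_restrict[OF assms(1,3)]] by simp
qed

lemma mod_lin_minus:
  assumes "Module.module R M" "Module.module R N" "mod_lin R M N f"
    and x: "x \<in> carrier M" and y: "y \<in> carrier M"
  shows "f (x \<ominus>\<^bsub>M\<^esub> y) = f x \<ominus>\<^bsub>N\<^esub> f y"
proof -
  interpret M: Module.module R M by fact
  interpret N: Module.module R N by fact
  note f = mod_linD[OF assms(3)]
  have xy: "x \<ominus>\<^bsub>M\<^esub> y \<in> carrier M" using x y by simp
  have "f x = f ((x \<ominus>\<^bsub>M\<^esub> y) \<oplus>\<^bsub>M\<^esub> y)"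
    using x y by (simp add: M.minus_eq M.a_assoc M.l_neg)
  also have "\<dots> = f (x \<ominus>\<^bsub>M\<^esub> y) \<oplus>\<^bsub>N\<^esub> f y" by (rule f(2)[OF xy y])
  finally show ?thesis
    using f(1)[OF xy] f(1)[OF y] by (simp add: N.minus_eq N.a_assoc N.r_neg)
qed

lemma (in abelian_group) eq_of_minus:
  assumes "a \<ominus> b = \<zero>" "a \<in> carrier G" "b \<in> carrier G"
  shows "a = b"
proof -
  have "a = a \<oplus> \<ominus> b \<oplus> b" using assms(2,3) by (simp add: a_assoc l_neg)
  also have "\<dots> = b" using assms by (simp add: minus_eq[symmetric])
  finally show ?thesis .
qed

lemma (in abelian_group) eq_add_of_minus_minus:
  assumes "a \<ominus> b \<ominus> c = \<zero>" "a \<in> carrier G" "b \<in> carrier G" "c \<in> carrier G"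
  shows "a = b \<oplus> c"
proof -
  have "a \<ominus> (b \<oplus> c) = a \<ominus> b \<ominus> c" 
   using assms(2-) unfolding minus_eq by (simp add: minus_add a_assoc)
  with assms show ?thesis by (auto intro: eq_of_minus[of a "b \<oplus> c"])
qed

lemma mod_lin_comp:
  assumes f: "mod_lin R L M f" and g: "mod_lin R M N g"
  shows "mod_lin R L N (\<lambda>x. g (f x))"
  by (rule mod_linI) (simp_all add: mod_linD[OF f] mod_linD[OF g])

lemma mod_lin_add:
  assumes "Module.module R N" and f: "mod_lin R M N f" and g: "mod_lin R M N g"
  shows "mod_lin R M N (\<lambda>x. f x \<oplus>\<^bsub>N\<^esub> g x)"
proof -
  interpret N: Module.module R N by fact
  show ?thesis
    by (rule mod_linI)
       (simp_all add: mod_linD[OF f] mod_linD[OF g] N.a_ac N.smult_r_distr)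
qed

lemma mod_lin_diff:
  assumes "Module.module R N" and f: "mod_lin R M N f" and g: "mod_lin R M N g"
  shows "mod_lin R M N (\<lambda>x. f x \<ominus>\<^bsub>N\<^esub> g x)"
proof -
  interpret N: Module.module R N by fact
  show ?thesis
    by (rule mod_linI)
       (simp_all add: mod_linD[OF f] mod_linD[OF g] N.a_ac N.smult_r_distr N.minus_eq
          N.minus_add N.smult_r_minus)
qed

lemma mod_lin_id: "mod_lin R M M (\<lambda>x. x)"
  by (simp add: mod_lin_def)

text \<open>
  \<open>P\<close> is projective if this holds for all \<open>M\<close> and \<open>N\<close>. As HOL cannot quantify over the types
  of \<open>M\<close> and \<open>N\<close>, these remain parameters.
\<close>

definition lifts ::
    "('r, 'x) ring_scheme \<Rightarrow> ('r, 'p) module \<Rightarrow> ('r, 'a) module \<Rightarrow> ('r, 'b) module \<Rightarrow> bool" where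
  "lifts R P M N \<longleftrightarrow> (\<forall>f g. mod_lin R P N f \<longrightarrow> mod_lin R M N g \<longrightarrow>
     f ` carrier P \<subseteq> g ` carrier M \<longrightarrow>
     (\<exists>h. mod_lin R P M h \<and> (\<forall>x\<in>carrier P. g (h x) = f x)))"

lemma liftsE:
  assumes "lifts R P M N" "mod_lin R P N f" "mod_lin R M N g"
    and "\<And>x. x \<in> carrier P \<Longrightarrow> f x \<in> g ` carrier M"
  obtains h where "mod_lin R P M h" "\<And>x. x \<in> carrier P \<Longrightarrow> g (h x) = f x"
  using assms unfolding lifts_def by blast

text \<open>The difference of the two maps vanishes on the basis, hence everywhere by
  \<open>hom_vanishI\<close>.\<close>

lemma mod_lin_eq_on_basis:
  assumes "Module.module R N"
    and f: "mod_lin R (free_module R S) N f" and g: "mod_lin R (free_module R S) N g"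
    and eq: "\<And>s. s \<in> S \<Longrightarrow> f (free_basis R S s) = g (free_basis R S s)"
    and v: "v \<in> carrier (free_module R S)"
  shows "f v = g v"
proof -
  interpret N: Module.module R N by fact
  have R: "cring R" by (rule N.R.is_cring)
  let ?h = "restrict (\<lambda>x. f x \<ominus>\<^bsub>N\<^esub> g x) (carrier (free_module R S))"
  have "?h v = \<zero>\<^bsub>N\<^esub>"
  proof (rule hom_vanishI[OF R N.module_axioms _ _ v])
    show "?h \<in> module_homs R (free_module R S) N"
      by (intro mod_lin_restrict free_module_module R mod_lin_diff f g N.module_axioms)
  qed (use eq in \<open>simp_all add: free_basis_closed[OF R] mod_linD(1)[OF g] N.minus_eq N.r_neg\<close>)
  then show ?thesis
    using v mod_linD(1)[OF f v] mod_linD(1)[OF g v] by (auto intro: N.eq_of_minus[of "f v" "g v"])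
qed

text \<open>Preimages under \<open>g\<close> are chosen for the images of the basis elements; their
  linear extension is the lift.\<close>

lemma lifts_free_module:
  assumes "Module.module R M" "Module.module R N"
  shows "lifts R (free_module R S) M N"
  unfolding lifts_def
proof (intro allI impI)
  fix f g
  assume f: "mod_lin R (free_module R S) N f" and g: "mod_lin R M N g"
    and sub: "f ` carrier (free_module R S) \<subseteq> g ` carrier M"
  have R: "cring R" using assms(1) by (simp add: Module.module_def)
  have "\<exists>m. m \<in> carrier M \<and> g m = f (free_basis R S s)" if "s \<in> S" for s
    using sub free_basis_closed[OF R that] by force
  then obtain m where m: "\<And>s. s \<in> S \<Longrightarrow> m s \<in> carrier M"
    "\<And>s. s \<in> S \<Longrightarrow> g (m s) = f (free_basis R S s)"
    by metis
  let ?h = "free_lift R S M m"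
  have h: "mod_lin R (free_module R S) M ?h"
    by (rule module_homs_mod_lin[OF free_lift_hom[OF assms(1) m(1)]])
  have "g (?h x) = f x" if "x \<in> carrier (free_module R S)" for x
    by (rule mod_lin_eq_on_basis[OF assms(2) mod_lin_comp[OF h g] f _ that])
       (simp add: free_lift_basis[OF assms(1) m(1)] m(2))
  with h show "\<exists>h. mod_lin R (free_module R S) M h \<and>
      (\<forall>x\<in>carrier (free_module R S). g (h x) = f x)" by blast
qed

section \<open>Comparison of resolutions\<close>

text \<open>The index convention is that \<open>d i\<close> goes from degree \<open>Suc i\<close> to
  degree \<open>i\<close>. Projectivity of the terms is kept apart, in \<open>lifts\<close>
  hypotheses. As a family over \<open>nat\<close>, all terms share one element type.\<close>

definition resolves ::
    "('r, 'x) ring_scheme \<Rightarrow> ('r, 'm) module \<Rightarrow> (nat \<Rightarrow> ('r, 'a) module) \<Rightarrow>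
      ('a \<Rightarrow> 'm) \<Rightarrow> (nat \<Rightarrow> 'a \<Rightarrow> 'a) \<Rightarrow> bool" where
  "resolves R M Q e d \<longleftrightarrow> Module.module R M \<and> (\<forall>i. Module.module R (Q i)) \<and>
     mod_lin R (Q 0) M e \<and> (\<forall>i. mod_lin R (Q (Suc i)) (Q i) (d i)) \<and>
     e ` carrier (Q 0) = carrier M \<and>
     d 0 ` carrier (Q (Suc 0)) = {v \<in> carrier (Q 0). e v = \<zero>\<^bsub>M\<^esub>} \<and>
     (\<forall>i. d (Suc i) ` carrier (Q (Suc (Suc i))) = {v \<in> carrier (Q (Suc i)). d i v = \<zero>\<^bsub>Q i\<^esub>})"

lemma resolvesD:
  assumes "resolves R M Q e d"
  shows "Module.module R M" "Module.module R (Q i)" "mod_lin R (Q 0) M e"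
    "mod_lin R (Q (Suc i)) (Q i) (d i)" "e ` carrier (Q 0) = carrier M"
    "d 0 ` carrier (Q (Suc 0)) = {v \<in> carrier (Q 0). e v = \<zero>\<^bsub>M\<^esub>}"
    "d (Suc i) ` carrier (Q (Suc (Suc i))) = {v \<in> carrier (Q (Suc i)). d i v = \<zero>\<^bsub>Q i\<^esub>}"
    "x \<in> carrier (Q (Suc 0)) \<Longrightarrow> e (d 0 x) = \<zero>\<^bsub>M\<^esub>"
    "x \<in> carrier (Q (Suc (Suc i))) \<Longrightarrow> d i (d (Suc i) x) = \<zero>\<^bsub>Q i\<^esub>"
  using assms by (simp_all add: resolves_def) blast+

lemma res_module_resolves:
  assumes "Module.module R M"
  shows "resolves R M (res_module R M) (res_aug R M) (res_diff R M)"
proof -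
  interpret Module.module R M by fact
  show ?thesis
    unfolding resolves_def
    by (intro conjI allI assms res_module_module R.is_cring module_homs_mod_lin[OF res_aug_hom]
      module_homs_mod_lin[OF res_diff_hom] res_aug_surj res_exact_0 res_exact_Suc)
qed

text \<open>The comparison theorem: the identity of \<open>M\<close> lifts degree by degree, since
  exactness of \<open>Q\<close> makes each required value a boundary and the terms of
  \<open>P\<close> lift along the maps of \<open>Q\<close>.\<close>

lemma lift_chain_map:
  assumes P: "resolves R M P eP dP" and Q: "resolves R M Q eQ dQ"
    and l0: "lifts R (P 0) (Q 0) M" and l: "\<And>i. lifts R (P (Suc i)) (Q (Suc i)) (Q i)"
  shows "\<exists>f. (\<forall>i. mod_lin R (P i) (Q i) (f i)) \<and> (\<forall>x\<in>carrier (P 0). eQ (f 0 x) = eP x) \<and>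
    (\<forall>i. \<forall>x\<in>carrier (P (Suc i)). dQ i (f (Suc i) x) = f i (dP i x))"
proof -
  note PD = resolvesD[OF P] and QD = resolvesD[OF Q]
  \<comment> \<open>The invariant carries what the next choice consumes: the composite with
    \<open>dP i\<close> lands in the image of \<open>dQ i\<close>. Degree 0 also records
    compatibility with the augmentations.\<close>
  define good where "good = (\<lambda>i h. mod_lin R (P i) (Q i) h \<and>
     (i = 0 \<longrightarrow> (\<forall>x\<in>carrier (P 0). eQ (h x) = eP x)) \<and>
     (\<forall>x\<in>carrier (P (Suc i)). h (dP i x) \<in> dQ i ` carrier (Q (Suc i))))"
  have "\<exists>f. \<forall>i. good i (f i) \<and>
      (\<forall>x\<in>carrier (P (Suc i)). dQ i (f (Suc i) x) = f i (dP i x))"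
  proof (rule dependent_nat_choice)
    obtain h where h: "mod_lin R (P 0) (Q 0) h" "\<And>x. x \<in> carrier (P 0) \<Longrightarrow> eQ (h x) = eP x"
      by (rule liftsE[OF l0 PD(3) QD(3)]) (use QD(5) mod_linD(1)[OF PD(3)] in auto)
    have "h (dP 0 x) \<in> dQ 0 ` carrier (Q (Suc 0))" if "x \<in> carrier (P (Suc 0))" for x
      using that h mod_linD(1)[OF h(1)] mod_linD(1)[OF PD(4)] PD(8) by (simp add: QD(6))
    with h show "\<exists>h. good 0 h" unfolding good_def by blast
  next
    fix h i assume "good i h"
    hence h: "mod_lin R (P i) (Q i) h"
      "\<And>x. x \<in> carrier (P (Suc i)) \<Longrightarrow> h (dP i x) \<in> dQ i ` carrier (Q (Suc i))"
      by (auto simp: good_def)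
    obtain h' where h': "mod_lin R (P (Suc i)) (Q (Suc i)) h'"
      "\<And>x. x \<in> carrier (P (Suc i)) \<Longrightarrow> dQ i (h' x) = h (dP i x)"
      by (rule liftsE[OF l mod_lin_comp[OF PD(4) h(1)] QD(4)]) (use h(2) in auto)
    have "h' (dP (Suc i) x) \<in> dQ (Suc i) ` carrier (Q (Suc (Suc i)))"
      if x: "x \<in> carrier (P (Suc (Suc i)))" for x
      using x mod_linD(1)[OF PD(4) x] mod_linD(1)[OF h'(1)] h'(2) PD(9)
        mod_lin_zero[OF PD(2) QD(2) h(1)] by (simp add: QD(7))
    with h' show "\<exists>h'. good (Suc i) h' \<and>
        (\<forall>x\<in>carrier (P (Suc i)). dQ i (h' x) = h (dP i x))"
      unfolding good_def by blast
  qed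
  then obtain f where f: "\<And>i. good i (f i)"
    "\<And>i x. x \<in> carrier (P (Suc i)) \<Longrightarrow> dQ i (f (Suc i) x) = f i (dP i x)" by blast
  show ?thesis
    using f unfolding good_def by (intro exI[of _ f] conjI) blast+
qed

text \<open>A chain map over the identity of \<open>M\<close> is homotopic to the identity. The
  homotopy equation is stated in the degrees \<open>Suc i\<close>, in which cohomology is later
  tested.\<close>

lemma chain_homotopy_to_id:
  assumes Q: "resolves R M Q e d" and l: "\<And>i. lifts R (Q i) (Q (Suc i)) (Q i)"
    and f: "\<And>i. mod_lin R (Q i) (Q i) (f i)"
    and fe: "\<And>x. x \<in> carrier (Q 0) \<Longrightarrow> e (f 0 x) = e x"
    and fd: "\<And>i x. x \<in> carrier (Q (Suc i)) \<Longrightarrow> d i (f (Suc i) x) = f i (d i x)"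
  shows "\<exists>s. (\<forall>i. mod_lin R (Q i) (Q (Suc i)) (s i)) \<and> (\<forall>i. \<forall>x\<in>carrier (Q (Suc i)).
      d (Suc i) (s (Suc i) x) = x \<ominus>\<^bsub>Q (Suc i)\<^esub> f (Suc i) x \<ominus>\<^bsub>Q (Suc i)\<^esub> s i (d i x))"
proof -
  note QD = resolvesD[OF Q]
  interpret M: Module.module R M by (rule QD)
  interpret Q: Module.module R "Q j" for j by (rule QD)
  \<comment> \<open>The homotopy equation in degree \<open>i\<close>, restricted to boundaries
    \<open>d i x\<close>, where the term with the previous homotopy drops out because
    \<open>d\<close> squares to zero. It makes \<open>x - f x - h (d x)\<close> a cycle one degree
    up.\<close>
  define good where "good = (\<lambda>i h. mod_lin R (Q i) (Q (Suc i)) h \<and>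
     (\<forall>x\<in>carrier (Q (Suc i)). d i (h (d i x)) = d i x \<ominus>\<^bsub>Q i\<^esub> f i (d i x)))"
  have "\<exists>s. \<forall>i. good i (s i) \<and> (\<forall>x\<in>carrier (Q (Suc i)).
      d (Suc i) (s (Suc i) x) = x \<ominus>\<^bsub>Q (Suc i)\<^esub> f (Suc i) x \<ominus>\<^bsub>Q (Suc i)\<^esub> s i (d i x))"
  proof (rule dependent_nat_choice)
    have lin: "mod_lin R (Q 0) (Q 0) (\<lambda>x. x \<ominus>\<^bsub>Q 0\<^esub> f 0 x)"
      by (intro mod_lin_diff QD mod_lin_id f)
    have "x \<ominus>\<^bsub>Q 0\<^esub> f 0 x \<in> d 0 ` carrier (Q (Suc 0))" if x: "x \<in> carrier (Q 0)" for x
      using x mod_linD(1)[OF f x] mod_lin_minus[OF QD(2) QD(1) QD(3) x mod_linD(1)[OF f x]] fe[OF x]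
        mod_linD(1)[OF QD(3) x]
      by (simp add: QD(6) M.minus_eq M.r_neg)
    then obtain h where h: "mod_lin R (Q 0) (Q (Suc 0)) h"
      "\<And>x. x \<in> carrier (Q 0) \<Longrightarrow> d 0 (h x) = x \<ominus>\<^bsub>Q 0\<^esub> f 0 x"
      by (rule liftsE[OF l lin QD(4)]) auto
    then have "good 0 h"
      using mod_linD(1)[OF QD(4)] by (auto simp: good_def)
    then show "\<exists>h. good 0 h" by blast
  next
    fix h i assume "good i h"
    hence h: "mod_lin R (Q i) (Q (Suc i)) h"
      "\<And>x. x \<in> carrier (Q (Suc i)) \<Longrightarrow> d i (h (d i x)) = d i x \<ominus>\<^bsub>Q i\<^esub> f i (d i x)"
      by (auto simp: good_def)
    let ?g = "\<lambda>x. x \<ominus>\<^bsub>Q (Suc i)\<^esub> f (Suc i) x \<ominus>\<^bsub>Q (Suc i)\<^esub> h (d i x)"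
    have lin: "mod_lin R (Q (Suc i)) (Q (Suc i)) ?g"
      by (intro mod_lin_diff QD mod_lin_id f mod_lin_comp[OF QD(4) h(1)])
    have "?g x \<in> d (Suc i) ` carrier (Q (Suc (Suc i)))" if x: "x \<in> carrier (Q (Suc i))" for x
    proof -
      note c = mod_linD(1)[OF f x] mod_linD(1)[OF QD(4) x]
        mod_linD(1)[OF h(1) mod_linD(1)[OF QD(4) x]]
      note m = mod_lin_minus[OF QD(2) QD(2) QD(4)]
      have "d i (?g x) = d i x \<ominus>\<^bsub>Q i\<^esub> f i (d i x) \<ominus>\<^bsub>Q i\<^esub> (d i x \<ominus>\<^bsub>Q i\<^esub> f i (d i x))"
        using c x by (simp add: m h(2) fd)
      also have "\<dots> = \<zero>\<^bsub>Q i\<^esub>"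
        using c mod_linD(1)[OF f c(2)] by (simp add: Q.r_neg Q.minus_eq[of _ "_ \<ominus>\<^bsub>Q i\<^esub> _"])
      finally have "d i (?g x) = \<zero>\<^bsub>Q i\<^esub>" .
      then show ?thesis using c x by (simp add: QD(7))
    qed
    then obtain h' where h': "mod_lin R (Q (Suc i)) (Q (Suc (Suc i))) h'"
      "\<And>x. x \<in> carrier (Q (Suc i)) \<Longrightarrow> d (Suc i) (h' x) = ?g x"
      by (rule liftsE[OF l lin QD(4)]) auto
    have "good (Suc i) h'"
      unfolding good_def
    proof (intro conjI ballI h')
      fix x assume x: "x \<in> carrier (Q (Suc (Suc i)))"
      have c: "d (Suc i) x \<in> carrier (Q (Suc i))" by (rule mod_linD(1)[OF QD(4) x])
      show "d (Suc i) (h' (d (Suc i) x)) = d (Suc i) x \<ominus>\<^bsub>Q (Suc i)\<^esub> f (Suc i) (d (Suc i) x)"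
        using c mod_linD(1)[OF f c]
        by (simp add: h'(2) QD(9)[OF x] mod_lin_zero[OF QD(2) QD(2) h(1)] Q.minus_eq)
    qed
    with h' show "\<exists>h'. good (Suc i) h' \<and> (\<forall>x\<in>carrier (Q (Suc i)). d (Suc i) (h' x) = ?g x)"
      by blast
  qed
  then obtain s where s: "\<And>i. good i (s i)" "\<And>i x. x \<in> carrier (Q (Suc i)) \<Longrightarrow>
      d (Suc i) (s (Suc i) x) = x \<ominus>\<^bsub>Q (Suc i)\<^esub> f (Suc i) x \<ominus>\<^bsub>Q (Suc i)\<^esub> s i (d i x)"
    by blast
  then show ?thesis
    unfolding good_def by (intro exI[of _ s] conjI) blast+
qed

text \<open>Vanishing of the cohomology of \<open>Hom(Q, N)\<close> in degree \<open>i + 1\<close>.\<close>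

definition cohom_trivial ::
    "('r, 'x) ring_scheme \<Rightarrow> (nat \<Rightarrow> ('r, 'a) module) \<Rightarrow> (nat \<Rightarrow> 'a \<Rightarrow> 'a) \<Rightarrow> nat \<Rightarrow>
      ('r, 'b) module \<Rightarrow> bool" where
  "cohom_trivial R Q d i N \<longleftrightarrow> (\<forall>\<phi>. mod_lin R (Q (Suc i)) N \<phi> \<longrightarrow>
     (\<forall>x\<in>carrier (Q (Suc (Suc i))). \<phi> (d (Suc i) x) = \<zero>\<^bsub>N\<^esub>) \<longrightarrow>
     (\<exists>\<psi>. mod_lin R (Q i) N \<psi> \<and> (\<forall>x\<in>carrier (Q (Suc i)). \<phi> x = \<psi> (d i x))))"

lemma cohom_trivialD:
  assumes "cohom_trivial R Q d i N" "mod_lin R (Q (Suc i)) N \<phi>"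
    and "\<And>x. x \<in> carrier (Q (Suc (Suc i))) \<Longrightarrow> \<phi> (d (Suc i) x) = \<zero>\<^bsub>N\<^esub>"
  shows "\<exists>\<psi>. mod_lin R (Q i) N \<psi> \<and> (\<forall>x\<in>carrier (Q (Suc i)). \<phi> x = \<psi> (d i x))"
  using assms unfolding cohom_trivial_def by blast

section \<open>Independence of the resolution, and the Ext modules\<close>

text \<open>Let \<open>f\<close> and \<open>g\<close> be comparison maps from \<open>P\<close> to
  \<open>Q\<close> and back, and \<open>s\<close> a homotopy between \<open>f g\<close> and the
  identity of \<open>Q\<close>. A cocycle \<open>\<phi>\<close> on \<open>Q\<close> gives the
  cocycle \<open>\<phi> f\<close> on \<open>P\<close>; if this is \<open>\<psi> dP\<close>, then
  \<open>\<phi> = \<psi> g dQ + \<phi> s dQ\<close> is a coboundary.\<close>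

lemma cohom_trivial_transfer:
  assumes P: "resolves R M P eP dP" and Q: "resolves R M Q eQ dQ" and N: "Module.module R N"
    and PQ: "lifts R (P 0) (Q 0) M" "\<And>i. lifts R (P (Suc i)) (Q (Suc i)) (Q i)"
    and QP: "lifts R (Q 0) (P 0) M" "\<And>i. lifts R (Q (Suc i)) (P (Suc i)) (P i)"
    and QQ: "\<And>i. lifts R (Q i) (Q (Suc i)) (Q i)"
    and triv: "cohom_trivial R P dP i N"
  shows "cohom_trivial R Q dQ i N"
proof -
  note PD = resolvesD[OF P] and QD = resolvesD[OF Q]
  interpret Q: Module.module R "Q j" for j by (rule QD)
  interpret N: Module.module R N by (rule N)
  obtain f where f: "\<And>i. mod_lin R (P i) (Q i) (f i)"
      "\<And>x. x \<in> carrier (P 0) \<Longrightarrow> eQ (f 0 x) = eP x"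
      "\<And>i x. x \<in> carrier (P (Suc i)) \<Longrightarrow> dQ i (f (Suc i) x) = f i (dP i x)"
    using lift_chain_map[OF P Q PQ] by blast
  obtain g where g: "\<And>i. mod_lin R (Q i) (P i) (g i)"
      "\<And>x. x \<in> carrier (Q 0) \<Longrightarrow> eP (g 0 x) = eQ x"
      "\<And>i x. x \<in> carrier (Q (Suc i)) \<Longrightarrow> dP i (g (Suc i) x) = g i (dQ i x)"
    using lift_chain_map[OF Q P QP] by blast
  note gc = mod_linD(1)[OF g(1)] and fc = mod_linD(1)[OF f(1)]
  have "\<exists>s. (\<forall>i. mod_lin R (Q i) (Q (Suc i)) (s i)) \<and> (\<forall>i. \<forall>x\<in>carrier (Q (Suc i)). dQ (Suc i) (s (Suc i) x) =
       x \<ominus>\<^bsub>Q (Suc i)\<^esub> f (Suc i) (g (Suc i) x) \<ominus>\<^bsub>Q (Suc i)\<^esub> s i (dQ i x))"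
  proof (rule chain_homotopy_to_id[OF Q QQ, of "\<lambda>i x. f i (g i x)"])
    show "mod_lin R (Q i) (Q i) (\<lambda>x. f i (g i x))" for i by (rule mod_lin_comp[OF g(1) f(1)])
  qed (use f g gc in auto)
  then obtain s where s: "\<And>i. mod_lin R (Q i) (Q (Suc i)) (s i)"
    "\<And>i x. x \<in> carrier (Q (Suc i)) \<Longrightarrow> dQ (Suc i) (s (Suc i) x) =
       x \<ominus>\<^bsub>Q (Suc i)\<^esub> f (Suc i) (g (Suc i) x) \<ominus>\<^bsub>Q (Suc i)\<^esub> s i (dQ i x)"
    by blast
  show ?thesis
    unfolding cohom_trivial_def
  proof (intro allI impI)
    fix \<phi> assume \<phi>: "mod_lin R (Q (Suc i)) N \<phi>"
      and cocycle: "\<forall>x\<in>carrier (Q (Suc (Suc i))). \<phi> (dQ (Suc i) x) = \<zero>\<^bsub>N\<^esub>"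
    have "\<exists>\<psi>. mod_lin R (P i) N \<psi> \<and>
        (\<forall>x\<in>carrier (P (Suc i)). \<phi> (f (Suc i) x) = \<psi> (dP i x))"
    proof (rule cohom_trivialD[OF triv mod_lin_comp[OF f(1) \<phi>]])
      show "\<phi> (f (Suc i) (dP (Suc i) x)) = \<zero>\<^bsub>N\<^esub>" if "x \<in> carrier (P (Suc (Suc i)))" for x
        using cocycle fc that by (simp flip: f(3))
    qed
    then obtain \<psi> where \<psi>: "mod_lin R (P i) N \<psi>"
      "\<And>x. x \<in> carrier (P (Suc i)) \<Longrightarrow> \<phi> (f (Suc i) x) = \<psi> (dP i x)"
      by blast
    have "\<phi> x = \<psi> (g i (dQ i x)) \<oplus>\<^bsub>N\<^esub> \<phi> (s i (dQ i x))" if x: "x \<in> carrier (Q (Suc i))" for x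
    proof -
      have c: "g (Suc i) x \<in> carrier (P (Suc i))" "f (Suc i) (g (Suc i) x) \<in> carrier (Q (Suc i))"
        "s i (dQ i x) \<in> carrier (Q (Suc i))"
        using x gc fc mod_linD(1)[OF QD(4) x] mod_linD(1)[OF s(1)] by auto
      \<comment> \<open>\<open>\<phi>\<close> is applied to the homotopy equation; its left-hand
        side gives zero by the cocycle condition.\<close>
      have "\<phi> x \<ominus>\<^bsub>N\<^esub> \<phi> (f (Suc i) (g (Suc i) x)) \<ominus>\<^bsub>N\<^esub> \<phi> (s i (dQ i x)) = \<zero>\<^bsub>N\<^esub>"
        using bspec[OF cocycle mod_linD(1)[OF s(1) x]] x c
        by (simp add: s(2)[OF x] mod_lin_minus[OF QD(2) N \<phi>])
      moreover have n: "\<phi> x \<in> carrier N" "\<phi> (f (Suc i) (g (Suc i) x)) \<in> carrier N"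
        "\<phi> (s i (dQ i x)) \<in> carrier N"
        using x c mod_linD(1)[OF \<phi>] by auto
      ultimately have "\<phi> x = \<phi> (f (Suc i) (g (Suc i) x)) \<oplus>\<^bsub>N\<^esub> \<phi> (s i (dQ i x))"
        by (rule N.eq_add_of_minus_minus)
      then show ?thesis using \<psi>(2)[OF c(1)] g(3)[OF x] by simp
    qed
    then show "\<exists>\<psi>. mod_lin R (Q i) N \<psi> \<and> (\<forall>x\<in>carrier (Q (Suc i)). \<phi> x = \<psi> (dQ i x))"
      by (intro exI[of _ "\<lambda>y. \<psi> (g i y) \<oplus>\<^bsub>N\<^esub> \<phi> (s i y)"])
         (auto intro!: mod_lin_add N mod_lin_comp[OF g(1) \<psi>(1)] mod_lin_comp[OF s(1) \<phi>])
  qed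
qed

text \<open>The bridge from the quotient module to explicit cocycles: if Ext is zero, the coset of a
  cocycle is the set of coboundaries itself, and a cocycle lies in its own coset.\<close>

lemma Ext_trivial_imp_cohom_trivial:
  assumes M: "Module.module R M" and N: "Module.module R N"
    and triv: "carrier (Ext R (Suc i) M N) = {\<zero>\<^bsub>Ext R (Suc i) M N\<^esub>}"
  shows "cohom_trivial R (res_module R M) (res_diff R M) i N"
  unfolding cohom_trivial_def
proof (intro allI impI)
  interpret M: Module.module R M by (rule M)
  interpret N: Module.module R N by (rule N)
  have R: "cring R" by (rule M.R.is_cring)
  note Pm = res_module_module[OF R, of M]
  fix \<phi> assume \<phi>: "mod_lin R (res_module R M (Suc i)) N \<phi>"
    and cocycle: "\<forall>x\<in>carrier (res_module R M (Suc (Suc i))). \<phi> (res_diff R M (Suc i) x) = \<zero>\<^bsub>N\<^esub>"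
  \<comment> \<open>Members of \<open>Ext_cochains\<close> are extensional, so \<open>\<phi>\<close>
    is first cut down to the carrier.\<close>
  let ?\<phi> = "restrict \<phi> (carrier (res_module R M (Suc i)))"
  let ?C = "Ext_cochains R (Suc i) M N"
  let ?Z = "submodule_on (Ext_cocycles R (Suc i) M N) ?C"
  let ?B = "Ext_coboundaries R (Suc i) M N"
  interpret C: Module.module R ?C
    unfolding Ext_cochains_def by (intro Hom_module_module Pm R N)
  have hom: "?\<phi> \<in> module_homs R (res_module R M (Suc i)) N"
    by (rule mod_lin_restrict[OF Pm \<phi>])
  have Z: "?\<phi> \<in> Ext_cocycles R (Suc i) M N"
    using hom cocycle module_homsD(1)[OF res_diff_hom[OF R, of M "Suc i"]]
    by (simp add: Ext_cocycles_def Ext_cochains_def Hom_module_def Ext_coboundary_def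
        cong: restrict_cong)
  have 0: "\<zero>\<^bsub>?C\<^esub> \<in> ?B"
    unfolding Ext_coboundaries_def
    using Ext_coboundary_linear(3)[OF R, of i M N]
      Module.module.axioms(2)[OF Hom_module_module[OF R Pm N], THEN abelian_group.axioms(1),
        THEN abelian_monoid.zero_closed, of i]
    by (auto simp: Ext_cochains_def intro!: image_eqI[of _ _ "\<zero>\<^bsub>Hom_module R (res_module R M i) N\<^esub>"])
  have "?B +>\<^bsub>?Z\<^esub> ?\<phi> \<in> carrier (Ext R (Suc i) M N)"
    using Z by (auto simp: Ext_def quotient_module_def A_RCOSETS_def' a_r_coset_def' submodule_on_def)
  hence "?B +>\<^bsub>?Z\<^esub> ?\<phi> = ?B"
    using triv by (simp add: Ext_def quotient_module_def)
  moreover have "\<zero>\<^bsub>?C\<^esub> \<oplus>\<^bsub>?C\<^esub> ?\<phi> = ?\<phi>"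
    using Z by (intro C.l_zero) (simp add: Ext_cocycles_def)
  hence "?\<phi> \<in> ?B +>\<^bsub>?Z\<^esub> ?\<phi>"
    using 0 by (force simp: a_r_coset_def' submodule_on_def)
  ultimately have "?\<phi> \<in> ?B" by simp
  then obtain \<psi> where \<psi>: "\<psi> \<in> module_homs R (res_module R M i) N" "?\<phi> = Ext_coboundary R i M \<psi>"
    by (auto simp: Ext_coboundaries_def Ext_cochains_def Hom_module_def)
  have "\<phi> x = \<psi> (res_diff R M i x)" if "x \<in> carrier (res_module R M (Suc i))" for x
    using fun_cong[OF \<psi>(2), of x] that by (simp add: Ext_coboundary_def)
  with module_homs_mod_lin[OF \<psi>(1)]
  show "\<exists>\<psi>. mod_lin R (res_module R M i) N \<psi> \<and>
      (\<forall>x\<in>carrier (res_module R M (Suc i)). \<phi> x = \<psi> (res_diff R M i x))" by blast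
qed

section \<open>Killing a regular element\<close>

definition prod_module :: "('r, 'a) module \<Rightarrow> ('r, 'b) module \<Rightarrow> ('r, 'a \<times> 'b) module" where
  "prod_module M N =
    \<lparr>carrier = carrier M \<times> carrier N, mult = undefined, one = undefined,
     zero = (\<zero>\<^bsub>M\<^esub>, \<zero>\<^bsub>N\<^esub>),
     add = (\<lambda>x y. (fst x \<oplus>\<^bsub>M\<^esub> fst y, snd x \<oplus>\<^bsub>N\<^esub> snd y)),
     smult = (\<lambda>r x. (r \<odot>\<^bsub>M\<^esub> fst x, r \<odot>\<^bsub>N\<^esub> snd x))\<rparr>"

lemma prod_module_simps [simp]:
  "carrier (prod_module M N) = carrier M \<times> carrier N"
  "\<zero>\<^bsub>prod_module M N\<^esub> = (\<zero>\<^bsub>M\<^esub>, \<zero>\<^bsub>N\<^esub>)"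
  "x \<oplus>\<^bsub>prod_module M N\<^esub> y = (fst x \<oplus>\<^bsub>M\<^esub> fst y, snd x \<oplus>\<^bsub>N\<^esub> snd y)"
  "r \<odot>\<^bsub>prod_module M N\<^esub> x = (r \<odot>\<^bsub>M\<^esub> fst x, r \<odot>\<^bsub>N\<^esub> snd x)"
  by (simp_all add: prod_module_def)

lemma prod_module_module:
  assumes "Module.module R M" "Module.module R N"
  shows "Module.module R (prod_module M N)"
proof -
  interpret M: Module.module R M by fact
  interpret N: Module.module R N by fact
  have neg: "\<exists>y\<in>carrier (prod_module M N). y \<oplus>\<^bsub>prod_module M N\<^esub> x = \<zero>\<^bsub>prod_module M N\<^esub>"
    if "x \<in> carrier (prod_module M N)" for x
    using that by (intro bexI[of _ "(\<ominus>\<^bsub>M\<^esub> fst x, \<ominus>\<^bsub>N\<^esub> snd x)"]) (auto simp: M.l_neg N.l_neg)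
  show ?thesis
    by (intro moduleI abelian_groupI M.R.is_cring neg)
       (auto simp: M.a_ac N.a_ac M.smult_l_distr N.smult_l_distr
         M.smult_r_distr N.smult_r_distr M.smult_assoc1 N.smult_assoc1)
qed

lemma mod_lin_fst: "mod_lin R (prod_module M N) M fst"
  and mod_lin_snd: "mod_lin R (prod_module M N) N snd"
  by (auto intro!: mod_linI)

lemma mod_lin_Pair:
  assumes f: "mod_lin R L M f" and g: "mod_lin R L N g"
  shows "mod_lin R L (prod_module M N) (\<lambda>x. (f x, g x))"
  by (rule mod_linI) (auto simp: mod_linD[OF f] mod_linD[OF g])

lemma mod_lin_const_zero:
  assumes "Module.module R N"
  shows "mod_lin R M N (\<lambda>x. \<zero>\<^bsub>N\<^esub>)"
proof -
  interpret N: Module.module R N by fact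
  show ?thesis by (rule mod_linI) auto
qed

lemma mod_lin_smult:
  assumes "Module.module R M" "x \<in> carrier R"
  shows "mod_lin R M M (\<lambda>v. x \<odot>\<^bsub>M\<^esub> v)"
proof -
  interpret M: Module.module R M by fact
  show ?thesis
    using assms(2)
    by (intro mod_linI) (auto simp: M.smult_r_distr M.smult_assoc1[symmetric] M.R.m_comm)
qed

lemma mod_lin_uminus:
  assumes "Module.module R M"
  shows "mod_lin R M M (\<lambda>v. \<ominus>\<^bsub>M\<^esub> v)"
proof -
  interpret M: Module.module R M by fact
  show ?thesis by (intro mod_linI) (auto simp: M.minus_add M.smult_r_minus)
qed

lemma mod_lin_neg:
  assumes "Module.module R M" "Module.module R N" "mod_lin R M N f" "x \<in> carrier M"
  shows "f (\<ominus>\<^bsub>M\<^esub> x) = \<ominus>\<^bsub>N\<^esub> f x"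
proof -
  interpret M: Module.module R M by fact
  interpret N: Module.module R N by fact
  show ?thesis
    using mod_lin_minus[OF assms(1-3) M.zero_closed assms(4)] mod_linD(1)[OF assms(3,4)]
    by (simp add: M.minus_eq N.minus_eq mod_lin_zero[OF assms(1-3)] assms(4))
qed

text \<open>The map is lifted on each factor separately, and the two lifts are added after
  projecting.\<close>

lemma lifts_prod_module:
  assumes P: "Module.module R P" "Module.module R P'" and M: "Module.module R M" "Module.module R N"
    and l: "lifts R P M N" "lifts R P' M N"
  shows "lifts R (prod_module P P') M N"
  unfolding lifts_def
proof (intro allI impI)
  interpret P: Module.module R P by (rule P)
  interpret P': Module.module R P' by (rule P)
  fix f g
  assume f: "mod_lin R (prod_module P P') N f" and g: "mod_lin R M N g"
    and sub: "f ` carrier (prod_module P P') \<subseteq> g ` carrier M"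
  have f1: "mod_lin R P N (\<lambda>x. f (x, \<zero>\<^bsub>P'\<^esub>))"
    by (rule mod_lin_comp[OF mod_lin_Pair[OF mod_lin_id mod_lin_const_zero[OF P(2)]] f])
  have f2: "mod_lin R P' N (\<lambda>x. f (\<zero>\<^bsub>P\<^esub>, x))"
    by (rule mod_lin_comp[OF mod_lin_Pair[OF mod_lin_const_zero[OF P(1)] mod_lin_id] f])
  obtain h1 where h1: "mod_lin R P M h1" "\<And>x. x \<in> carrier P \<Longrightarrow> g (h1 x) = f (x, \<zero>\<^bsub>P'\<^esub>)"
    by (rule liftsE[OF l(1) f1 g]) (use sub in auto)
  obtain h2 where h2: "mod_lin R P' M h2" "\<And>x. x \<in> carrier P' \<Longrightarrow> g (h2 x) = f (\<zero>\<^bsub>P\<^esub>, x)"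
    by (rule liftsE[OF l(2) f2 g]) (use sub in auto)
  let ?h = "\<lambda>x. h1 (fst x) \<oplus>\<^bsub>M\<^esub> h2 (snd x)"
  have "g (?h x) = f x" if "x \<in> carrier (prod_module P P')" for x
    using that mod_linD(2)[OF f, of "(fst x, \<zero>\<^bsub>P'\<^esub>)" "(\<zero>\<^bsub>P\<^esub>, snd x)"]
    by (auto simp: mod_linD(2)[OF g] mod_linD(1)[OF h1(1)] mod_linD(1)[OF h2(1)] h1(2) h2(2))
  moreover have "mod_lin R (prod_module P P') M ?h"
    by (intro mod_lin_add M mod_lin_comp[OF mod_lin_fst h1(1)] mod_lin_comp[OF mod_lin_snd h2(1)])
  ultimately show "\<exists>h. mod_lin R (prod_module P P') M h \<and>
      (\<forall>x\<in>carrier (prod_module P P'). g (h x) = f x)" by blast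
qed

text \<open>The zero module on the element type of \<open>M\<close>. It fills the empty slot in
  degree 0 of the cone, whose terms must all have elements of type
  \<open>'a \<times> 'a\<close>.\<close>

definition zero_submodule :: "('r, 'a) module \<Rightarrow> ('r, 'a) module" where
  "zero_submodule M = submodule_on {\<zero>\<^bsub>M\<^esub>} M"

lemma zero_submodule_simps [simp]:
  "carrier (zero_submodule M) = {\<zero>\<^bsub>M\<^esub>}" "\<zero>\<^bsub>zero_submodule M\<^esub> = \<zero>\<^bsub>M\<^esub>"
  "add (zero_submodule M) = add M" "smult (zero_submodule M) = smult M"
  by (simp_all add: zero_submodule_def submodule_on_def)

lemma zero_submodule_module:
  assumes "Module.module R M"
  shows "Module.module R (zero_submodule M)"
proof -
  interpret M: Module.module R M by fact
  show ?thesis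
    unfolding zero_submodule_def by (rule submodule_on_module[OF assms]) auto
qed

lemma lifts_zero_submodule:
  assumes "Module.module R P" "Module.module R M" "Module.module R N"
  shows "lifts R (zero_submodule P) M N"
  unfolding lifts_def
proof (intro allI impI)
  fix f g assume f: "mod_lin R (zero_submodule P) N f" and g: "mod_lin R M N g"
  show "\<exists>h. mod_lin R (zero_submodule P) M h \<and> (\<forall>x\<in>carrier (zero_submodule P). g (h x) = f x)"
    using mod_lin_zero[OF zero_submodule_module[OF assms(1)] assms(3) f] mod_lin_zero[OF assms(2,3) g]
    by (intro exI[of _ "\<lambda>_. \<zero>\<^bsub>M\<^esub>"]) (auto intro: mod_lin_const_zero assms)
qed

section \<open>The mapping cone of multiplication by a ring element\<close>

text \<open>\<open>P\<close> plus its shift by one degree; the zero module stands for the missing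
  term in degree -1.\<close>

definition cone_module :: "(nat \<Rightarrow> ('r, 'a) module) \<Rightarrow> nat \<Rightarrow> ('r, 'a \<times> 'a) module" where
  "cone_module P i =
     prod_module (P i) (case i of 0 \<Rightarrow> zero_submodule (P 0) | Suc j \<Rightarrow> P j)"

text \<open>The cone differential from degree \<open>Suc i\<close> to degree \<open>i\<close>; the
  minus sign makes the two contributions \<open>x d b\<close> to its square cancel. For
  \<open>i = 0\<close> the second component takes values in the zero module, hence the
  constant.\<close>

definition cone_diff ::
    "'r \<Rightarrow> (nat \<Rightarrow> ('r, 'a) module) \<Rightarrow> (nat \<Rightarrow> 'a \<Rightarrow> 'a) \<Rightarrow> nat \<Rightarrow> 'a \<times> 'a \<Rightarrow> 'a \<times> 'a" where
  "cone_diff x P d i v =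
     (d i (fst v) \<oplus>\<^bsub>P i\<^esub> x \<odot>\<^bsub>P i\<^esub> snd v,
      case i of 0 \<Rightarrow> \<zero>\<^bsub>P 0\<^esub> | Suc j \<Rightarrow> \<ominus>\<^bsub>P j\<^esub> d j (snd v))"

lemma cone_module_module:
  assumes "\<And>i. Module.module R (P i)"
  shows "Module.module R (cone_module P i)"
  unfolding cone_module_def
  by (cases i) (auto intro: prod_module_module zero_submodule_module assms)

lemma lifts_cone_module:
  assumes "\<And>i. Module.module R (P i)" "Module.module R M" "Module.module R N"
    and "\<And>i. lifts R (P i) M N"
  shows "lifts R (cone_module P i) M N"
  unfolding cone_module_def
  by (cases i) (auto intro!: lifts_prod_module lifts_zero_submodule zero_submodule_module assms)

text \<open>Since \<open>P\<close> is exact, the homology of the cone is \<open>M / x M\<close> in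
  degree 0, the kernel of \<open>x\<close> on \<open>M\<close> in degree 1, and zero above.
  Regularity kills the degree 1 part, and \<open>p\<close> identifies \<open>M / x M\<close> with
  \<open>M'\<close>.\<close>

lemma cone_resolves:
  assumes P: "resolves R M P e d" and M': "Module.module R M'" and x: "x \<in> carrier R"
    and reg: "\<And>m. m \<in> carrier M \<Longrightarrow> x \<odot>\<^bsub>M\<^esub> m = \<zero>\<^bsub>M\<^esub> \<Longrightarrow> m = \<zero>\<^bsub>M\<^esub>"
    and p: "mod_lin R M M' p" "p ` carrier M = carrier M'"
    and ker: "{m \<in> carrier M. p m = \<zero>\<^bsub>M'\<^esub>} = (\<lambda>m. x \<odot>\<^bsub>M\<^esub> m) ` carrier M"
  shows "resolves R M' (cone_module P) (\<lambda>v. p (e (fst v))) (cone_diff x P d)"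
proof -
  note PD = resolvesD[OF P]
  note e = mod_linD[OF PD(3)] and d = mod_linD[OF PD(4)]
  interpret M: Module.module R M by (rule PD)
  interpret M': Module.module R M' by (rule M')
  interpret P: Module.module R "P j" for j by (rule PD)
  \<comment> \<open>Exactness comes down to this: the second entry \<open>b\<close> of a preimage is
    prescribed, and the first one is found from \<open>d a' = a - x b\<close>.\<close>
  have lift: "\<exists>a'\<in>carrier (P (Suc i)). \<exists>b'\<in>carrier (P i).
      d i a' \<oplus>\<^bsub>P i\<^esub> x \<odot>\<^bsub>P i\<^esub> b' = a \<and> b' = b"
    if ab: "a \<in> carrier (P i)" "b \<in> carrier (P i)"
      "a \<ominus>\<^bsub>P i\<^esub> x \<odot>\<^bsub>P i\<^esub> b \<in> d i ` carrier (P (Suc i))" for i a b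
  proof -
    obtain a' where a': "a' \<in> carrier (P (Suc i))" "d i a' = a \<ominus>\<^bsub>P i\<^esub> x \<odot>\<^bsub>P i\<^esub> b"
      using ab(3) by auto
    have "d i a' \<oplus>\<^bsub>P i\<^esub> x \<odot>\<^bsub>P i\<^esub> b = a"
      using ab x by (simp add: a'(2) P.minus_eq P.a_assoc P.l_neg)
    then show ?thesis using a'(1) ab(2) by blast
  qed
  \<comment> \<open>If \<open>d a + x d b = 0\<close>, then \<open>a + x b\<close> is a cycle of
    \<open>P\<close>, hence some \<open>d a'\<close>, and \<open>(a', - b)\<close> is a preimage of
    \<open>(a, d b)\<close>.\<close>
  have cd: "cone_diff x P d (Suc i) ` carrier (cone_module P (Suc (Suc i))) \<supseteq>
      {v. fst v \<in> carrier (P (Suc i)) \<and> snd v \<in> d i ` carrier (P (Suc i)) \<and>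
         d i (fst v) \<oplus>\<^bsub>P i\<^esub> x \<odot>\<^bsub>P i\<^esub> snd v = \<zero>\<^bsub>P i\<^esub>}" for i
  proof clarsimp
    fix a b assume a: "a \<in> carrier (P (Suc i))" and b: "b \<in> carrier (P (Suc i))"
      and eq: "d i a \<oplus>\<^bsub>P i\<^esub> x \<odot>\<^bsub>P i\<^esub> d i b = \<zero>\<^bsub>P i\<^esub>"
    let ?b = "\<ominus>\<^bsub>P (Suc i)\<^esub> b"
    have b': "?b \<in> carrier (P (Suc i))" using b by simp
    have "d i (a \<ominus>\<^bsub>P (Suc i)\<^esub> x \<odot>\<^bsub>P (Suc i)\<^esub> ?b) = d i a \<oplus>\<^bsub>P i\<^esub> x \<odot>\<^bsub>P i\<^esub> d i b"
      using a b x d(1)[OF b]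
      by (simp add: P.minus_eq P.smult_r_minus d)
    with eq have "a \<ominus>\<^bsub>P (Suc i)\<^esub> x \<odot>\<^bsub>P (Suc i)\<^esub> ?b \<in> d (Suc i) ` carrier (P (Suc (Suc i)))"
      using a b x by (simp add: PD(7))
    from lift[OF a b' this] obtain a' where a': "a' \<in> carrier (P (Suc (Suc i)))"
      "d (Suc i) a' \<oplus>\<^bsub>P (Suc i)\<^esub> x \<odot>\<^bsub>P (Suc i)\<^esub> ?b = a" by blast
    then show "(a, d i b) \<in> cone_diff x P d (Suc i) ` carrier (cone_module P (Suc (Suc i)))"
      using b b' mod_lin_neg[OF PD(2) PD(2) PD(4) b] d(1)[OF b]
      by (intro image_eqI[of _ _ "(a', ?b)"]) (auto simp: cone_diff_def cone_module_def)
  qed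
  show ?thesis
    unfolding resolves_def
  proof (intro conjI allI)
    show "Module.module R M'" by (rule M')
    show "Module.module R (cone_module P i)" for i by (rule cone_module_module[OF PD(2)])
    show "mod_lin R (cone_module P 0) M' (\<lambda>v. p (e (fst v)))"
      unfolding cone_module_def by (intro mod_lin_comp[OF mod_lin_comp[OF mod_lin_fst PD(3)] p(1)])
    show "mod_lin R (cone_module P (Suc i)) (cone_module P i) (cone_diff x P d i)" for i
    proof -
      have 1: "mod_lin R (cone_module P (Suc i)) (P i) (\<lambda>v. d i (fst v) \<oplus>\<^bsub>P i\<^esub> x \<odot>\<^bsub>P i\<^esub> snd v)"
        unfolding cone_module_def nat.case
        by (intro mod_lin_add PD(2) mod_lin_comp[OF mod_lin_fst PD(4)]
            mod_lin_comp[OF mod_lin_snd mod_lin_smult[OF PD(2) x]])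
      have 2: "mod_lin R (cone_module P (Suc 0)) (zero_submodule (P 0)) (\<lambda>v. \<zero>\<^bsub>P 0\<^esub>)"
        using mod_lin_const_zero[OF zero_submodule_module[OF PD(2)]] by simp
      have 3: "mod_lin R (cone_module P (Suc (Suc j))) (P j) (\<lambda>v. \<ominus>\<^bsub>P j\<^esub> d j (snd v))" for j
        unfolding cone_module_def nat.case
        by (intro mod_lin_comp[OF mod_lin_comp[OF mod_lin_snd PD(4)] mod_lin_uminus[OF PD(2)]])
      show ?thesis
        unfolding cone_diff_def[abs_def] cone_module_def[of P i]
        by (cases i) (use 1 2 3 in \<open>auto intro!: mod_lin_Pair\<close>)
    qed
    show "(\<lambda>v. p (e (fst v))) ` carrier (cone_module P 0) = carrier M'"
      unfolding p(2)[symmetric] PD(5)[symmetric] by (force simp: cone_module_def image_iff)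
    show "cone_diff x P d 0 ` carrier (cone_module P (Suc 0)) =
        {v \<in> carrier (cone_module P 0). p (e (fst v)) = \<zero>\<^bsub>M'\<^esub>}" (is "?L = ?R")
    proof (intro equalityI subsetI)
      fix v assume "v \<in> ?L"
      then obtain a b where ab: "a \<in> carrier (P (Suc 0))" "b \<in> carrier (P 0)"
        "v = (d 0 a \<oplus>\<^bsub>P 0\<^esub> x \<odot>\<^bsub>P 0\<^esub> b, \<zero>\<^bsub>P 0\<^esub>)"
        by (auto simp: cone_diff_def cone_module_def)
      have "e (fst v) = x \<odot>\<^bsub>M\<^esub> e b"
        using ab x d(1)[OF ab(1)] by (simp add: e PD(8))
      moreover have "x \<odot>\<^bsub>M\<^esub> e b \<in> {m \<in> carrier M. p m = \<zero>\<^bsub>M'\<^esub>}"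
        unfolding ker using e(1)[OF ab(2)] by blast
      ultimately show "v \<in> ?R" using ab x d(1)[OF ab(1)] by (simp add: cone_module_def)
    next
      fix v assume "v \<in> ?R"
      then obtain a where a: "a \<in> carrier (P 0)" "v = (a, \<zero>\<^bsub>P 0\<^esub>)" "p (e a) = \<zero>\<^bsub>M'\<^esub>"
        by (auto simp: cone_module_def)
      have "e a \<in> {m \<in> carrier M. p m = \<zero>\<^bsub>M'\<^esub>}" using a e by simp
      then obtain m where m: "m \<in> carrier M" "e a = x \<odot>\<^bsub>M\<^esub> m" unfolding ker by blast
      obtain b where b: "b \<in> carrier (P 0)" "m = e b"
        using m(1) unfolding PD(5)[symmetric] by blast
      have "e (a \<ominus>\<^bsub>P 0\<^esub> x \<odot>\<^bsub>P 0\<^esub> b) = \<zero>\<^bsub>M\<^esub>"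
        using a(1) b x m e(1)[OF b(1)]
        by (simp add: mod_lin_minus[OF PD(2) PD(1) PD(3)] e M.minus_eq M.r_neg)
      then have "a \<ominus>\<^bsub>P 0\<^esub> x \<odot>\<^bsub>P 0\<^esub> b \<in> d 0 ` carrier (P (Suc 0))"
        using a(1) b(1) x by (simp add: PD(6))
      from lift[OF a(1) b(1) this] show "v \<in> ?L"
        using a(2) b(1) by (force simp: cone_diff_def cone_module_def)
    qed
    fix i
    show "cone_diff x P d (Suc i) ` carrier (cone_module P (Suc (Suc i))) =
        {v \<in> carrier (cone_module P (Suc i)). cone_diff x P d i v = \<zero>\<^bsub>cone_module P i\<^esub>}" (is "?L = ?R")
    proof (intro equalityI subsetI)
      fix v assume "v \<in> ?L"
      then obtain a b where ab: "a \<in> carrier (P (Suc (Suc i)))" "b \<in> carrier (P (Suc i))"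
        "v = (d (Suc i) a \<oplus>\<^bsub>P (Suc i)\<^esub> x \<odot>\<^bsub>P (Suc i)\<^esub> b, \<ominus>\<^bsub>P i\<^esub> d i b)"
        by (auto simp: cone_diff_def cone_module_def)
      have "d i (fst v) \<oplus>\<^bsub>P i\<^esub> x \<odot>\<^bsub>P i\<^esub> snd v = \<zero>\<^bsub>P i\<^esub>"
        using ab x d(1)[OF ab(1)] d(1)[OF ab(2)]
        by (simp add: d PD(9) P.smult_r_minus P.r_neg)
      moreover have "d j (\<ominus>\<^bsub>P (Suc j)\<^esub> d (Suc j) b) = \<zero>\<^bsub>P j\<^esub>" if "i = Suc j" for j
        using ab that d(1)[OF ab(2)]
        by (simp add: mod_lin_neg[OF PD(2) PD(2) PD(4)] PD(9))
      ultimately show "v \<in> ?R" using ab x d(1)[OF ab(1)] d(1)[OF ab(2)]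
        by (cases i) (auto simp: cone_module_def cone_diff_def)
    next
      fix v assume v: "v \<in> ?R"
      then have ab: "fst v \<in> carrier (P (Suc i))" "snd v \<in> carrier (P i)"
        "d i (fst v) \<oplus>\<^bsub>P i\<^esub> x \<odot>\<^bsub>P i\<^esub> snd v = \<zero>\<^bsub>P i\<^esub>"
        by (auto simp: cone_diff_def cone_module_def)
      \<comment> \<open>Regularity enters for \<open>i = 0\<close>: with \<open>b = snd v\<close>,
        applying \<open>e\<close> to the cycle condition gives \<open>x e(b) = 0\<close>, so
        \<open>e(b) = 0\<close>. For larger \<open>i\<close> the second component says that
        \<open>b\<close> is a cycle.\<close>
      have "snd v \<in> d i ` carrier (P (Suc i))"
      proof (cases i)
        case 0
        have "x \<odot>\<^bsub>M\<^esub> e (snd v) = e (d 0 (fst v) \<oplus>\<^bsub>P 0\<^esub> x \<odot>\<^bsub>P 0\<^esub> snd v)"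
          using ab(1,2) x 0 d(1)[of "fst v" 0] by (simp add: e PD(8))
        also have "\<dots> = \<zero>\<^bsub>M\<^esub>" using ab(3) 0 mod_lin_zero[OF PD(2,1,3)] by simp
        finally show ?thesis using reg[OF e(1)] ab(2) 0 by (simp add: PD(6))
      next
        case (Suc j)
        then have "\<ominus>\<^bsub>P j\<^esub> d j (snd v) = \<zero>\<^bsub>P j\<^esub>"
          using v by (auto simp: cone_diff_def cone_module_def)
        then have "d j (snd v) = \<zero>\<^bsub>P j\<^esub>"
          using ab(2) Suc d(1)[of "snd v" j] P.minus_minus[of "d j (snd v)" j] by simp
        then show ?thesis using ab(2) Suc by (simp add: PD(7))
      qed
      with ab show "v \<in> ?L" using cd[of i] by blast
    qed
  qed
qed

text \<open>When \<open>x\<close> kills \<open>N\<close>, the connecting map is injective: composing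
  a cocycle \<open>\<phi>\<close> of \<open>P\<close> with \<open>snd\<close> gives a cocycle of the
  cone one degree up, and if the latter is the coboundary of \<open>\<psi>\<close>, then
  \<open>\<phi>\<close> is the coboundary of \<open>y \<mapsto> \<psi> (0, - y)\<close>.\<close>

lemma cohom_trivial_cone:
  assumes P: "resolves R M P e d" and N: "Module.module R N" and x: "x \<in> carrier R"
    and xN: "\<And>y. y \<in> carrier N \<Longrightarrow> x \<odot>\<^bsub>N\<^esub> y = \<zero>\<^bsub>N\<^esub>"
    and triv: "cohom_trivial R (cone_module P) (cone_diff x P d) (Suc i) N"
  shows "cohom_trivial R P d i N"
  unfolding cohom_trivial_def
proof (intro allI impI)
  note PD = resolvesD[OF P]
  note d = mod_linD[OF PD(4)]
  interpret N: Module.module R N by (rule N)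
  interpret P: Module.module R "P j" for j by (rule PD)
  fix \<phi> assume \<phi>: "mod_lin R (P (Suc i)) N \<phi>"
    and cocycle: "\<forall>v\<in>carrier (P (Suc (Suc i))). \<phi> (d (Suc i) v) = \<zero>\<^bsub>N\<^esub>"
  have "mod_lin R (cone_module P (Suc (Suc i))) N (\<lambda>v. \<phi> (snd v))"
    unfolding cone_module_def nat.case by (rule mod_lin_comp[OF mod_lin_snd \<phi>])
  from cohom_trivialD[OF triv this] cocycle
  obtain \<psi> where \<psi>: "mod_lin R (cone_module P (Suc i)) N \<psi>"
    "\<And>v. v \<in> carrier (cone_module P (Suc (Suc i))) \<Longrightarrow> \<phi> (snd v) = \<psi> (cone_diff x P d (Suc i) v)"
    using d(1) mod_lin_neg[OF PD(2) N \<phi>] by (auto simp: cone_module_def cone_diff_def)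
  have lin: "mod_lin R (P i) N (\<lambda>y. \<psi> (\<zero>\<^bsub>P (Suc i)\<^esub>, \<ominus>\<^bsub>P i\<^esub> y))"
    using mod_lin_comp[OF mod_lin_Pair[OF mod_lin_const_zero[OF PD(2)] mod_lin_uminus[OF PD(2)]]
        \<psi>(1)[unfolded cone_module_def nat.case]] .
  have "\<phi> b = \<psi> (\<zero>\<^bsub>P (Suc i)\<^esub>, \<ominus>\<^bsub>P i\<^esub> d i b)" if b: "b \<in> carrier (P (Suc i))" for b
  proof -
    have c: "(b, \<zero>\<^bsub>P i\<^esub>) \<in> carrier (cone_module P (Suc i))"
      "(\<zero>\<^bsub>P (Suc i)\<^esub>, \<ominus>\<^bsub>P i\<^esub> d i b) \<in> carrier (cone_module P (Suc i))"
      using b d(1)[OF b] by (auto simp: cone_module_def)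
    have "\<phi> b = \<psi> (cone_diff x P d (Suc i) (\<zero>\<^bsub>P (Suc (Suc i))\<^esub>, b))"
      using \<psi>(2)[of "(\<zero>\<^bsub>P (Suc (Suc i))\<^esub>, b)"] b by (simp add: cone_module_def)
    \<comment> \<open>The differential of \<open>(0, b)\<close> is split as
      \<open>x (b, 0) + (0, - d b)\<close>; \<open>\<psi>\<close> sends the first summand to a
      multiple of \<open>x\<close>, which is zero in \<open>N\<close>.\<close>
    also have "cone_diff x P d (Suc i) (\<zero>\<^bsub>P (Suc (Suc i))\<^esub>, b) =
        x \<odot>\<^bsub>cone_module P (Suc i)\<^esub> (b, \<zero>\<^bsub>P i\<^esub>) \<oplus>\<^bsub>cone_module P (Suc i)\<^esub> (\<zero>\<^bsub>P (Suc i)\<^esub>, \<ominus>\<^bsub>P i\<^esub> d i b)"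
      using b x d(1)[OF b] mod_lin_zero[OF PD(2) PD(2) PD(4)]
      by (simp add: cone_diff_def cone_module_def)
    also have "\<psi> \<dots> = x \<odot>\<^bsub>N\<^esub> \<psi> (b, \<zero>\<^bsub>P i\<^esub>) \<oplus>\<^bsub>N\<^esub> \<psi> (\<zero>\<^bsub>P (Suc i)\<^esub>, \<ominus>\<^bsub>P i\<^esub> d i b)"
      using c x Module.module.smult_closed[OF cone_module_module[OF PD(2)] x c(1)]
      by (simp add: mod_linD(2,3)[OF \<psi>(1)])
    also have "\<dots> = \<psi> (\<zero>\<^bsub>P (Suc i)\<^esub>, \<ominus>\<^bsub>P i\<^esub> d i b)"
      using mod_linD(1)[OF \<psi>(1) c(1)] mod_linD(1)[OF \<psi>(1) c(2)] by (simp add: xN)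
    finally show ?thesis .
  qed
  with lin show "\<exists>\<psi>. mod_lin R (P i) N \<psi> \<and> (\<forall>v\<in>carrier (P (Suc i)). \<phi> v = \<psi> (d i v))"
    by blast
qed

text \<open>The standard resolution of \<open>M'\<close> and the cone over that of \<open>M\<close>
  both resolve \<open>M'\<close>. So vanishing passes from the one to the other, and then by
  \<open>cohom_trivial_cone\<close> to \<open>M\<close> in one degree less.\<close>

lemma cohom_trivial_quotient_by_regular:
  assumes M: "Module.module R M" and M': "Module.module R M'" and N: "Module.module R N"
    and x: "x \<in> carrier R"
    and xN: "\<And>y. y \<in> carrier N \<Longrightarrow> x \<odot>\<^bsub>N\<^esub> y = \<zero>\<^bsub>N\<^esub>"
    and reg: "\<And>m. m \<in> carrier M \<Longrightarrow> x \<odot>\<^bsub>M\<^esub> m = \<zero>\<^bsub>M\<^esub> \<Longrightarrow> m = \<zero>\<^bsub>M\<^esub>"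
    and p: "mod_lin R M M' p" "p ` carrier M = carrier M'"
    and ker: "{m \<in> carrier M. p m = \<zero>\<^bsub>M'\<^esub>} = (\<lambda>m. x \<odot>\<^bsub>M\<^esub> m) ` carrier M"
    and triv: "cohom_trivial R (res_module R M') (res_diff R M') (Suc i) N"
  shows "cohom_trivial R (res_module R M) (res_diff R M) i N"
proof -
  interpret M: Module.module R M by (rule M)
  note Pm = res_module_module[OF M.R.is_cring] and P = res_module_resolves
  have lP: "lifts R (res_module R L j) A B" if "Module.module R A" "Module.module R B" for L j A B
    unfolding res_module_def by (rule lifts_free_module[OF that])
  note cm = cone_module_module[OF Pm]
  note lC = lifts_cone_module[OF Pm _ _ lP]
  show ?thesis
    by (rule cohom_trivial_cone[OF P[OF M] N x xN])
       (auto intro!: cohom_trivial_transfer[OF P[OF M'] cone_resolves[OF P[OF M] M' x reg p ker] N]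
         lP lC Pm M' cm triv)
qed

section \<open>Residue class rings as modules\<close>

lemma regular_module_simps [simp]:
  "carrier (regular_module R) = carrier R" "\<zero>\<^bsub>regular_module R\<^esub> = \<zero>\<^bsub>R\<^esub>"
  "add (regular_module R) = add R" "smult (regular_module R) = mult R"
  "a_r_coset (regular_module R) = a_r_coset R"
  "set_add (regular_module R) = set_add R"
  by (simp_all add: regular_module_def a_r_coset_def' set_add_def' fun_eq_iff)

lemma ideal_coset_map:
  assumes "cring R" "ideal I R"
  defines "Q \<equiv> quotient_module (regular_module R) I"
  shows "mod_lin R (regular_module R) Q (\<lambda>x. I +>\<^bsub>R\<^esub> x)"
    and "(\<lambda>x. I +>\<^bsub>R\<^esub> x) ` carrier R = carrier Q"
    and "x \<in> carrier R \<Longrightarrow> I +>\<^bsub>R\<^esub> x = \<zero>\<^bsub>Q\<^esub> \<longleftrightarrow> x \<in> I"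
proof -
  interpret I: ideal I R by fact
  interpret reg: Module.module R "regular_module R" by (rule regular_module_module[OF assms(1)])
  have carrier: "carrier Q = (\<lambda>x. I +>\<^bsub>R\<^esub> x) ` carrier R"
    by (auto simp: Q_def quotient_module_def A_RCOSETS_def' a_r_coset_def')
  show "(\<lambda>x. I +>\<^bsub>R\<^esub> x) ` carrier R = carrier Q" by (simp add: carrier)
  show "mod_lin R (regular_module R) Q (\<lambda>x. I +>\<^bsub>R\<^esub> x)"
  proof (rule mod_linI)
    fix r x assume "r \<in> carrier R" "x \<in> carrier (regular_module R)"
    then show "I +>\<^bsub>R\<^esub> (r \<odot>\<^bsub>regular_module R\<^esub> x) = r \<odot>\<^bsub>Q\<^esub> (I +>\<^bsub>R\<^esub> x)"
      using quotient_module_module(2)[OF reg.module_axioms, of I x r] I.a_subset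
      by (simp add: Q_def I.I_l_closed)
  qed (use carrier in \<open>simp_all add: Q_def quotient_module_def I.a_rcos_sum\<close>)
  show "I +>\<^bsub>R\<^esub> x = \<zero>\<^bsub>Q\<^esub> \<longleftrightarrow> x \<in> I" if "x \<in> carrier R"
    using that I.a_rcos_self[OF that] I.a_rcos_const[of x] by (auto simp: Q_def quotient_module_def)
qed

text \<open>\<open>R/I'\<close> is the quotient of \<open>R/I\<close> by \<open>x\<close>, which is
  regular on \<open>R/I\<close>; this restates the degree shift for cyclic modules in terms of
  ideals.\<close>

lemma cohom_trivial_quotient_ring:
  assumes R: "cring R" and I: "ideal I R" and I': "ideal I' R" and N: "Module.module R N"
    and x: "x \<in> carrier R" and xN: "\<And>y. y \<in> carrier N \<Longrightarrow> x \<odot>\<^bsub>N\<^esub> y = \<zero>\<^bsub>N\<^esub>"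
    and I'_eq: "I' = {s \<oplus>\<^bsub>R\<^esub> x \<otimes>\<^bsub>R\<^esub> r |s r. s \<in> I \<and> r \<in> carrier R}"
    and regular: "\<And>r. r \<in> carrier R \<Longrightarrow> x \<otimes>\<^bsub>R\<^esub> r \<in> I \<Longrightarrow> r \<in> I"
    and triv: "cohom_trivial R (res_module R (quotient_module (regular_module R) I'))
      (res_diff R (quotient_module (regular_module R) I')) (Suc i) N"
  shows "cohom_trivial R (res_module R (quotient_module (regular_module R) I))
      (res_diff R (quotient_module (regular_module R) I)) i N"
proof -
  interpret cring R by (rule R)
  interpret I: ideal I R by (rule I)
  interpret I': ideal I' R by (rule I')
  define M where "M = quotient_module (regular_module R) I"
  define M' where "M' = quotient_module (regular_module R) I'"
  note c = ideal_coset_map[OF R I, folded M_def] and c' = ideal_coset_map[OF R I', folded M'_def]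
  have M: "Module.module R M" and M': "Module.module R M'"
    unfolding M_def M'_def by (rule ideal_quotient_module[OF R I] ideal_quotient_module[OF R I'])+
  interpret reg: Module.module R "regular_module R" by (rule regular_module_module[OF R])
  have sub: "I \<subseteq> I'"
  proof
    fix s assume "s \<in> I"
    then have "s = s \<oplus>\<^bsub>R\<^esub> x \<otimes>\<^bsub>R\<^esub> \<zero>\<^bsub>R\<^esub>" using x I.a_subset by auto
    with \<open>s \<in> I\<close> show "s \<in> I'" unfolding I'_eq by blast
  qed
  \<comment> \<open>Adding \<open>I'\<close> to a coset of \<open>I\<close> enlarges it to a coset
    of \<open>I'\<close>: the projection from \<open>R/I\<close> to \<open>R/I'\<close> without a
    choice of representatives.\<close>
  define p where "p = (\<lambda>X. I' <+>\<^bsub>R\<^esub> X)"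
  have p_coset: "p (I +>\<^bsub>R\<^esub> r) = I' +>\<^bsub>R\<^esub> r" if r: "r \<in> carrier R" for r
  proof -
    have "s' \<oplus>\<^bsub>R\<^esub> (s \<oplus>\<^bsub>R\<^esub> r) \<in> I' +>\<^bsub>R\<^esub> r" if "s' \<in> I'" "s \<in> I" for s s'
    proof -
      have "s' \<oplus>\<^bsub>R\<^esub> (s \<oplus>\<^bsub>R\<^esub> r) = (s' \<oplus>\<^bsub>R\<^esub> s) \<oplus>\<^bsub>R\<^esub> r"
        using that I.a_subset I'.a_subset r by (simp add: a_assoc subset_iff)
      moreover have "s' \<oplus>\<^bsub>R\<^esub> s \<in> I'" using that sub by blast
      ultimately show ?thesis unfolding a_r_coset_def' by blast
    qed
    moreover have "s' \<oplus>\<^bsub>R\<^esub> r \<in> I' <+>\<^bsub>R\<^esub> (I +>\<^bsub>R\<^esub> r)" if "s' \<in> I'" for s'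
    proof -
      have "r = \<zero>\<^bsub>R\<^esub> \<oplus>\<^bsub>R\<^esub> r" using r by simp
      then have "r \<in> I +>\<^bsub>R\<^esub> r" using I.zero_closed unfolding a_r_coset_def' by blast
      with that show ?thesis unfolding set_add_def' by blast
    qed
    ultimately show ?thesis
      unfolding p_def by (auto simp: set_add_def' a_r_coset_def')
  qed
  have Mc: "\<exists>r\<in>carrier R. m = I +>\<^bsub>R\<^esub> r" if "m \<in> carrier M" for m
    using that c(2) by blast
  note lin = mod_linD[OF c(1), simplified] and lin' = mod_linD[OF c'(1), simplified]
  have p_lin: "mod_lin R M M' p"
  proof (rule mod_linI)
    show "p m \<in> carrier M'" if "m \<in> carrier M" for m
      using Mc[OF that] p_coset lin'(1) by auto
    show "p (l \<oplus>\<^bsub>M\<^esub> m) = p l \<oplus>\<^bsub>M'\<^esub> p m" if "l \<in> carrier M" "m \<in> carrier M" for l m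
      using Mc[OF that(1)] Mc[OF that(2)] by (auto simp: p_coset lin' simp flip: lin(2))
    show "p (r \<odot>\<^bsub>M\<^esub> m) = r \<odot>\<^bsub>M'\<^esub> p m" if "r \<in> carrier R" "m \<in> carrier M" for r m
      using Mc[OF that(2)] that(1) by (auto simp: p_coset lin' simp flip: lin(3))
  qed
  have p_surj: "p ` carrier M = carrier M'"
    unfolding c(2)[symmetric] c'(2)[symmetric] image_image by (intro image_cong p_coset refl)
  have ker: "{m \<in> carrier M. p m = \<zero>\<^bsub>M'\<^esub>} = (\<lambda>m. x \<odot>\<^bsub>M\<^esub> m) ` carrier M"
  proof (intro equalityI subsetI)
    fix m assume "m \<in> {m \<in> carrier M. p m = \<zero>\<^bsub>M'\<^esub>}"
    then obtain q where q: "q \<in> carrier R" "m = I +>\<^bsub>R\<^esub> q" "q \<in> I'"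
      using Mc[of m] by (auto simp: p_coset c'(3))
    then obtain s r where s: "s \<in> I" "r \<in> carrier R" "q = s \<oplus>\<^bsub>R\<^esub> x \<otimes>\<^bsub>R\<^esub> r" unfolding I'_eq by blast
    interpret M: Module.module R M by (rule M)
    have "m = x \<odot>\<^bsub>M\<^esub> (I +>\<^bsub>R\<^esub> r)"
      using s x I.a_subset c(3)[of s] lin(1)[OF s(2)] by (auto simp: q(2) lin)
    then show "m \<in> (\<lambda>m. x \<odot>\<^bsub>M\<^esub> m) ` carrier M" using lin(1)[OF s(2)] by blast
  next
    fix m assume "m \<in> (\<lambda>m. x \<odot>\<^bsub>M\<^esub> m) ` carrier M"
    then obtain r where r: "r \<in> carrier R" "m = I +>\<^bsub>R\<^esub> (x \<otimes>\<^bsub>R\<^esub> r)"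
      using Mc x by (auto simp: lin)
    have "x \<otimes>\<^bsub>R\<^esub> r = \<zero>\<^bsub>R\<^esub> \<oplus>\<^bsub>R\<^esub> x \<otimes>\<^bsub>R\<^esub> r" using x r by simp
    then have "x \<otimes>\<^bsub>R\<^esub> r \<in> I'" unfolding I'_eq using r I.zero_closed by blast
    then show "m \<in> {m \<in> carrier M. p m = \<zero>\<^bsub>M'\<^esub>}"
      using r x lin(1)[of "x \<otimes>\<^bsub>R\<^esub> r"] by (simp add: p_coset c'(3))
  qed
  have reg: "m = \<zero>\<^bsub>M\<^esub>" if m: "m \<in> carrier M" "x \<odot>\<^bsub>M\<^esub> m = \<zero>\<^bsub>M\<^esub>" for m
  proof -
    obtain r where r: "r \<in> carrier R" "m = I +>\<^bsub>R\<^esub> r" using Mc[OF m(1)] by blast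
    have "I +>\<^bsub>R\<^esub> (x \<otimes>\<^bsub>R\<^esub> r) = \<zero>\<^bsub>M\<^esub>" using m(2) r x by (simp add: lin)
    then have "x \<otimes>\<^bsub>R\<^esub> r \<in> I" using r x by (simp add: c(3))
    then show ?thesis using regular[OF r(1)] r by (simp add: c(3))
  qed
  show ?thesis
    using cohom_trivial_quotient_by_regular[OF M M' N x xN reg p_lin p_surj ker triv[folded M'_def]]
    unfolding M_def .
qed

section \<open>The telescope resolution\<close>

text \<open>
  If \<open>I\<close> is the union of the principal ideals \<open>(a\<^sub>k)\<close> with \<open>a\<^sub>k = u\<^sub>k a\<^bsub>k+1\<^esub>\<close>, then \<open>R/I\<close> is resolved
  by the telescope \<open>0 \<rightarrow> R\<^bsup>(\<nat>)\<^esup> \<rightarrow> R\<^bsup>(\<nat>)\<^esup> \<rightarrow> R\<close> with \<open>e\<^sub>k \<mapsto> e\<^sub>k - u\<^sub>k e\<^bsub>k+1\<^esub>\<close> and \<open>e\<^sub>k \<mapsto> a\<^sub>k\<close>.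
\<close>

definition telescope_basis :: "nat \<Rightarrow> nat set" where
  "telescope_basis i = (if i = 0 then {0} else if i \<le> 2 then UNIV else {})"

definition telescope_module :: "('r, 'x) ring_scheme \<Rightarrow> nat \<Rightarrow> ('r, nat \<Rightarrow> 'r) module" where
  "telescope_module R i = free_module R (telescope_basis i)"

text \<open>The maps in coordinates: the coefficient of \<open>e_(j+1)\<close> in the sum of all
  \<open>v_k (e_k - u_k e_(k+1))\<close> is \<open>v_(j+1) - u_j v_j\<close>. Degree 0 is free on
  the single index \<open>0\<close>, so for \<open>i = 0\<close> the value is a function on
  \<open>{0}\<close>.\<close>

definition telescope_diff ::
    "('r, 'x) ring_scheme \<Rightarrow> (nat \<Rightarrow> 'r) \<Rightarrow> (nat \<Rightarrow> 'r) \<Rightarrow> nat \<Rightarrow> (nat \<Rightarrow> 'r) \<Rightarrow> nat \<Rightarrow> 'r" where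
  "telescope_diff R a u i v =
     (if i = 0 then (\<lambda>_\<in>{0}. free_lift R UNIV (regular_module R) a v)
      else if i = 1 then (\<lambda>k. case k of 0 \<Rightarrow> v 0 | Suc j \<Rightarrow> v (Suc j) \<ominus>\<^bsub>R\<^esub> u j \<otimes>\<^bsub>R\<^esub> v j)
      else \<zero>\<^bsub>telescope_module R i\<^esub>)"

lemma free_module_UNIV:
  "v \<in> carrier (free_module R (UNIV :: nat set)) \<longleftrightarrow>
     (\<forall>k. v k \<in> carrier R) \<and> (\<exists>m. \<forall>k\<ge>m. v k = \<zero>\<^bsub>R\<^esub>)"
proof -
  have "finite {k. v k \<noteq> \<zero>\<^bsub>R\<^esub>} \<longleftrightarrow> (\<exists>m. \<forall>k\<ge>m. v k = \<zero>\<^bsub>R\<^esub>)"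
    unfolding finite_nat_set_iff_bounded by (auto simp: not_less[symmetric])
  then show ?thesis by (auto simp: free_module_simps PiE_iff)
qed

context
  fixes R :: "('r, 'x) ring_scheme" (structure) and I :: "'r set" and a u :: "nat \<Rightarrow> 'r"
  assumes R: "cring R" and I: "ideal I R"
    and a: "\<And>k. a k \<in> carrier R" and u: "\<And>k. u k \<in> carrier R"
    and step: "\<And>k. a k = u k \<otimes> a (Suc k)"
    and regular: "\<And>k r. r \<in> carrier R \<Longrightarrow> r \<otimes> a k = \<zero> \<Longrightarrow> r = \<zero>"
    and I_eq: "I = {r \<otimes> a k |r k. r \<in> carrier R}"
begin

interpretation cring R by (rule R)
interpretation reg: Module.module R "regular_module R" by (rule regular_module_module[OF R])
interpretation F: Module.module R "free_module R S" for S :: "nat set"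
  by (rule free_module_module[OF R])

abbreviation (input) telescope_aug where
  "telescope_aug \<equiv> \<lambda>v :: nat \<Rightarrow> 'r. I +> v 0"

abbreviation (input) telescope_target where
  "telescope_target \<equiv> quotient_module (regular_module R) I"

lemma telescope_sum:
  assumes v: "v \<in> carrier (free_module R UNIV)" and m: "\<And>k. k > m \<Longrightarrow> v k = \<zero>"
  shows "free_lift R UNIV (regular_module R) a v = (\<Oplus>\<^bsub>regular_module R\<^esub>k\<in>{..m}. v k \<otimes> a k)"
  using free_lift_superset[OF reg.module_axioms, of UNIV a v "{..m}"] v a m
  by (auto simp: not_le[symmetric])

text \<open>The sum collapses because \<open>u_m w_m a_(m+1) = w_m a_m\<close>. \<open>w\<close> may
  have infinite support, so that the formula can later show that a recursively defined
  \<open>w\<close> has finite support.\<close>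

lemma telescope_partial_sum:
  assumes w: "\<And>k. w k \<in> carrier R" and v: "v = telescope_diff R a u 1 w"
  shows "(\<Oplus>\<^bsub>regular_module R\<^esub>k\<in>{..m}. v k \<otimes> a k) = w m \<otimes> a m"
proof (induction m)
  case 0
  show ?case using w a by (simp add: v telescope_diff_def)
next
  case (Suc m)
  have vc: "v k \<in> carrier R" for k using w u by (cases k) (auto simp: v telescope_diff_def)
  have "(\<Oplus>\<^bsub>regular_module R\<^esub>k\<in>{..Suc m}. v k \<otimes> a k) = v (Suc m) \<otimes> a (Suc m) \<oplus> w m \<otimes> a m"
    using vc a by (simp add: atMost_Suc Suc)
  also have "w m \<otimes> a m = (u m \<otimes> w m) \<otimes> a (Suc m)"
    using w[of m] u[of m] a[of "Suc m"] by (subst step) (simp add: m_ac)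
  also have "v (Suc m) \<otimes> a (Suc m) \<oplus> (u m \<otimes> w m) \<otimes> a (Suc m) = w (Suc m) \<otimes> a (Suc m)"
    using w[of m] w[of "Suc m"] u[of m] a[of "Suc m"]
    by (simp add: v telescope_diff_def minus_eq l_distr[symmetric] a_assoc l_neg)
  finally show ?case .
qed

text \<open>Exactness in degree 0 is the description of \<open>I\<close> as a union of principal
  ideals. In degree 1 a preimage is found recursively, and it has finite support since the
  \<open>a_k\<close> are regular. In degree 2 the map is unitriangular, hence injective.\<close>

lemma telescope_resolves:
  "resolves R telescope_target (telescope_module R) telescope_aug (telescope_diff R a u)"
  unfolding resolves_def
proof (intro conjI allI)
  note coset = ideal_coset_map[OF R I]
  show "Module.module R telescope_target" by (rule ideal_quotient_module[OF R I])
  show "Module.module R (telescope_module R i)" for i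
    unfolding telescope_module_def by (rule F.module_axioms)
  have lin0: "mod_lin R (free_module R {0 :: nat}) (regular_module R) (\<lambda>v. v 0)"
    by (rule mod_linI) (auto simp: free_module_simps)
  show "mod_lin R (telescope_module R 0) telescope_target telescope_aug"
    using mod_lin_comp[OF lin0 coset(1)] by (simp add: telescope_module_def telescope_basis_def)
  show "telescope_aug ` carrier (telescope_module R 0) = carrier telescope_target"
  proof -
    have "x \<in> (\<lambda>v. v 0) ` carrier (free_module R {0 :: nat})" if "x \<in> carrier R" for x
      using that by (intro image_eqI[of _ _ "\<lambda>_\<in>{0}. x"]) (auto simp: free_module_simps)
    moreover have "v 0 \<in> carrier R" if "v \<in> carrier (free_module R {0 :: nat})" for v
      using mod_linD(1)[OF lin0 that] by simp
    ultimately have "(\<lambda>v. v 0) ` carrier (free_module R {0 :: nat}) = carrier R" by blast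
    then show ?thesis
      by (simp add: telescope_module_def telescope_basis_def coset(2)[symmetric]
          image_image[symmetric, of _ "\<lambda>v. v 0"])
  qed
  note lift = module_homs_mod_lin[OF free_lift_hom[OF reg.module_axioms, of UNIV a]]
  have d0: "mod_lin R (free_module R (UNIV :: nat set)) (free_module R {0 :: nat}) (telescope_diff R a u 0)"
    by (rule mod_linI)
       (use mod_linD[OF lift] a in \<open>simp_all add: telescope_diff_def free_module_simps(1)[of _ _ "{0}"]
         free_module_simps(2,3)[of _ "{0}"] cong: restrict_cong\<close>)
  have d1: "mod_lin R (free_module R (UNIV :: nat set)) (free_module R (UNIV :: nat set))
      (telescope_diff R a u 1)"
  proof (rule mod_linI)
    fix v assume v: "v \<in> carrier (free_module R (UNIV :: nat set))"
    then obtain m where m: "\<And>k. k \<ge> m \<Longrightarrow> v k = \<zero>" unfolding free_module_UNIV by blast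
    have "telescope_diff R a u 1 v k = \<zero>" if "k \<ge> Suc m" for k
      using that m u by (cases k) (auto simp: telescope_diff_def minus_eq)
    moreover have "telescope_diff R a u 1 v k \<in> carrier R" for k
      using v u unfolding free_module_UNIV by (simp add: telescope_diff_def split: nat.split)
    ultimately show "telescope_diff R a u 1 v \<in> carrier (free_module R UNIV)"
      unfolding free_module_UNIV by blast
  next
    fix v w assume "v \<in> carrier (free_module R (UNIV :: nat set))" "w \<in> carrier (free_module R (UNIV :: nat set))"
    then have "v k \<in> carrier R" "w k \<in> carrier R" for k unfolding free_module_UNIV by auto
    then show "telescope_diff R a u 1 (v \<oplus>\<^bsub>free_module R UNIV\<^esub> w) =
        telescope_diff R a u 1 v \<oplus>\<^bsub>free_module R UNIV\<^esub> telescope_diff R a u 1 w"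
      using u by (auto simp: telescope_diff_def free_module_simps fun_eq_iff minus_eq r_distr
          minus_add a_ac split: nat.split)
  next
    fix r v assume r: "r \<in> carrier R" and "v \<in> carrier (free_module R (UNIV :: nat set))"
    then have "v k \<in> carrier R" for k unfolding free_module_UNIV by auto
    with r show "telescope_diff R a u 1 (r \<odot>\<^bsub>free_module R UNIV\<^esub> v) =
        r \<odot>\<^bsub>free_module R UNIV\<^esub> telescope_diff R a u 1 v"
      using u by (auto simp: telescope_diff_def free_module_simps fun_eq_iff minus_eq r_distr
          r_minus m_ac split: nat.split)
  qed
  show "mod_lin R (telescope_module R (Suc i)) (telescope_module R i) (telescope_diff R a u i)" for i
  proof -
    consider "i = 0" | "i = 1" | "i \<ge> 2" by linarith
    then show ?thesis
    proof cases
      case 3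
      then have "telescope_diff R a u i = (\<lambda>_. \<zero>\<^bsub>telescope_module R i\<^esub>)"
        by (auto simp: telescope_diff_def)
      then show ?thesis
        using mod_lin_const_zero[OF F.module_axioms] by (simp add: telescope_module_def)
    qed (use d0 d1 in \<open>simp_all add: telescope_module_def telescope_basis_def\<close>)
  qed
  show "telescope_diff R a u 0 ` carrier (telescope_module R (Suc 0)) =
      {v \<in> carrier (telescope_module R 0). I +> v 0 = \<zero>\<^bsub>telescope_target\<^esub>}" (is "?L = ?R")
  proof (intro equalityI subsetI)
    fix v assume "v \<in> ?L"
    then obtain w where w: "w \<in> carrier (free_module R (UNIV :: nat set))" "v = telescope_diff R a u 0 w"
      by (auto simp: telescope_module_def telescope_basis_def)
    obtain m where m: "\<And>k. k > m \<Longrightarrow> w k = \<zero>" using w(1) unfolding free_module_UNIV by (meson less_imp_le)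
    have wc: "w k \<in> carrier R" for k using w(1) unfolding free_module_UNIV by blast
    have "(\<Oplus>\<^bsub>regular_module R\<^esub>k\<in>{..j}. w k \<otimes> a k) \<in> I" for j
    proof (induction j)
      case (Suc j)
      have "w (Suc j) \<otimes> a (Suc j) \<in> I" using wc unfolding I_eq by blast
      with Suc show ?case
        using wc a by (simp add: atMost_Suc ideal.axioms(1)[OF I] additive_subgroup.a_closed)
    qed (use wc a in \<open>auto simp: I_eq\<close>)
    then have "v 0 \<in> I" using telescope_sum[OF w(1) m] by (simp add: w(2) telescope_diff_def)
    moreover have "v \<in> carrier (free_module R {0 :: nat})" using mod_linD(1)[OF d0 w(1)] w(2) by simp
    moreover have "v 0 \<in> carrier R" using mod_linD(1)[OF lin0 calculation(2)] by simp
    ultimately show "v \<in> ?R" by (simp add: coset(3) telescope_module_def telescope_basis_def)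
  next
    fix v assume "v \<in> ?R"
    then have v: "v \<in> carrier (free_module R {0 :: nat})" "I +> v 0 = \<zero>\<^bsub>telescope_target\<^esub>"
      by (auto simp: telescope_module_def telescope_basis_def)
    then have "v 0 \<in> I" using mod_linD(1)[OF lin0 v(1)] by (simp add: coset(3))
    then obtain r k where r: "r \<in> carrier R" "v 0 = r \<otimes> a k" unfolding I_eq by blast
    let ?w = "r \<odot>\<^bsub>free_module R UNIV\<^esub> free_basis R UNIV k"
    have "?w \<in> carrier (free_module R UNIV)"
      by (intro F.smult_closed r free_basis_closed[OF R] UNIV_I)
    moreover have "free_lift R UNIV (regular_module R) a ?w = v 0"
      using r free_basis_closed[OF R, of k UNIV] a
      by (simp add: mod_linD(3)[OF lift] free_lift_basis[OF reg.module_axioms])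
    then have "telescope_diff R a u 0 ?w = v"
      using v(1) by (auto simp: telescope_diff_def free_module_simps(1) PiE_iff extensional_def fun_eq_iff)
    ultimately show "v \<in> ?L" by (force simp: telescope_module_def telescope_basis_def)
  qed
  fix i :: nat
  consider "i = 0" | "i = 1" | "i \<ge> 2" by linarith
  then show "telescope_diff R a u (Suc i) ` carrier (telescope_module R (Suc (Suc i))) =
      {v \<in> carrier (telescope_module R (Suc i)). telescope_diff R a u i v = \<zero>\<^bsub>telescope_module R i\<^esub>}"
      (is "?L = ?R")
  proof cases
    case 1
    show ?thesis
    proof (intro equalityI subsetI)
      fix v assume "v \<in> ?L"
      then obtain w where w: "w \<in> carrier (free_module R (UNIV :: nat set))" "v = telescope_diff R a u 1 w"
        using 1 by (auto simp: telescope_module_def telescope_basis_def)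
      have v: "v \<in> carrier (free_module R (UNIV :: nat set))" using mod_linD(1)[OF d1 w(1)] w(2) by simp
      obtain m1 m2 where m: "\<And>k. k \<ge> m1 \<Longrightarrow> v k = \<zero>" "\<And>k. k \<ge> m2 \<Longrightarrow> w k = \<zero>"
        using v w(1) unfolding free_module_UNIV by blast
      \<comment> \<open>Beyond both supports the partial sum is the whole sum, and \<open>w\<close>
        vanishes there, so the composite of the two differentials is zero.\<close>
      have "free_lift R UNIV (regular_module R) a v = w (max m1 m2) \<otimes> a (max m1 m2)"
        using telescope_sum[OF v, of "max m1 m2"] m telescope_partial_sum[OF _ w(2)] w(1)
        unfolding free_module_UNIV by simp
      then show "v \<in> ?R"
        using v m(2)[of "max m1 m2"] 1 a
        by (auto simp: telescope_diff_def telescope_module_def telescope_basis_def free_module_simps(4))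
    next
      fix v assume "v \<in> ?R"
      then have v: "v \<in> carrier (free_module R (UNIV :: nat set))"
        and d: "telescope_diff R a u 0 v = \<zero>\<^bsub>free_module R {0}\<^esub>"
        using 1 by (auto simp: telescope_module_def telescope_basis_def)
      have 0: "free_lift R UNIV (regular_module R) a v = \<zero>"
        using fun_cong[OF d, of 0] by (simp add: telescope_diff_def free_module_simps(4))
      have vc: "v k \<in> carrier R" for k using v unfolding free_module_UNIV by blast
      \<comment> \<open>The only sequence with \<open>v = telescope_diff R a u 1 w\<close>, solved
        from coordinate \<open>0\<close> upwards.\<close>
      define w where "w = rec_nat (v 0) (\<lambda>k y. v (Suc k) \<oplus> u k \<otimes> y)"
      have w: "w 0 = v 0" "w (Suc k) = v (Suc k) \<oplus> u k \<otimes> w k" for k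
        by (simp_all add: w_def)
      have wc: "w k \<in> carrier R" for k by (induction k) (auto simp: w vc u)
      have vw: "v = telescope_diff R a u 1 w"
      proof
        fix k show "v k = telescope_diff R a u 1 w k"
          using vc wc u
          by (cases k) (simp_all add: telescope_diff_def w minus_eq a_assoc r_neg)
      qed
      obtain m where m: "\<And>k. k \<ge> m \<Longrightarrow> v k = \<zero>" using v unfolding free_module_UNIV by blast
      \<comment> \<open>From \<open>m\<close> on, the partial sums of the \<open>v_k a_k\<close>
        equal the full sum, which is zero; they also equal \<open>w_k a_k\<close>, and
        \<open>a_k\<close> is regular.\<close>
      have "w k = \<zero>" if "k \<ge> m" for k
      proof (rule regular[OF wc])
        show "w k \<otimes> a k = \<zero>"
          using telescope_sum[OF v, of k] m that telescope_partial_sum[OF wc vw, of k] 0 by simp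
      qed
      then have "w \<in> carrier (free_module R UNIV)" unfolding free_module_UNIV using wc by blast
      then show "v \<in> ?L" using 1 vw by (auto simp: telescope_module_def telescope_basis_def)
    qed
  next
    case 2
    have "w = \<zero>\<^bsub>free_module R UNIV\<^esub>"
      if w: "w \<in> carrier (free_module R (UNIV :: nat set))"
        and d: "telescope_diff R a u 1 w = \<zero>\<^bsub>free_module R UNIV\<^esub>" for w
    proof -
      have wc: "w k \<in> carrier R" for k using w unfolding free_module_UNIV by blast
      have "w k = \<zero>" for k
      proof (induction k)
        case 0
        show ?case using fun_cong[OF d, of 0] by (simp add: telescope_diff_def free_module_simps(4))
      next
        case (Suc k)
        then show ?case
          using fun_cong[OF d, of "Suc k"] wc u
          by (simp add: telescope_diff_def free_module_simps(4) minus_eq)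
      qed
      then show ?thesis by (auto simp: free_module_simps(4))
    qed
    moreover have "telescope_diff R a u 1 \<zero>\<^bsub>free_module R UNIV\<^esub> = \<zero>\<^bsub>free_module R UNIV\<^esub>"
      by (rule mod_lin_zero[OF F.module_axioms F.module_axioms d1])
    ultimately have "{v \<in> carrier (free_module R (UNIV :: nat set)).
        telescope_diff R a u 1 v = \<zero>\<^bsub>free_module R UNIV\<^esub>} = {\<zero>\<^bsub>free_module R UNIV\<^esub>}"
      by auto
    \<comment> \<open>The source in degree 3 is the zero module; it has to be nonempty for the
      constant map to have exactly zero as its image.\<close>
    moreover have "carrier (free_module R ({} :: nat set)) \<noteq> {}" using F.M.zero_closed by blast
    ultimately show ?thesis
      using 2 by (simp add: telescope_module_def telescope_basis_def telescope_diff_def numeral_eq_Suc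
          image_constant_conv)
  next
    case 3
    have "carrier (free_module R ({} :: nat set)) = {\<zero>\<^bsub>free_module R {}\<^esub>}"
      by (auto simp: free_module_simps restrict_def)
    then show ?thesis
      using 3 by (auto simp: telescope_module_def telescope_basis_def telescope_diff_def)
  qed
qed

text \<open>A linear map from the free module on \<open>UNIV\<close> to \<open>N\<close> is a
  sequence in \<open>N\<close>. As the telescope stops in degree 2, every sequence \<open>c\<close>
  is a cocycle there, and writing it as a coboundary means solving
  \<open>c_k = b_k - u_k b_(k+1)\<close>. The index \<open>1\<close> stands for cohomology in degree
  2.\<close>

lemma not_cohom_trivial_telescope:
  assumes N: "Module.module R N" and c: "\<And>k :: nat. c k \<in> carrier N"
    and nosol: "\<And>b. (\<And>k. b k \<in> carrier N) \<Longrightarrow>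
      (\<And>k. c k = b k \<ominus>\<^bsub>N\<^esub> u k \<odot>\<^bsub>N\<^esub> b (Suc k)) \<Longrightarrow> False"
  shows "\<not> cohom_trivial R (res_module R telescope_target) (res_diff R telescope_target) 1 N"
proof
  assume triv: "cohom_trivial R (res_module R telescope_target) (res_diff R telescope_target) 1 N"
  interpret N: Module.module R N by (rule N)
  have M: "Module.module R telescope_target" by (rule ideal_quotient_module[OF R I])
  note P = res_module_resolves[OF M]
  have T: "Module.module R (telescope_module R i)" for i
    unfolding telescope_module_def by (rule F.module_axioms)
  have lP: "lifts R (res_module R L j) A B" if "Module.module R A" "Module.module R B" for L j A B
    unfolding res_module_def by (rule lifts_free_module[OF that])
  have lT: "lifts R (telescope_module R j) A B" if "Module.module R A" "Module.module R B" for j A B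
    unfolding telescope_module_def by (rule lifts_free_module[OF that])
  have trivT: "cohom_trivial R (telescope_module R) (telescope_diff R a u) 1 N"
    by (rule cohom_trivial_transfer[OF P telescope_resolves N])
       (auto intro: lP lT T M res_module_module[OF R] triv simp del: One_nat_def)
  let ?F = "free_module R (UNIV :: nat set)"
  let ?\<phi> = "free_lift R UNIV N c"
  have \<phi>: "mod_lin R ?F N ?\<phi>" by (rule module_homs_mod_lin[OF free_lift_hom[OF N c]])
  have "\<exists>\<psi>. mod_lin R (telescope_module R 1) N \<psi> \<and>
      (\<forall>v\<in>carrier (telescope_module R (Suc 1)). ?\<phi> v = \<psi> (telescope_diff R a u 1 v))"
  proof (rule cohom_trivialD[OF trivT])
    show "mod_lin R (telescope_module R (Suc 1)) N ?\<phi>"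
      using \<phi> by (simp add: telescope_module_def telescope_basis_def)
    show "?\<phi> (telescope_diff R a u (Suc 1) v) = \<zero>\<^bsub>N\<^esub>" for v
      using mod_lin_zero[OF F.module_axioms N \<phi>]
      by (simp add: telescope_diff_def telescope_module_def telescope_basis_def)
  qed
  then obtain \<psi> where \<psi>: "mod_lin R ?F N \<psi>"
    "\<And>v. v \<in> carrier ?F \<Longrightarrow> ?\<phi> v = \<psi> (telescope_diff R a u 1 v)"
    by (auto simp: telescope_module_def telescope_basis_def)
  let ?e = "free_basis R (UNIV :: nat set)"
  have e: "?e k \<in> carrier ?F" for k by (rule free_basis_closed[OF R]) simp
  have de: "telescope_diff R a u 1 (?e k) = ?e k \<ominus>\<^bsub>?F\<^esub> u k \<odot>\<^bsub>?F\<^esub> ?e (Suc k)" for k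
  proof -
    have "?e k = telescope_diff R a u 1 (?e k) \<oplus>\<^bsub>?F\<^esub> u k \<odot>\<^bsub>?F\<^esub> ?e (Suc k)"
      using u by (auto simp: telescope_diff_def free_module_simps free_basis_def fun_eq_iff minus_eq
          l_neg split: nat.split)
    moreover have "telescope_diff R a u 1 (?e k) \<in> carrier ?F"
      using mod_linD(1)[OF resolvesD(4)[OF telescope_resolves, of 1], of "?e k"] e
      by (simp add: telescope_module_def telescope_basis_def)
    ultimately show ?thesis
      using e[of "Suc k"] u
      by (metis F.M.a_assoc F.M.a_inv_closed F.M.minus_eq F.M.r_neg F.M.r_zero F.smult_closed)
  qed
  show False
  proof (rule nosol)
    show "\<psi> (?e k) \<in> carrier N" for k by (rule mod_linD(1)[OF \<psi>(1) e])
    have "c k = ?\<phi> (?e k)" for k by (simp add: free_lift_basis[OF N c])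
    also have "?\<phi> (?e k) = \<psi> (?e k) \<ominus>\<^bsub>N\<^esub> u k \<odot>\<^bsub>N\<^esub> \<psi> (?e (Suc k))" for k
      using e u
      by (simp del: One_nat_def
          add: \<psi>(2) de mod_lin_minus[OF F.module_axioms N \<psi>(1)] mod_linD(3)[OF \<psi>(1)])
    finally show "c k = \<psi> (?e k) \<ominus>\<^bsub>N\<^esub> u k \<odot>\<^bsub>N\<^esub> \<psi> (?e (Suc k))" for k .
  qed
qed

end

section \<open>Ideals of real-exponent polynomials\<close>

lemma real_poly_ring_simps [simp]:
  "carrier (real_poly_ring n) = {p. Poly_Mapping.keys p \<subseteq> nonneg_exps n}"
  "mult (real_poly_ring n) = (*)" "\<one>\<^bsub>real_poly_ring n\<^esub> = 1"
  "\<zero>\<^bsub>real_poly_ring n\<^esub> = 0" "add (real_poly_ring n) = (+)"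
  by (simp_all add: real_poly_ring_def)

lemma nonneg_exps_add: "a \<in> nonneg_exps n \<Longrightarrow> b \<in> nonneg_exps n \<Longrightarrow> a + b \<in> nonneg_exps n"
  using Poly_Mapping.keys_add[of a b] by (auto simp: nonneg_exps_def lookup_add)

lemma nonneg_exps_diff_single:
  assumes "a \<in> nonneg_exps n" "i \<in> {1..n}" "s \<le> Poly_Mapping.lookup a i"
  shows "a - Poly_Mapping.single i s \<in> nonneg_exps n"
  using assms
  by (auto simp: nonneg_exps_def lookup_minus lookup_single when_def in_keys_iff split: if_splits)

lemma var_pow_mult: "var_pow i s * var_pow i t = (var_pow i (s + t) :: _ \<Rightarrow>\<^sub>0 'k::field)"
  by (simp add: var_pow_def mult_single single_add)

lemma var_pow_nonzero: "var_pow i s \<noteq> (0 :: _ \<Rightarrow>\<^sub>0 'k::field)"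
  by (simp add: var_pow_def flip: keys_eq_empty)

text \<open>Multiplication by a monomial translates the exponents, and by cancellation no other term
  is moved to \<open>t + b\<close>.\<close>

lemma lookup_single_mult:
  fixes p :: "'a::cancel_comm_monoid_add \<Rightarrow>\<^sub>0 'k::semiring_1"
  shows "Poly_Mapping.lookup (Poly_Mapping.single t 1 * p) (t + b) = Poly_Mapping.lookup p b"
proof (induction p rule: update_induct)
  case (update p a c)
  have "Poly_Mapping.update a c p = Poly_Mapping.single a c + p"
    using update(1)
    by (intro poly_mapping_eqI) (auto simp: lookup_update lookup_add lookup_single in_keys_iff)
  with update show ?case
    by (simp add: distrib_left lookup_add mult_single lookup_single when_def)
qed auto

lemma keys_var_pow_mult:
  fixes p :: "(nat \<Rightarrow>\<^sub>0 real) \<Rightarrow>\<^sub>0 'k::field"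
  shows "Poly_Mapping.keys (var_pow i s * p) = (+) (Poly_Mapping.single i s) ` Poly_Mapping.keys p"
proof
  show "Poly_Mapping.keys (var_pow i s * p) \<subseteq> (+) (Poly_Mapping.single i s) ` Poly_Mapping.keys p"
    using keys_mult[of "var_pow i s" p] by (auto simp: var_pow_def)
qed (auto simp: var_pow_def in_keys_iff lookup_single_mult)

text \<open>The division is done term by term, lowering each exponent of \<open>x_i\<close> by
  \<open>s\<close>.\<close>

lemma real_poly_division:
  fixes p :: "(nat \<Rightarrow>\<^sub>0 real) \<Rightarrow>\<^sub>0 'k::field"
  assumes "Poly_Mapping.keys p \<subseteq> {a \<in> nonneg_exps n. s \<le> Poly_Mapping.lookup a i}" "i \<in> {1..n}"
  shows "\<exists>q. Poly_Mapping.keys q \<subseteq> nonneg_exps n \<and> p = var_pow i s * q"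
  using assms(1)
proof (induction p rule: real_poly_induct)
  case zero
  show ?case by (rule exI[of _ 0]) simp
next
  case (add a c p)
  then obtain q where q: "Poly_Mapping.keys q \<subseteq> nonneg_exps n" "p = var_pow i s * q" by blast
  let ?a = "a - Poly_Mapping.single i s"
  have "?a \<in> nonneg_exps n" using add(1) assms(2) by (intro nonneg_exps_diff_single) auto
  then have "Poly_Mapping.keys (Poly_Mapping.single ?a c + q) \<subseteq> nonneg_exps n"
    using q(1) Poly_Mapping.keys_add[of "Poly_Mapping.single ?a c" q] by (auto split: if_splits)
  moreover have "Poly_Mapping.single a c + p = var_pow i s * (Poly_Mapping.single ?a c + q)"
    by (simp add: q(2) distrib_left var_pow_def mult_single)
  ultimately show ?case by blast
qed

section \<open>The chain of ideals leading from \<open>m1\<close> to \<open>I\<close>\<close>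

text \<open>The exponents of the monomials in the ideal generated by \<open>x_1, ..., x_j\<close>
  and \<open>m1\<close>. A multiple of \<open>x_i\<close> has exponent at least 1 there, whereas
  \<open>m1\<close> contains all positive powers of \<open>x_n\<close>. The case
  \<open>j = 0\<close> gives \<open>m1\<close>, and \<open>j = n - 1\<close> gives
  \<open>I\<close>.\<close>

definition koszul_exps :: "nat \<Rightarrow> nat \<Rightarrow> (nat \<Rightarrow>\<^sub>0 real) set" where
  "koszul_exps n j =
     {a \<in> nonneg_exps n. (\<exists>i\<in>{1..j}. 1 \<le> Poly_Mapping.lookup a i) \<or> 0 < Poly_Mapping.lookup a n}"

text \<open>Describing a monomial ideal by supports turns membership and regularity into conditions
  on single exponents.\<close>

definition koszul_ideal :: "nat \<Rightarrow> nat \<Rightarrow> ((nat \<Rightarrow>\<^sub>0 real) \<Rightarrow>\<^sub>0 'k::field) set" where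
  "koszul_ideal n j = {p. Poly_Mapping.keys p \<subseteq> koszul_exps n j}"

lemma koszul_exps_add:
  assumes "a \<in> nonneg_exps n" "b \<in> koszul_exps n j"
  shows "a + b \<in> koszul_exps n j"
proof -
  have "Poly_Mapping.lookup b i \<le> Poly_Mapping.lookup (a + b) i" for i
    using assms(1) by (simp add: nonneg_exps_def lookup_add)
  then show ?thesis
    using assms nonneg_exps_add[of a n b] unfolding koszul_exps_def
    by (blast intro: order_trans less_le_trans)
qed

lemma koszul_ideal_ideal: "ideal (koszul_ideal n j) (real_poly_ring n :: (_ \<Rightarrow>\<^sub>0 'k::field) ring)"
proof -
  let ?R = "real_poly_ring n :: (_ \<Rightarrow>\<^sub>0 'k) ring"
  interpret cring ?R by (rule cring_real_poly_ring)
  have sub: "koszul_ideal n j \<subseteq> carrier ?R"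
    by (auto simp: koszul_ideal_def koszul_exps_def)
  have mult: "p * q \<in> koszul_ideal n j"
    if "p \<in> carrier ?R" "q \<in> koszul_ideal n j" for p q :: "_ \<Rightarrow>\<^sub>0 'k"
    using that keys_mult[of p q] koszul_exps_add[of _ n _ j] unfolding koszul_ideal_def by fastforce
  have add: "p + q \<in> koszul_ideal n j"
    if "p \<in> koszul_ideal n j" "q \<in> koszul_ideal n j" for p q :: "_ \<Rightarrow>\<^sub>0 'k"
    using that Poly_Mapping.keys_add[of p q] unfolding koszul_ideal_def by blast
  have neg: "\<ominus>\<^bsub>?R\<^esub> p = - p" if "p \<in> carrier ?R" for p
    using that by (intro minus_equality) (auto simp: in_keys_iff)
  show ?thesis
  proof (rule idealI[OF ring_axioms])
    show "subgroup (koszul_ideal n j) (add_monoid ?R)"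
    proof (rule add.subgroupI)
      show "koszul_ideal n j \<subseteq> carrier ?R" by (rule sub)
      have "0 \<in> koszul_ideal n j" by (simp add: koszul_ideal_def)
      then show "koszul_ideal n j \<noteq> {}" by blast
    next
      fix p :: "_ \<Rightarrow>\<^sub>0 'k" assume "p \<in> koszul_ideal n j"
      then show "\<ominus>\<^bsub>?R\<^esub> p \<in> koszul_ideal n j"
        using subsetD[OF sub, of p] neg[of p] by (simp add: koszul_ideal_def)
    qed (use add in auto)
  next
    fix p q :: "_ \<Rightarrow>\<^sub>0 'k" assume "p \<in> koszul_ideal n j" "q \<in> carrier ?R"
    then show "q \<otimes>\<^bsub>?R\<^esub> p \<in> koszul_ideal n j" "p \<otimes>\<^bsub>?R\<^esub> q \<in> koszul_ideal n j"
      using mult[of q p] by (simp_all add: mult.commute)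
  qed
qed

text \<open>A polynomial has finitely many terms. If \<open>x_n\<close> has positive exponent in all
  of them, some \<open>\<epsilon> k\<close> lies below these exponents, and that power of
  \<open>x_n\<close> divides the polynomial.\<close>

lemma koszul_ideal_0:
  fixes \<epsilon> :: "nat \<Rightarrow> real"
  assumes n: "0 < n" and pos: "\<And>k. 0 < \<epsilon> k" and lim: "\<epsilon> \<longlonglongrightarrow> 0"
  shows "koszul_ideal n 0 = {r * var_pow n (\<epsilon> k) |r k. Poly_Mapping.keys r \<subseteq> nonneg_exps n}"
    (is "?L = ?R")
proof (intro equalityI subsetI)
  fix p :: "_ \<Rightarrow>\<^sub>0 'a" assume p: "p \<in> ?L"
  have "eventually (\<lambda>k. \<forall>a\<in>Poly_Mapping.keys p. \<epsilon> k < Poly_Mapping.lookup a n) sequentially"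
    using p by (intro eventually_ball_finite ballI order_tendstoD(2)[OF lim])
      (auto simp: koszul_ideal_def koszul_exps_def)
  then obtain k where k: "\<And>a. a \<in> Poly_Mapping.keys p \<Longrightarrow> \<epsilon> k < Poly_Mapping.lookup a n"
    by (auto simp: eventually_sequentially)
  have "\<exists>q. Poly_Mapping.keys q \<subseteq> nonneg_exps n \<and> p = var_pow n (\<epsilon> k) * q"
    using p k n by (intro real_poly_division) (auto simp: koszul_ideal_def koszul_exps_def less_imp_le)
  then show "p \<in> ?R" by (auto simp: mult.commute)
next
  fix p :: "_ \<Rightarrow>\<^sub>0 'a" assume "p \<in> ?R"
  then obtain r k where r: "Poly_Mapping.keys r \<subseteq> nonneg_exps n" "p = var_pow n (\<epsilon> k) * r"
    by (auto simp: mult.commute)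
  have "Poly_Mapping.single n (\<epsilon> k) \<in> koszul_exps n 0"
    using n pos[of k] by (auto simp: koszul_exps_def nonneg_exps_def lookup_single when_def)
  then show "p \<in> ?L"
    using r koszul_exps_add[of _ n "Poly_Mapping.single n (\<epsilon> k)" 0]
    by (auto simp: koszul_ideal_def keys_var_pow_mult add.commute)
qed

text \<open>The terms are sorted: a monomial of the larger ideal outside the smaller one has
  exponent at least 1 in \<open>x_(j+1)\<close>, so it is a multiple of that variable.\<close>

lemma koszul_ideal_Suc:
  assumes "Suc j < n"
  shows "koszul_ideal n (Suc j) = {s + var_pow (Suc j) 1 * r |s r.
    s \<in> koszul_ideal n j \<and> Poly_Mapping.keys r \<subseteq> nonneg_exps n}" (is "?L = ?R")
proof (intro equalityI subsetI)
  fix p :: "_ \<Rightarrow>\<^sub>0 'a" assume "p \<in> ?L"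
  then have "Poly_Mapping.keys p \<subseteq> koszul_exps n (Suc j)" by (simp add: koszul_ideal_def)
  then show "p \<in> ?R"
  proof (induction p rule: real_poly_induct)
    case zero
    have "0 = 0 + var_pow (Suc j) 1 * 0" "0 \<in> koszul_ideal n j" by (simp_all add: koszul_ideal_def)
    then show ?case by fastforce
  next
    case (add a c p)
    then obtain s r where s: "s \<in> koszul_ideal n j" "Poly_Mapping.keys r \<subseteq> nonneg_exps n"
      "p = s + var_pow (Suc j) 1 * r" by blast
    show ?case
    proof (cases "a \<in> koszul_exps n j")
      case True
      then have "Poly_Mapping.single a c + s \<in> koszul_ideal n j"
        using s(1) Poly_Mapping.keys_add[of "Poly_Mapping.single a c" s]
        by (auto simp: koszul_ideal_def split: if_splits)
      then show ?thesis using s by (force simp: add.assoc)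
    next
      case False
      then have "1 \<le> Poly_Mapping.lookup a (Suc j)" "a \<in> nonneg_exps n"
        using add(1) by (auto simp: koszul_exps_def le_Suc_eq)
      then have "\<exists>q. Poly_Mapping.keys q \<subseteq> nonneg_exps n \<and>
          Poly_Mapping.single a c = var_pow (Suc j) 1 * q"
        using assms by (intro real_poly_division) auto
      then obtain q where q: "Poly_Mapping.keys q \<subseteq> nonneg_exps n"
        "Poly_Mapping.single a c = var_pow (Suc j) 1 * q" by blast
      have "Poly_Mapping.keys (q + r) \<subseteq> nonneg_exps n"
        using q(1) s(2) Poly_Mapping.keys_add[of q r] by blast
      moreover have "Poly_Mapping.single a c + p = s + var_pow (Suc j) 1 * (q + r)"
        by (simp add: q(2) s(3) algebra_simps)
      ultimately show ?thesis using s(1) by blast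
    qed
  qed
next
  fix p :: "_ \<Rightarrow>\<^sub>0 'a" assume "p \<in> ?R"
  then obtain s r where s: "s \<in> koszul_ideal n j" "Poly_Mapping.keys r \<subseteq> nonneg_exps n"
    "p = s + var_pow (Suc j) 1 * r" by blast
  have "Poly_Mapping.single (Suc j) 1 \<in> koszul_exps n (Suc j)"
    using assms by (auto simp: koszul_exps_def nonneg_exps_def lookup_single when_def)
  then have "Poly_Mapping.keys (var_pow (Suc j) 1 * r) \<subseteq> koszul_exps n (Suc j)"
    using s(2) koszul_exps_add[of _ n "Poly_Mapping.single (Suc j) 1" "Suc j"]
    by (auto simp: keys_var_pow_mult add.commute)
  moreover have "Poly_Mapping.keys s \<subseteq> koszul_exps n (Suc j)"
    using s(1) by (force simp: koszul_ideal_def koszul_exps_def)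
  ultimately show "p \<in> ?L"
    using Poly_Mapping.keys_add[of s "var_pow (Suc j) 1 * r"] by (auto simp: koszul_ideal_def s(3))
qed

text \<open>Multiplication by \<open>x_(j+1)\<close> changes no exponent on which membership
  depends, since \<open>j + 1\<close> is neither among \<open>1, ..., j\<close> nor equal to
  \<open>n\<close>.\<close>

lemma koszul_ideal_regular:
  assumes "Suc j < n" "Poly_Mapping.keys r \<subseteq> nonneg_exps n" "var_pow (Suc j) 1 * r \<in> koszul_ideal n j"
  shows "r \<in> koszul_ideal n j"
  unfolding koszul_ideal_def
proof (intro CollectI subsetI)
  fix a assume a: "a \<in> Poly_Mapping.keys r"
  then have "Poly_Mapping.single (Suc j) 1 + a \<in> koszul_exps n j"
    using assms(3) by (auto simp: koszul_ideal_def keys_var_pow_mult)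
  moreover have "Poly_Mapping.lookup (Poly_Mapping.single (Suc j) 1 + a) i = Poly_Mapping.lookup a i"
    if "i \<noteq> Suc j" for i
    using that by (simp add: lookup_add lookup_single)
  ultimately show "a \<in> koszul_exps n j"
    using a assms(1,2) by (auto simp: koszul_exps_def)
qed

text \<open>The generators satisfy the exponent condition; conversely, each term that satisfies it
  is a multiple of a single generator.\<close>

lemma koszul_ideal_eq:
  fixes n :: nat
  defines "R \<equiv> real_poly_ring n :: (_ \<Rightarrow>\<^sub>0 'k::field) ring"
  assumes n: "0 < n"
  shows "Idl\<^bsub>R\<^esub> {var_pow i 1 |i. 1 \<le> i \<and> i \<le> n - 1} <+>\<^bsub>R\<^esub> Idl\<^bsub>R\<^esub> {var_pow n \<delta> |\<delta>. 0 < \<delta>}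
    = koszul_ideal n (n - 1)" (is "?J <+>\<^bsub>R\<^esub> ?m = ?K")
proof -
  interpret cring R unfolding R_def by (rule cring_real_poly_ring)
  have gens: "{var_pow i 1 |i. 1 \<le> i \<and> i \<le> n - 1} \<subseteq> carrier R" "{var_pow n \<delta> |\<delta>. 0 < \<delta>} \<subseteq> carrier R"
    unfolding R_def using n var_pow_closed[of _ n, where ?'a = 'k] by (auto simp del: real_poly_ring_simps)
  interpret J: ideal ?J R by (rule genideal_ideal[OF gens(1)])
  interpret m: ideal ?m R by (rule genideal_ideal[OF gens(2)])
  interpret K: ideal ?K R unfolding R_def by (rule koszul_ideal_ideal)
  interpret S: ideal "?J <+>\<^bsub>R\<^esub> ?m" R by (rule add_ideals[OF J.ideal_axioms m.ideal_axioms])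
  have "?J \<subseteq> ?K"
    by (rule genideal_minimal[OF K.ideal_axioms])
       (auto simp: koszul_ideal_def var_pow_def koszul_exps_def nonneg_exps_def lookup_single when_def)
  moreover have "?m \<subseteq> ?K"
    using n by (intro genideal_minimal[OF K.ideal_axioms])
      (auto simp: koszul_ideal_def var_pow_def koszul_exps_def nonneg_exps_def lookup_single when_def)
  ultimately have "?J <+>\<^bsub>R\<^esub> ?m \<subseteq> ?K"
    unfolding set_add_def' using K.a_closed by blast
  moreover have "p \<in> ?J <+>\<^bsub>R\<^esub> ?m" if "Poly_Mapping.keys p \<subseteq> koszul_exps n (n - 1)" for p
    using that
  proof (induction p rule: real_poly_induct)
    case zero
    show ?case using S.zero_closed by (simp add: R_def)
  next
    case (add a c p)
    have div: "\<exists>q\<in>carrier R. Poly_Mapping.single a c = var_pow i s * q"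
      if "s \<le> Poly_Mapping.lookup a i" "i \<in> {1..n}" for i s
    proof -
      have "\<exists>q. Poly_Mapping.keys q \<subseteq> nonneg_exps n \<and> Poly_Mapping.single a c = var_pow i s * q"
        using that add(1) by (intro real_poly_division) (auto simp: koszul_exps_def)
      then show ?thesis by (auto simp: R_def)
    qed
    have "Poly_Mapping.single a c \<in> ?J <+>\<^bsub>R\<^esub> ?m"
    proof (cases "0 < Poly_Mapping.lookup a n")
      case True
      obtain q where q: "q \<in> carrier R"
        "Poly_Mapping.single a c = var_pow n (Poly_Mapping.lookup a n) * q"
        using div[of "Poly_Mapping.lookup a n" n] n by auto
      have "var_pow n (Poly_Mapping.lookup a n) \<in> ?m"
        using True by (intro subsetD[OF genideal_self[OF gens(2)]]) blast
      from m.I_r_closed[OF this q(1)] have "Poly_Mapping.single a c \<in> ?m" by (simp add: q(2) R_def)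
      then have "0 + Poly_Mapping.single a c \<in> ?J <+>\<^bsub>R\<^esub> ?m"
        using J.zero_closed unfolding set_add_def' by (force simp: R_def)
      then show ?thesis by simp
    next
      case False
      then obtain i where i: "1 \<le> i" "i \<le> n - 1" "1 \<le> Poly_Mapping.lookup a i"
        using add(1) by (auto simp: koszul_exps_def)
      obtain q where q: "q \<in> carrier R" "Poly_Mapping.single a c = var_pow i 1 * q"
        using div[OF i(3)] i(1) le_trans[OF i(2) diff_le_self] by auto
      have "var_pow i 1 \<in> ?J"
        using i by (intro subsetD[OF genideal_self[OF gens(1)]]) blast
      from J.I_r_closed[OF this q(1)] have "Poly_Mapping.single a c \<in> ?J" by (simp add: q(2) R_def)
      then have "Poly_Mapping.single a c + 0 \<in> ?J <+>\<^bsub>R\<^esub> ?m"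
        using m.zero_closed unfolding set_add_def' by (force simp: R_def)
      then show ?thesis by simp
    qed
    from S.a_closed[OF this add(3)] show ?case by (simp add: R_def)
  qed
  ultimately show ?thesis unfolding koszul_ideal_def by blast
qed

section \<open>Coefficients forced by the telescope equations\<close>

lemma keys_principal_ideal:
  fixes q :: "(nat \<Rightarrow>\<^sub>0 real) \<Rightarrow>\<^sub>0 'k::field"
  assumes "q \<in> PIdl\<^bsub>real_poly_ring n\<^esub> (var_pow i s)" "a \<in> Poly_Mapping.keys q"
  shows "s \<le> Poly_Mapping.lookup a i"
proof -
  obtain r where r: "Poly_Mapping.keys r \<subseteq> nonneg_exps n" "q = var_pow i s * r"
    using assms(1) by (auto simp: cgenideal_def mult.commute)
  then show ?thesis
    using assms(2) by (auto simp: keys_var_pow_mult lookup_add nonneg_exps_def)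
qed

text \<open>
  Coordinate \<open>j\<close> of the equations up to index \<open>j + 1\<close> forces the monomial \<open>x\<^bsup>\<epsilon>\<^sub>0\<^esup>\<close> into
  \<open>b\<^sub>0\<close>, as the remaining term has exponents above \<open>\<epsilon>\<^sub>0\<close>.
\<close>

lemma telescope_equations_coeff:
  fixes b :: "nat \<Rightarrow> (nat \<Rightarrow>\<^sub>0 real) \<Rightarrow>\<^sub>0 'k::field" and \<epsilon> :: "nat \<Rightarrow> real"
  assumes b: "\<And>k. b k = (if k = j then var_pow 1 (\<epsilon> j) else 0) + var_pow 1 (\<epsilon> k - \<epsilon> (Suc k)) * b (Suc k)"
    and ideal: "b (Suc j) \<in> PIdl\<^bsub>real_poly_ring 1\<^esub> (var_pow 1 (\<epsilon> j))"
    and less: "\<epsilon> (Suc j) < \<epsilon> j"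
  shows "Poly_Mapping.lookup (b 0) (Poly_Mapping.single 1 (\<epsilon> 0)) = 1"
proof -
  \<comment> \<open>The equations before index \<open>j\<close> are homogeneous in this coordinate,
    so substituting them only accumulates exponents, which telescope to
    \<open>\<epsilon> 0 - \<epsilon> k\<close>.\<close>
  have "b 0 = var_pow 1 (\<epsilon> 0 - \<epsilon> k) * b k" if "k \<le> j" for k
    using that
  proof (induction k)
    case 0
    show ?case by (simp add: var_pow_def flip: single_one)
  next
    case (Suc k)
    then have "b 0 = var_pow 1 (\<epsilon> 0 - \<epsilon> k) * (var_pow 1 (\<epsilon> k - \<epsilon> (Suc k)) * b (Suc k))"
      using b[of k] by simp
    then show ?case by (simp add: mult.assoc[symmetric] var_pow_mult)
  qed
  from this[of j] have "b 0 = var_pow 1 (\<epsilon> 0 - \<epsilon> j) *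
      (var_pow 1 (\<epsilon> j) + var_pow 1 (\<epsilon> j - \<epsilon> (Suc j)) * b (Suc j))"
    using b[of j] by simp
  then have b0: "b 0 = var_pow 1 (\<epsilon> 0) + var_pow 1 (\<epsilon> 0 - \<epsilon> (Suc j)) * b (Suc j)"
    by (simp add: distrib_left mult.assoc[symmetric] var_pow_mult)
  \<comment> \<open>Only this exponent would be shifted to \<open>\<epsilon> 0\<close> in
    \<open>b0\<close>; but all exponents in \<open>b (Suc j)\<close> are at least
    \<open>\<epsilon> j\<close>, which is larger.\<close>
  have "Poly_Mapping.single 1 (\<epsilon> (Suc j)) \<notin> Poly_Mapping.keys (b (Suc j))"
    using keys_principal_ideal[OF ideal] less by (force simp: lookup_single)
  moreover have "Poly_Mapping.single (1 :: nat) (\<epsilon> 0) =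
      Poly_Mapping.single 1 (\<epsilon> 0 - \<epsilon> (Suc j)) + Poly_Mapping.single 1 (\<epsilon> (Suc j))"
    by (simp flip: single_add)
  then have "Poly_Mapping.lookup (var_pow 1 (\<epsilon> 0 - \<epsilon> (Suc j)) * b (Suc j)) (Poly_Mapping.single 1 (\<epsilon> 0))
      = Poly_Mapping.lookup (b (Suc j)) (Poly_Mapping.single 1 (\<epsilon> (Suc j)))"
    unfolding var_pow_def by (simp only: lookup_single_mult)
  ultimately show ?thesis by (simp add: b0 lookup_add var_pow_def in_keys_iff)
qed

section \<open>Climbing from degree 2 for \<open>m1\<close> to degree \<open>n + 1\<close> for
  \<open>I\<close>\<close>

theorem proposition3p4:
  fixes n :: nat
    and R R1 :: "((nat \<Rightarrow>\<^sub>0 real) \<Rightarrow>\<^sub>0 'k::field) ring"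
    and m1 J I :: "((nat \<Rightarrow>\<^sub>0 real) \<Rightarrow>\<^sub>0 'k) set"
    and \<epsilon> :: "nat \<Rightarrow> real"
    and F :: "((nat \<Rightarrow>\<^sub>0 real) \<Rightarrow>\<^sub>0 'k, nat \<Rightarrow> ((nat \<Rightarrow>\<^sub>0 real) \<Rightarrow>\<^sub>0 'k)) module"
  assumes "0 < n"
    and "R = real_poly_ring n"
    and "R1 = real_poly_ring 1"
    and "m1 = Idl\<^bsub>R\<^esub> {var_pow n \<delta> |\<delta>. 0 < \<delta>}"
    and "J = Idl\<^bsub>R\<^esub> {var_pow i 1 |i. 1 \<le> i \<and> i \<le> n - 1}"
    and "I = J <+>\<^bsub>R\<^esub> m1"
    and "\<And>k. 0 < \<epsilon> k"
    and "\<And>k. \<epsilon> (Suc k) < \<epsilon> k"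
    and "\<epsilon> \<longlonglongrightarrow> 0"
    and "F = direct_sum UNIV
              (\<lambda>k. submodule_on (PIdl\<^bsub>R1\<^esub> (var_pow 1 (\<epsilon> k))) (regular_module R1))"
  shows "carrier (Ext R (n + 1) (quotient_module (regular_module R) I)
                    (restrict_scalars (to_last_var n) F))
         \<noteq> {\<zero>\<^bsub>Ext R (n + 1) (quotient_module (regular_module R) I)
                    (restrict_scalars (to_last_var n) F)\<^esub>}"
proof -
  note R_def = assms(2) and R1_def = assms(3) and F_def = assms(10)
  define N where "N = restrict_scalars (to_last_var n) F"
  define L where "L = (koszul_ideal n :: nat \<Rightarrow> ((nat \<Rightarrow>\<^sub>0 real) \<Rightarrow>\<^sub>0 'k) set)"
  define M where "M = (\<lambda>j. quotient_module (regular_module R) (L j))"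
  define G where "G = (\<lambda>k. submodule_on (PIdl\<^bsub>R1\<^esub> (var_pow 1 (\<epsilon> k))) (regular_module R1))"
  have R: "cring R" and R1: "cring R1" unfolding R_def R1_def by (rule cring_real_poly_ring)+
  interpret R1: cring R1 by (rule R1)
  have L: "ideal (L j) R" for j unfolding L_def R_def by (rule koszul_ideal_ideal)
  have I: "I = L (n - 1)"
    using koszul_ideal_eq[OF assms(1), where ?'k = 'k]
    by (simp only: assms(4-6) L_def flip: R_def)
  have gen: "var_pow 1 (\<epsilon> k) \<in> carrier R1" for k
    unfolding R1_def using var_pow_closed[of 1 1 "\<epsilon> k"] assms(7)[of k] by simp
  have F: "Module.module R1 F"
    unfolding F_def by (intro direct_sum_module R1 ideal_module R1.cgenideal_ideal gen)
  have N: "Module.module R N"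
    unfolding N_def using to_last_var_hom(1)[OF assms(1)] R F
    by (intro restrict_scalars_module[of R R1]) (simp_all add: R_def R1_def)
  interpret F: Module.module R1 F by (rule F)
  interpret N: Module.module R N by (rule N)
  have N_simps: "carrier N = carrier F" "add N = add F" "\<zero>\<^bsub>N\<^esub> = \<zero>\<^bsub>F\<^esub>"
    "r \<odot>\<^bsub>N\<^esub> y = to_last_var n r \<odot>\<^bsub>F\<^esub> y" for r y
    by (simp_all add: N_def restrict_scalars_def)
  have F_carrier: "y \<in> carrier F \<longleftrightarrow> (\<forall>k. y k \<in> PIdl\<^bsub>R1\<^esub> (var_pow 1 (\<epsilon> k))) \<and> finite {k. y k \<noteq> 0}" for y
    by (auto simp: F_def direct_sum_def submodule_on_def R1_def PiE_iff)
  have F_add: "(y \<oplus>\<^bsub>F\<^esub> z) k = y k + z k" and F_smult: "(r \<odot>\<^bsub>F\<^esub> y) k = r * y k" for r y z k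
    by (simp_all add: F_def direct_sum_def submodule_on_def R1_def)
  \<comment> \<open>\<open>?triv j i\<close> expresses that Ext of \<open>R / L j\<close> with
    values in \<open>N\<close> vanishes in degree \<open>i + 1\<close>, not
    \<open>i\<close>.\<close>
  let ?triv = "\<lambda>j i. cohom_trivial R (res_module R (M j)) (res_diff R (M j)) i N"
  have vR: "var_pow i s \<in> carrier R" if "1 \<le> i" "i \<le> n" "0 \<le> s" for i s
    unfolding R_def using that by (rule var_pow_closed)
  have "\<not> ?triv 0 1"
    unfolding M_def
  proof (rule not_cohom_trivial_telescope[OF R L])
    let ?a = "\<lambda>k. var_pow n (\<epsilon> k) :: (nat \<Rightarrow>\<^sub>0 real) \<Rightarrow>\<^sub>0 'k"
    \<comment> \<open>The quotient of consecutive generators of \<open>m1\<close>; its exponent is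
      positive because \<open>\<epsilon>\<close> decreases.\<close>
    let ?u = "\<lambda>k. var_pow n (\<epsilon> k - \<epsilon> (Suc k)) :: (nat \<Rightarrow>\<^sub>0 real) \<Rightarrow>\<^sub>0 'k"
    let ?c = "\<lambda>k j. if k = j then var_pow 1 (\<epsilon> j) else 0 :: (nat \<Rightarrow>\<^sub>0 real) \<Rightarrow>\<^sub>0 'k"
    show "?a k \<in> carrier R" for k using assms(1) assms(7)[of k] by (intro vR) auto
    show "?u k \<in> carrier R" for k using assms(1) assms(8)[of k] by (intro vR) auto
    show "?a k = ?u k \<otimes>\<^bsub>R\<^esub> ?a (Suc k)" for k by (simp add: R_def var_pow_mult)
    show "r = \<zero>\<^bsub>R\<^esub>" if "r \<otimes>\<^bsub>R\<^esub> ?a k = \<zero>\<^bsub>R\<^esub>" for r k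
      using that var_pow_nonzero[of n "\<epsilon> k", where ?'k = 'k] by (simp add: R_def)
    show "L 0 = {r \<otimes>\<^bsub>R\<^esub> ?a k |r k. r \<in> carrier R}"
      using koszul_ideal_0[OF assms(1,7,9), where ?'a = 'k] by (simp add: L_def R_def)
    show "Module.module R N" by (rule N)
    show "?c k \<in> carrier N" for k
      unfolding N_simps F_carrier using R1.cgenideal_self[OF gen]
        additive_subgroup.zero_closed[OF ideal.axioms(1)[OF R1.cgenideal_ideal[OF gen]]]
      by (auto simp: R1_def intro: finite_subset[of _ "{k}"])
    fix b assume bN: "\<And>k. b k \<in> carrier N"
      and eq: "\<And>k. ?c k = b k \<ominus>\<^bsub>N\<^esub> ?u k \<odot>\<^bsub>N\<^esub> b (Suc k)"
    have b: "b k = ?c k \<oplus>\<^bsub>N\<^esub> ?u k \<odot>\<^bsub>N\<^esub> b (Suc k)" for k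
      unfolding eq[of k] using bN assms(1) assms(8)[of k] vR[of n "\<epsilon> k - \<epsilon> (Suc k)"]
      by (simp add: N.minus_eq N.a_assoc N.l_neg)
    have eqs: "b k j = ?c k j + var_pow 1 (\<epsilon> k - \<epsilon> (Suc k)) * b (Suc k) j" for k j
      using fun_cong[OF b[of k], of j] by (simp only: N_simps F_add F_smult to_last_var_var_pow(1))
    \<comment> \<open>Each \<open>j\<close> is treated separately, using that the
      \<open>j\<close>-th coordinate of \<open>b (Suc j)\<close> lies in the ideal of the
      \<open>j\<close>-th summand. So all coordinates of \<open>b 0\<close> are nonzero, whereas an
      element of a direct sum has finite support.\<close>
    have "Poly_Mapping.lookup (b 0 j) (Poly_Mapping.single 1 (\<epsilon> 0)) = 1" for j
    proof (rule telescope_equations_coeff[of "\<lambda>k. b k j", OF eqs _ assms(8)])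
      show "b (Suc j) j \<in> PIdl\<^bsub>real_poly_ring 1\<^esub> (var_pow 1 (\<epsilon> j))"
        using bN[of "Suc j"] unfolding N_simps F_carrier R1_def by blast
    qed
    then have "b 0 j \<noteq> 0" for j
      by (metis (no_types) lookup_zero zero_neq_one)
    then show False using bN[of 0] unfolding N_simps F_carrier by simp
  qed
  \<comment> \<open>Adjoining \<open>x_(j+1)\<close> raises the degree by one: it is regular modulo
    \<open>L j\<close>, and it acts as zero on \<open>N\<close>, because \<open>j + 1 < n\<close>
    and so \<open>to_last_var n\<close> sends it to zero.\<close>
  moreover have "?triv j i" if "Suc j < n" "?triv (Suc j) (Suc i)" for j i
    unfolding M_def
  proof (rule cohom_trivial_quotient_ring[OF R L L N])
    show "(var_pow (Suc j) 1 :: _ \<Rightarrow>\<^sub>0 'k) \<in> carrier R" using that(1) by (intro vR) auto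
    show "var_pow (Suc j) 1 \<odot>\<^bsub>N\<^esub> y = \<zero>\<^bsub>N\<^esub>" if "y \<in> carrier N" for y
      using \<open>Suc j < n\<close> that F.smult_l_null[of y] by (simp add: N_simps to_last_var_var_pow(2) R1_def)
    show "L (Suc j) = {s \<oplus>\<^bsub>R\<^esub> var_pow (Suc j) 1 \<otimes>\<^bsub>R\<^esub> r |s r. s \<in> L j \<and> r \<in> carrier R}"
      using koszul_ideal_Suc[OF that(1), where ?'a = 'k] by (simp add: L_def R_def)
    show "r \<in> L j" if "r \<in> carrier R" "var_pow (Suc j) 1 \<otimes>\<^bsub>R\<^esub> r \<in> L j" for r
      using koszul_ideal_regular[OF \<open>Suc j < n\<close>, of r] that by (simp add: L_def R_def)
  qed (use that(2) in \<open>simp add: M_def\<close>)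
  \<comment> \<open>The induction climbs from the pair \<open>(0, 1)\<close> to
    \<open>(n - 1, n)\<close>; the index \<open>n\<close> means Ext in degree
    \<open>n + 1\<close>.\<close>
  ultimately have "\<not> ?triv j (Suc j)" if "j < n" for j
    using that by (induction j) (auto intro: Suc_lessD)
  from this[of "n - 1"] have "\<not> ?triv (n - 1) n" using assms(1) by simp
  moreover have "Module.module R (M j)" for j
    unfolding M_def by (rule ideal_quotient_module[OF R L])
  ultimately show ?thesis
    using Ext_trivial_imp_cohom_trivial[of R "M (n - 1)" N n] N by (auto simp: I M_def N_def)
qed

end
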